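(* Let $\alpha',\beta',\gamma'$ be nonzero real constants and $\Lambda=-\gamma'/(8\beta')$. Consider the metric $$ds^2_{\rm seed}=2H\,du^2-2\,du\,dr+dx^2+dy^2,\qquad H=F(\zeta)+\bar F(\bar\zeta)+\bar\zeta\,G(\zeta)+\zeta\,\bar G(\bar\zeta),\qquad \zeta=x+\mathrm i\,y,$$ where $F$ and $G$ are arbitrary holomorphic functions of $\zeta$. Let $z=p_u u+p_x x+p_y y$ with constants $p_u,p_x,p_y$, $p_x^2+p_y^2\neq0$, and set $L=\Lambda/\big(3(p_x^2+p_y^2)\big)$. Then, for any constant $c$, the metric $d\tilde s^2=\Omega(z)^2\,ds^2_{\rm seed}$ is a solution of the vacuum field equations of quadratic gravity with parameters $\alpha',\beta',\gamma',\Lambda$ for each of the following choices of $\Omega$: (a) if $L<0$: $\displaystyle \Omega(z)=\pm\sqrt{-\frac1L}\;\frac{1}{z-c}$. These solutions are of Weyl type N and traceless Ricci type N and represent AdS waves, which have the Siklos geometry. (b) for any constant $K>0$: $\displaystyle \Omega(z)=K^{1/4}L^{-1/4}\,\mathrm{sn}\!\left(K^{1/4}L^{1/4}(z-c),-1\right)$. These solutions are of Weyl type N and traceless Ricci type II. They involve curvature singularities at zeroes of the function $\mathrm{sn}$ (that is, at $z=c$ and $z=c+P$, where $P$ is the period), since $$\tilde R_{ab}\tilde R^{ab}=\tfrac1{12}\tilde R^2\left(3+\mathrm{sn}^{-8}\!\left(K^{1/4}L^{1/4}(z-c),-1\right)\right),$$ where $\tilde R_{ab}$, $\tilde R=4\Lambda$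 are the Ricci tensor and scalar of $d\tilde s^2$.
   Context: The vacuum field equations of quadratic gravity for a four-dimensional metric $g_{ab}$ are $$\gamma'\left(R_{ab}-\tfrac12 R g_{ab}+\Lambda g_{ab}\right)-4\alpha' B_{ab}+2\beta'\left(R_{ab}-\tfrac14 R g_{ab}+g_{ab}\Box-\nabla_b\nabla_a\right)R=0,$$ where $R_{ab}$, $R$ are the Ricci tensor and scalar, $\Box=g^{ab}\nabla_a\nabla_b$, and $B_{ab}=(\nabla^c\nabla^d+\tfrac12R^{cd})C_{acbd}$ is the Bach tensor with $C_{abcd}$ the Weyl tensor. Signature $(-,+,+,+)$; coordinates $(u,r,x,y)$. The metric is considered where $\Omega$ is defined and nonzero. $\mathrm{sn}(w,-1)$ is the Jacobi elliptic sine with parameter $m=k^2=-1$ (modulus $k=\mathrm i$), i.e. the solution of $(s')^2=1-s^4$ with $s(0)=0$, $s'(0)=1$. For $L<0$ a fixed fourth root $L^{1/4}$ is used (and $L^{-1/4}=1/L^{1/4}$); the resulting $\Omega$ is real. Algebraic types: in a null frame $\ell,n,m^{(2)},m^{(3)}$ ($\ell,n$ null, $\ell^an_a=1$, $m^{(i)}$ orthonormal spacelike and orthogonal to $\ell,n$), a component has boost weight $\mathrm b$ if it scales by $\lambda^{\mathrm b}$ under $\ell\to\lambda\ell$, $n\to\lambda^{-1}n$. The boost order of a tensor with respect to $\ell$ is the maximal boost weight of its nonvanishing components. The Weyl tensor is of type N if for some null $\ell$ it has boost order $-2$; the traceless Ricci tensor $R_{ab}-\tfrac14Rg_{ab}$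 is of type N (type II) if for some null $\ell$ it has boost order $-2$ (respectively $0$); here $\ell\propto\partial_r$. The Siklos geometry (AdS waves) consists of metrics conformal to pp-waves with a conformal factor of the form in (a), i.e. $\text{const}\cdot(z-c)^{-2}$ times a pp-wave metric, with negative cosmological constant.
   Formalization: Weyl type N, and in (a) traceless Ricci type N, are asserted only at points where the respective tensor is nonzero, since it can vanish (e.g. for F = G = 0); the vanishing loci are stated explicitly. *)

theory Defs
  imports "HOL-Complex_Analysis.Complex_Analysis"
begin

no_notation fps_nth (infixl \<open>$\<close> 75)  (* otherwise every vec_nth below is ambiguous *)

text \<open>
  Coordinates \<open>(u, r, x, y)\<close> are the components \<open>1, 2, 3, 4\<close> of a point of \<open>real ^ 4\<close>.
  A metric is given by its matrix of covariant components at every point.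
\<close>

type_synonym point = "real ^ 4"
type_synonym metric = "point \<Rightarrow> real ^ 4 ^ 4"

text \<open>A covariant tensor field of any rank, as a function of the list of its indices.\<close>

type_synonym tensor_field = "point \<Rightarrow> 4 list \<Rightarrow> real"

definition pd :: "4 \<Rightarrow> (point \<Rightarrow> real) \<Rightarrow> point \<Rightarrow> real" where
  "pd a f p = frechet_derivative f (at p) (axis a 1)"

primrec Ck_on :: "nat \<Rightarrow> (point \<Rightarrow> real) \<Rightarrow> point set \<Rightarrow> bool" where
  "Ck_on 0 f U \<longleftrightarrow> continuous_on U f"
| "Ck_on (Suc k) f U \<longleftrightarrow> f differentiable_on U \<and> (\<forall>a. Ck_on k (pd a f) U)"

definition smooth_on :: "(point \<Rightarrow> real) \<Rightarrow> point set \<Rightarrow> bool" where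
  "smooth_on f U \<longleftrightarrow> (\<forall>k. Ck_on k f U)"

definition ip :: "real ^ 4 ^ 4 \<Rightarrow> real ^ 4 \<Rightarrow> real ^ 4 \<Rightarrow> real" where
  "ip G v w = (\<Sum>a\<in>UNIV. \<Sum>b\<in>UNIV. G $ a $ b * v $ a * w $ b)"

definition lorentzian_signature :: "real ^ 4 ^ 4 \<Rightarrow> bool" where
  "lorentzian_signature G \<longleftrightarrow>
     (\<exists>e :: 4 \<Rightarrow> real ^ 4. \<forall>i j. ip G (e i) (e j) = (if i = j then (if i = 1 then -1 else 1) else 0))"

definition lorentzian_metric :: "point set \<Rightarrow> metric \<Rightarrow> bool" where
  "lorentzian_metric U g \<longleftrightarrow> open U \<and>
     (\<forall>a b. smooth_on (\<lambda>p. g p $ a $ b) U) \<and>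
     (\<forall>p\<in>U. transpose (g p) = g p \<and> lorentzian_signature (g p))"

definition ginv :: "metric \<Rightarrow> point \<Rightarrow> 4 \<Rightarrow> 4 \<Rightarrow> real" where
  "ginv g p a b = matrix_inv (g p) $ a $ b"

text \<open>\<open>christoffel g p a b c\<close> is \<open>\<Gamma>\<^sup>a\<^sub>b\<^sub>c\<close>.\<close>

definition christoffel :: "metric \<Rightarrow> point \<Rightarrow> 4 \<Rightarrow> 4 \<Rightarrow> 4 \<Rightarrow> real" where
  "christoffel g p a b c =
     (\<Sum>d\<in>UNIV. ginv g p a d / 2 *
        (pd b (\<lambda>q. g q $ d $ c) p + pd c (\<lambda>q. g q $ d $ b) p - pd d (\<lambda>q. g q $ b $ c) p))"

text \<open>
  The derivative index comes first: \<open>nabla g T p (c # as)\<close> is \<open>\<nabla>\<^sub>c T\<^sub>a\<^sub>s\<close>, so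
  \<open>nabla g (nabla g T) p (c # d # as)\<close> is \<open>\<nabla>\<^sub>c \<nabla>\<^sub>d T\<^sub>a\<^sub>s\<close>.
\<close>

definition nabla :: "metric \<Rightarrow> tensor_field \<Rightarrow> tensor_field" where
  "nabla g T p cs = (let c = hd cs; as = tl cs in
     pd c (\<lambda>q. T q as) p
     - (\<Sum>i<length as. \<Sum>d\<in>UNIV. christoffel g p d c (as ! i) * T p (as[i := d])))"

definition rank0 :: "(point \<Rightarrow> real) \<Rightarrow> tensor_field" where
  "rank0 f p as = f p"

definition rank2 :: "(point \<Rightarrow> 4 \<Rightarrow> 4 \<Rightarrow> real) \<Rightarrow> tensor_field" where
  "rank2 T p as = T p (as ! 0) (as ! 1)"

definition rank4 :: "(point \<Rightarrow> 4 \<Rightarrow> 4 \<Rightarrow> 4 \<Rightarrow> 4 \<Rightarrow> real) \<Rightarrow> tensor_field" where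
  "rank4 T p as = T p (as ! 0) (as ! 1) (as ! 2) (as ! 3)"

text \<open>
  \<open>riemann_up g p a b c d\<close> is \<open>R\<^sup>a\<^sub>b\<^sub>c\<^sub>d\<close>, with the sign for which
  \<open>(\<nabla>\<^sub>c \<nabla>\<^sub>d - \<nabla>\<^sub>d \<nabla>\<^sub>c) V\<^sup>a = R\<^sup>a\<^sub>b\<^sub>c\<^sub>d V\<^sup>b\<close>; the Ricci tensor is \<open>R\<^sup>c\<^sub>a\<^sub>c\<^sub>b\<close>, hence
  anti-de Sitter space has negative scalar curvature.
\<close>

definition riemann_up :: "metric \<Rightarrow> point \<Rightarrow> 4 \<Rightarrow> 4 \<Rightarrow> 4 \<Rightarrow> 4 \<Rightarrow> real" where
  "riemann_up g p a b c d =
     pd c (\<lambda>q. christoffel g q a d b) p - pd d (\<lambda>q. christoffel g q a c b) p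
     + (\<Sum>e\<in>UNIV. christoffel g p a c e * christoffel g p e d b
                 - christoffel g p a d e * christoffel g p e c b)"

definition riemann :: "metric \<Rightarrow> point \<Rightarrow> 4 \<Rightarrow> 4 \<Rightarrow> 4 \<Rightarrow> 4 \<Rightarrow> real" where
  "riemann g p a b c d = (\<Sum>e\<in>UNIV. g p $ a $ e * riemann_up g p e b c d)"

definition ricci :: "metric \<Rightarrow> point \<Rightarrow> 4 \<Rightarrow> 4 \<Rightarrow> real" where
  "ricci g p a b = (\<Sum>c\<in>UNIV. riemann_up g p c a c b)"

definition ricci_scalar :: "metric \<Rightarrow> point \<Rightarrow> real" where
  "ricci_scalar g p = (\<Sum>a\<in>UNIV. \<Sum>b\<in>UNIV. ginv g p a b * ricci g p a b)"

definition ricci_up :: "metric \<Rightarrow> point \<Rightarrow> 4 \<Rightarrow> 4 \<Rightarrow> real" where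
  "ricci_up g p a b = (\<Sum>c\<in>UNIV. \<Sum>d\<in>UNIV. ginv g p a c * ginv g p b d * ricci g p c d)"

definition ricci_square :: "metric \<Rightarrow> point \<Rightarrow> real" where
  "ricci_square g p = (\<Sum>a\<in>UNIV. \<Sum>b\<in>UNIV. ricci g p a b * ricci_up g p a b)"

definition traceless_ricci :: "metric \<Rightarrow> point \<Rightarrow> 4 \<Rightarrow> 4 \<Rightarrow> real" where
  "traceless_ricci g p a b = ricci g p a b - ricci_scalar g p * g p $ a $ b / 4"

definition weyl :: "metric \<Rightarrow> point \<Rightarrow> 4 \<Rightarrow> 4 \<Rightarrow> 4 \<Rightarrow> 4 \<Rightarrow> real" where
  "weyl g p a b c d = riemann g p a b c d
     - (g p $ a $ c * ricci g p b d - g p $ a $ d * ricci g p b c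
        - g p $ b $ c * ricci g p a d + g p $ b $ d * ricci g p a c) / 2
     + ricci_scalar g p * (g p $ a $ c * g p $ b $ d - g p $ a $ d * g p $ b $ c) / 6"

text \<open>\<open>B\<^sub>a\<^sub>b = (\<nabla>\<^sup>c \<nabla>\<^sup>d + R\<^sup>c\<^sup>d / 2) C\<^sub>a\<^sub>c\<^sub>b\<^sub>d\<close>.\<close>

definition bach :: "metric \<Rightarrow> point \<Rightarrow> 4 \<Rightarrow> 4 \<Rightarrow> real" where
  "bach g p a b =
     (\<Sum>c\<in>UNIV. \<Sum>d\<in>UNIV. \<Sum>e\<in>UNIV. \<Sum>f\<in>UNIV.
        ginv g p c e * ginv g p d f * nabla g (nabla g (rank4 (weyl g))) p [e, f, a, c, b, d])
     + (\<Sum>c\<in>UNIV. \<Sum>d\<in>UNIV. ricci_up g p c d * weyl g p a c b d) / 2"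

definition hessian :: "metric \<Rightarrow> (point \<Rightarrow> real) \<Rightarrow> point \<Rightarrow> 4 \<Rightarrow> 4 \<Rightarrow> real" where
  "hessian g f p a b = nabla g (nabla g (rank0 f)) p [a, b]"

definition box :: "metric \<Rightarrow> (point \<Rightarrow> real) \<Rightarrow> point \<Rightarrow> real" where
  "box g f p = (\<Sum>a\<in>UNIV. \<Sum>b\<in>UNIV. ginv g p a b * hessian g f p a b)"

definition quadratic_gravity_vacuum ::
    "real \<Rightarrow> real \<Rightarrow> real \<Rightarrow> real \<Rightarrow> point set \<Rightarrow> metric \<Rightarrow> bool" where
  "quadratic_gravity_vacuum \<alpha>' \<beta>' \<gamma>' \<Lambda> U g \<longleftrightarrow> lorentzian_metric U g \<and>
     (\<forall>p\<in>U. \<forall>a b.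
        \<gamma>' * (ricci g p a b - ricci_scalar g p * g p $ a $ b / 2 + \<Lambda> * g p $ a $ b)
        - 4 * \<alpha>' * bach g p a b
        + 2 * \<beta>' * ((ricci g p a b - ricci_scalar g p * g p $ a $ b / 4) * ricci_scalar g p
                   + g p $ a $ b * box g (ricci_scalar g) p
                   - hessian g (ricci_scalar g) p b a) = 0)"

text \<open>A null frame \<open>e\<close> consists of \<open>\<ell> = e 1\<close>, \<open>n = e 2\<close>, \<open>m\<^sup>(\<^sup>2\<^sup>) = e 3\<close> and \<open>m\<^sup>(\<^sup>3\<^sup>) = e 4\<close>.\<close>

definition null_frame :: "real ^ 4 ^ 4 \<Rightarrow> (4 \<Rightarrow> real ^ 4) \<Rightarrow> bool" where
  "null_frame G e \<longleftrightarrow>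
     ip G (e 1) (e 1) = 0 \<and> ip G (e 2) (e 2) = 0 \<and> ip G (e 1) (e 2) = 1 \<and>
     ip G (e 3) (e 3) = 1 \<and> ip G (e 4) (e 4) = 1 \<and> ip G (e 3) (e 4) = 0 \<and>
     ip G (e 1) (e 3) = 0 \<and> ip G (e 1) (e 4) = 0 \<and>
     ip G (e 2) (e 3) = 0 \<and> ip G (e 2) (e 4) = 0"

definition frame_component :: "(4 list \<Rightarrow> real) \<Rightarrow> (4 \<Rightarrow> real ^ 4) \<Rightarrow> 4 list \<Rightarrow> real" where
  "frame_component T e ks =
     (\<Sum>as | length as = length ks. T as * (\<Prod>j<length ks. e (ks ! j) $ (as ! j)))"

text \<open>
  Under \<open>\<ell> \<rightarrow> \<lambda> \<ell>\<close>, \<open>n \<rightarrow> \<lambda>\<^sup>-\<^sup>1 n\<close> the component obtained by contraction with \<open>e (ks ! 0)\<close>,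
  \<open>e (ks ! 1)\<close>, ... scales by \<open>\<lambda>\<close> to the number of \<open>\<ell>\<close>'s minus the number of \<open>n\<close>'s.
\<close>

definition boost_weight :: "4 list \<Rightarrow> int" where
  "boost_weight ks = int (count_list ks 1) - int (count_list ks 2)"

text \<open>
  \<open>has_boost_order G k T \<ell> b\<close>: the rank \<open>k\<close> tensor \<open>T\<close> has boost order \<open>b\<close> with respect to the
  null vector \<open>\<ell>\<close> of the inner product \<open>G\<close>. The boost order does not depend on how \<open>\<ell>\<close> is completed
  to a null frame. The zero tensor has no boost order.
\<close>

definition has_boost_order ::
    "real ^ 4 ^ 4 \<Rightarrow> nat \<Rightarrow> (4 list \<Rightarrow> real) \<Rightarrow> real ^ 4 \<Rightarrow> int \<Rightarrow> bool" where
  "has_boost_order G k T l b \<longleftrightarrow>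
     (\<exists>e. null_frame G e \<and> e 1 = l \<and>
        (\<exists>ks. length ks = k \<and> frame_component T e ks \<noteq> 0 \<and> boost_weight ks = b) \<and>
        (\<forall>ks. length ks = k \<and> frame_component T e ks \<noteq> 0 \<longrightarrow> boost_weight ks \<le> b))"

definition weyl_boost_order :: "metric \<Rightarrow> point \<Rightarrow> real ^ 4 \<Rightarrow> int \<Rightarrow> bool" where
  "weyl_boost_order g p l b \<longleftrightarrow> has_boost_order (g p) 4 (rank4 (weyl g) p) l b"

definition ricci_boost_order :: "metric \<Rightarrow> point \<Rightarrow> real ^ 4 \<Rightarrow> int \<Rightarrow> bool" where
  "ricci_boost_order g p l b \<longleftrightarrow> has_boost_order (g p) 2 (rank2 (traceless_ricci g) p) l b"

definition weyl_type_N :: "metric \<Rightarrow> point \<Rightarrow> bool" where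
  "weyl_type_N g p \<longleftrightarrow> (\<exists>l. weyl_boost_order g p l (-2))"

definition traceless_ricci_type_N :: "metric \<Rightarrow> point \<Rightarrow> bool" where
  "traceless_ricci_type_N g p \<longleftrightarrow> (\<exists>l. ricci_boost_order g p l (-2))"

definition traceless_ricci_type_II :: "metric \<Rightarrow> point \<Rightarrow> bool" where
  "traceless_ricci_type_II g p \<longleftrightarrow> (\<exists>l. ricci_boost_order g p l 0)"

definition d_r :: "real ^ 4" where
  "d_r = axis 2 1"

text \<open>\<open>2 H(u,x,y) du\<^sup>2 - 2 du dr + dx\<^sup>2 + dy\<^sup>2\<close>\<close>

definition pp_wave :: "(real \<Rightarrow> real \<Rightarrow> real \<Rightarrow> real) \<Rightarrow> metric" where
  "pp_wave H p = (\<chi> a b.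
     if a = 1 \<and> b = 1 then 2 * H (p $ 1) (p $ 3) (p $ 4)
     else if (a = 1 \<and> b = 2) \<or> (a = 2 \<and> b = 1) then -1
     else if (a = 3 \<and> b = 3) \<or> (a = 4 \<and> b = 4) then 1
     else 0)"

definition zeta :: "point \<Rightarrow> complex" where
  "zeta p = Complex (p $ 3) (p $ 4)"

text \<open>
  The conjugate function of \<open>F\<close> takes the value \<open>cnj (F \<zeta>)\<close> at \<open>cnj \<zeta>\<close>. The sum is real,
  so \<open>Re\<close> is only a coercion.
\<close>

definition seed_profile :: "(complex \<Rightarrow> complex) \<Rightarrow> (complex \<Rightarrow> complex) \<Rightarrow> real \<Rightarrow> real \<Rightarrow> real \<Rightarrow> real" where
  "seed_profile F G u x y = (let \<zeta> = Complex x y in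
     Re (F \<zeta> + cnj (F \<zeta>) + cnj \<zeta> * G \<zeta> + \<zeta> * cnj (G \<zeta>)))"

definition seed_metric :: "(complex \<Rightarrow> complex) \<Rightarrow> (complex \<Rightarrow> complex) \<Rightarrow> metric" where
  "seed_metric F G = pp_wave (seed_profile F G)"

definition lin :: "real \<Rightarrow> real \<Rightarrow> real \<Rightarrow> point \<Rightarrow> real" where
  "lin pu px py p = pu * p $ 1 + px * p $ 3 + py * p $ 4"

definition conformal :: "(point \<Rightarrow> real) \<Rightarrow> metric \<Rightarrow> metric" where
  "conformal \<omega> g p = (\<omega> p)\<^sup>2 *\<^sub>R g p"

text \<open>
  The constant \<open>- 3 (p\<^sub>x\<^sup>2 + p\<^sub>y\<^sup>2) / \<Lambda>\<close> multiplying \<open>(z - c)\<^sup>-\<^sup>2\<close> is the one for which the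
  (negative) cosmological constant is \<open>\<Lambda>\<close>.
\<close>

definition siklos_geometry :: "real \<Rightarrow> point set \<Rightarrow> metric \<Rightarrow> bool" where
  "siklos_geometry \<Lambda> U g \<longleftrightarrow> \<Lambda> < 0 \<and>
     (\<exists>H pu px py c. px\<^sup>2 + py\<^sup>2 \<noteq> 0 \<and> lorentzian_metric U (pp_wave H) \<and>
        (\<forall>p\<in>U. lin pu px py p \<noteq> c \<and>
           g p = (- 3 * (px\<^sup>2 + py\<^sup>2) / \<Lambda> / (lin pu px py p - c)\<^sup>2) *\<^sub>R pp_wave H p))"

text \<open>
  The meromorphic function \<open>s = sn(\<cdot>, m)\<close> on the plane (parameter \<open>m = k\<^sup>2\<close>) with
  \<open>s'\<^sup>2 = (1 - s\<^sup>2) (1 - m s\<^sup>2)\<close>, \<open>s 0 = 0\<close> and \<open>s' 0 = 1\<close>; for \<open>m = -1\<close> the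
  equation is \<open>s'\<^sup>2 = 1 - s\<^sup>4\<close>. By the convention of \<open>nicely_meromorphic_on\<close> the value at a
  pole is \<open>0\<close>, so poles must be excluded when zeroes are meant.
\<close>

definition jacobi_sn :: "complex \<Rightarrow> complex \<Rightarrow> complex" where
  "jacobi_sn w m = (THE s. s nicely_meromorphic_on UNIV \<and>
      (\<forall>v. \<not> is_pole s v \<longrightarrow> (deriv s v)\<^sup>2 = (1 - (s v)\<^sup>2) * (1 - m * (s v)\<^sup>2)) \<and>
      s 0 = 0 \<and> (s has_field_derivative 1) (at 0)) w"

definition sn_pole :: "complex \<Rightarrow> complex \<Rightarrow> bool" where
  "sn_pole w m \<longleftrightarrow> is_pole (\<lambda>v. jacobi_sn v m) w"

definition least_period :: "(real \<Rightarrow> 'a) \<Rightarrow> real \<Rightarrow> bool" where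
  "least_period f P \<longleftrightarrow> P > 0 \<and> (\<forall>t. f (t + P) = f t) \<and>
     (\<forall>Q. 0 < Q \<and> Q < P \<longrightarrow> (\<exists>t. f (t + Q) \<noteq> f t))"

definition curvature_singularity :: "point set \<Rightarrow> (point \<Rightarrow> real) \<Rightarrow> point \<Rightarrow> bool" where
  "curvature_singularity U I q \<longleftrightarrow> q islimpt U \<and> q \<notin> U \<and>
     filterlim (\<lambda>p. \<bar>I p\<bar>) at_top (at q within U)"

end

theory Submission
  imports Defs
begin

text \<open>
  Write \<open>\<Omega> = \<Omega>(z)\<close>. Both families satisfy \<open>\<Omega>'\<^sup>2 = K - L \<Omega> ^ 4\<close>, with \<open>K = 0\<close> for the first one. Differentiating gives
  \<open>\<Omega>'' = - 2 L \<Omega>\<^sup>3\<close>, which says that the scalar curvature is the constant \<open>4 \<Lambda>\<close>. For this value and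
  \<open>\<Lambda> = - \<gamma>' / (8 \<beta>')\<close> all terms of the field equations except the Bach tensor cancel, and the Bach tensor vanishes
  because the profile \<open>H\<close> is biharmonic. The Weyl tensor has only the components \<open>C\<^sub>u\<^sub>i\<^sub>u\<^sub>j\<close>, and
  the traceless Ricci tensor is \<open>K \<Omega>\<^sup>-\<^sup>2\<close> times a tensor of boost order 0, plus a multiple of \<open>du\<^sup>2\<close>.

  The function sn with parameter \<open>-1\<close> is the local solution of \<open>s'\<^sup>2 = 1 - s ^ 4\<close> near the origin, continued to
  the plane by the duplication formula \<open>s(2 w) = 2 s s' / (1 + s ^ 4)\<close>. The same formula shows that twice
  a critical point or twice a pole is a zero, and uniqueness of the solution makes every zero a period up to sign. On
  the ray on which \<open>\<Omega>\<close> is evaluated the first critical point (\<open>L > 0\<close>) or the first pole (\<open>L < 0\<close>)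
  therefore determines all zeroes and the least period.
\<close>

section \<open>Partial derivatives and smoothness\<close>

text \<open>\<open>pd\<close> selects a Frechet derivative by choice, so tensors get closed forms on
  the open set \<open>U\<close>, and explicit gradients (\<open>has_grad\<close>) are transported to
  \<open>pd\<close> there. The conformal factor enters through \<open>W\<close> and its logarithmic
  derivative \<open>Y\<close>: the gradients of both are polynomial in \<open>W\<close> and
  \<open>Y\<close>, so after clearing powers of \<open>W\<close> curvature identities become
  polynomial identities in components. The obstacle is the second covariant derivative in the Bach
  tensor. Metric compatibility moves one contraction inside the outer derivative, and what remains
  is the derivative of a rank 3 divergence with few nonzero components. For sn, \<open>THE\<close>
  demands a unique global meromorphic function, and doubling runs through poles. Writing
  \<open>s = N / D\<close> with holomorphic \<open>N\<close>, \<open>D\<close> and a third function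
  \<open>M = s' D^2\<close> keeps the duplication formula free of denominators. Symmetries of sn are
  obtained by transforming such a triple, as its quotient does not depend on the triple. A fourth
  root of L is, up to a fourth root of unity, a positive number times 1 or exp (i pi / 4); the
  homogeneity of sn under fourth roots of unity removes the choice.\<close>

definition has_grad :: "(point \<Rightarrow> real) \<Rightarrow> (4 \<Rightarrow> real) \<Rightarrow> point \<Rightarrow> bool" where
  "has_grad f d p \<longleftrightarrow> (f has_derivative (\<lambda>h. \<Sum>a\<in>UNIV. d a * h $ a)) (at p)"

lemma has_grad_pd: "has_grad f d p \<Longrightarrow> pd a f p = d a"
  unfolding has_grad_def pd_def
  by (subst frechet_derivative_at[symmetric], assumption) (simp add: axis_def if_distrib cong: if_cong)

lemma differentiable_has_grad:
  assumes "f differentiable (at p)" shows "has_grad f (\<lambda>a. pd a f p) p"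
proof -
  let ?D = "frechet_derivative f (at p)"
  have D: "(f has_derivative ?D) (at p)" using assms frechet_derivative_works by blast
  then interpret linear ?D using has_derivative_linear by blast
  have "?D h = (\<Sum>a\<in>UNIV. pd a f p * h $ a)" for h
  proof -
    have "?D h = ?D (\<Sum>a\<in>UNIV. h $ a *\<^sub>R axis a 1)"
      using basis_expansion[of h] by (simp add: scalar_mult_eq_scaleR)
    also have "\<dots> = (\<Sum>a\<in>UNIV. pd a f p * h $ a)"
      by (simp add: sum scale pd_def mult.commute)
    finally show ?thesis .
  qed
  then have "?D = (\<lambda>h. \<Sum>a\<in>UNIV. pd a f p * h $ a)" by blast
  then show ?thesis using D unfolding has_grad_def by simp
qed

lemma has_grad_differentiable: "has_grad f d p \<Longrightarrow> f differentiable (at p)"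
  unfolding has_grad_def differentiable_def by blast

lemma has_grad_eq: "has_grad f d p \<Longrightarrow> (\<And>a. d a = d' a) \<Longrightarrow> has_grad f d' p"
  by (simp add: has_grad_def)

lemma has_grad_const: "has_grad (\<lambda>_. k) (\<lambda>_. 0) p"
  by (simp add: has_grad_def)

lemma has_grad_add:
  assumes "has_grad f d p" "has_grad g e p"
  shows "has_grad (\<lambda>q. f q + g q) (\<lambda>a. d a + e a) p"
  using has_derivative_add[OF assms[unfolded has_grad_def]]
  by (simp add: has_grad_def distrib_right sum.distrib)

lemma has_grad_minus:
  assumes "has_grad f d p" shows "has_grad (\<lambda>q. - f q) (\<lambda>a. - d a) p"
  using has_derivative_minus[OF assms[unfolded has_grad_def]]
  by (simp add: has_grad_def sum_negf)

lemma has_grad_diff: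
  assumes "has_grad f d p" "has_grad g e p"
  shows "has_grad (\<lambda>q. f q - g q) (\<lambda>a. d a - e a) p"
  using has_grad_add[OF assms(1) has_grad_minus[OF assms(2)]] by simp

lemma has_grad_mult:
  assumes "has_grad f d p" "has_grad g e p"
  shows "has_grad (\<lambda>q. f q * g q) (\<lambda>a. d a * g p + f p * e a) p"
  using has_derivative_mult[OF assms[unfolded has_grad_def]]
  by (simp add: has_grad_def algebra_simps sum.distrib sum_distrib_left)

lemma has_grad_power2:
  assumes "has_grad f d p"
  shows "has_grad (\<lambda>q. (f q)\<^sup>2) (\<lambda>a. 2 * f p * d a) p"
  using has_grad_mult[OF assms assms] by (simp add: power2_eq_square algebra_simps)

lemma has_grad_sum:
  assumes "\<And>i. i \<in> I \<Longrightarrow> has_grad (f i) (d i) p"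
  shows "has_grad (\<lambda>q. \<Sum>i\<in>I. f i q) (\<lambda>a. \<Sum>i\<in>I. d i a) p"
  using assms by (induction I rule: infinite_finite_induct) (auto intro: has_grad_const has_grad_add)

lemma has_grad_compose:
  assumes "(f has_real_derivative f') (at (\<phi> p))" "has_grad \<phi> d p"
  shows "has_grad (\<lambda>q. f (\<phi> q)) (\<lambda>a. f' * d a) p"
  using has_derivative_compose[OF assms(2)[unfolded has_grad_def] assms(1)[unfolded has_field_derivative_def]]
  by (simp add: has_grad_def sum_distrib_left mult.assoc)

lemma has_grad_coord: "has_grad (\<lambda>q. q $ i) (\<lambda>a. if a = i then 1 else 0) p"
  using bounded_linear_imp_has_derivative[OF bounded_linear_vec_nth, of i "at p"]
  by (simp add: has_grad_def if_distrib if_distribR cong: if_cong)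

lemma has_grad_cong:
  assumes "open U" "p \<in> U" "\<And>q. q \<in> U \<Longrightarrow> f q = g q" "has_grad g d p"
  shows "has_grad f d p"
  unfolding has_grad_def
  by (rule has_derivative_transform_within_open[OF assms(4)[unfolded has_grad_def] assms(1,2)])
    (simp add: assms(3))

text \<open>Holds even where no derivative exists: both functions have the same Frechet derivatives
  at \<open>p\<close>, so \<open>frechet_derivative\<close> makes the same choice for both.\<close>

lemma pd_cong:
  assumes "open U" "p \<in> U" "\<And>q. q \<in> U \<Longrightarrow> f q = g q"
  shows "pd a f p = pd a g p"
proof -
  have "(f has_derivative D) (at p) \<longleftrightarrow> (g has_derivative D) (at p)" for D
    using has_derivative_transform_within_open[OF _ assms(1,2), of f D UNIV g]
      has_derivative_transform_within_open[OF _ assms(1,2), of g D UNIV f] assms(3) by metis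
  then show ?thesis by (simp add: pd_def frechet_derivative_def)
qed

lemma differentiable_on_cong_open:
  fixes f g :: "point \<Rightarrow> real"
  assumes "open U" "\<And>q. q \<in> U \<Longrightarrow> f q = g q" "g differentiable_on U"
  shows "f differentiable_on U"
proof (rule differentiable_at_imp_differentiable_on)
  fix p assume p: "p \<in> U"
  then have "g differentiable (at p)"
    using assms(1,3) differentiable_on_eq_differentiable_at by blast
  then show "f differentiable (at p)"
    using has_grad_differentiable[OF has_grad_cong[OF assms(1) p _ differentiable_has_grad[of g p]], of f]
      assms(2) by simp
qed

section \<open>Closure properties of C^k and smooth functions\<close>

lemma Ck_on_cong:
  assumes "open U" "\<And>q. q \<in> U \<Longrightarrow> f q = g q"
  shows "Ck_on k f U \<longleftrightarrow> Ck_on k g U"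
  using assms
proof (induction k arbitrary: f g)
  case 0 then show ?case by (auto intro: continuous_on_cong)
next
  case (Suc k)
  have "f differentiable_on U \<longleftrightarrow> g differentiable_on U"
    using differentiable_on_cong_open[OF Suc.prems(1)] Suc.prems(2) by metis
  moreover have "Ck_on k (pd a f) U \<longleftrightarrow> Ck_on k (pd a g) U" for a
    by (intro Suc.IH Suc.prems pd_cong[OF Suc.prems(1)]) auto
  ultimately show ?case by simp
qed

text \<open>For the product rule, where a factor of class C^(k+1) also occurs undifferentiated and
  has to be of class C^k.\<close>

lemma Ck_on_SucD: "Ck_on (Suc k) f U \<Longrightarrow> Ck_on k f U"
proof (induction k arbitrary: f)
  case 0 then show ?case by (auto intro: differentiable_imp_continuous_on)
next
  case (Suc k)
  then have "f differentiable_on U" "\<And>a. Ck_on (Suc k) (pd a f) U" by simp_all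
  then show ?case using Suc.IH by simp
qed

text \<open>Lets an explicit gradient formula replace \<open>pd a f\<close>, which is known to agree
  with it on \<open>U\<close> only.\<close>

lemma Ck_on_SucI:
  assumes "open U" "\<And>p. p \<in> U \<Longrightarrow> has_grad f (\<lambda>a. d a p) p" "\<And>a. Ck_on k (d a) U"
  shows "Ck_on (Suc k) f U"
proof -
  have "f differentiable_on U"
    using assms(2) has_grad_differentiable by (intro differentiable_at_imp_differentiable_on) blast
  moreover have "Ck_on k (pd a f) U" for a
    using assms Ck_on_cong[of U "pd a f" "d a" k] has_grad_pd[OF assms(2)] by auto
  ultimately show ?thesis by simp
qed

lemma Ck_on_has_grad:
  assumes "open U" "Ck_on (Suc k) f U" "p \<in> U"
  shows "has_grad f (\<lambda>a. pd a f p) p"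
  using assms by (auto intro!: differentiable_has_grad simp: differentiable_on_eq_differentiable_at)

lemma Ck_on_const: "open U \<Longrightarrow> Ck_on k (\<lambda>_. r) U"
proof (induction k arbitrary: r)
  case (Suc k) then show ?case by (intro Ck_on_SucI[where d="\<lambda>_ _. 0"] has_grad_const) auto
qed auto

lemma Ck_on_add:
  assumes "open U" shows "Ck_on k f U \<Longrightarrow> Ck_on k g U \<Longrightarrow> Ck_on k (\<lambda>p. f p + g p) U"
proof (induction k arbitrary: f g)
  case (Suc k)
  show ?case
    by (rule Ck_on_SucI[OF assms has_grad_add[OF Ck_on_has_grad Ck_on_has_grad]])
       (use Suc assms in \<open>auto simp del: Ck_on.simps(1)\<close>)
qed (auto intro: continuous_on_add)

lemma Ck_on_mult:
  assumes "open U" shows "Ck_on k f U \<Longrightarrow> Ck_on k g U \<Longrightarrow> Ck_on k (\<lambda>p. f p * g p) U"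
proof (induction k arbitrary: f g)
  case (Suc k)
  have "Ck_on k f U" "Ck_on k g U" using Suc.prems Ck_on_SucD by blast+
  then show ?case
    by (intro Ck_on_SucI[OF assms has_grad_mult[OF Ck_on_has_grad Ck_on_has_grad]] Ck_on_add)
       (use Suc assms in \<open>auto simp del: Ck_on.simps(1)\<close>)
qed (auto intro: continuous_on_mult)

lemma smooth_on_cong: "open U \<Longrightarrow> (\<And>q. q \<in> U \<Longrightarrow> f q = g q) \<Longrightarrow> smooth_on f U \<longleftrightarrow> smooth_on g U"
  unfolding smooth_on_def by (intro all_cong1 Ck_on_cong)

lemma smooth_on_const: "open U \<Longrightarrow> smooth_on (\<lambda>_. r) U"
  by (simp add: smooth_on_def Ck_on_const)

lemma smooth_on_add: "open U \<Longrightarrow> smooth_on f U \<Longrightarrow> smooth_on g U \<Longrightarrow> smooth_on (\<lambda>p. f p + g p) U"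
  by (simp add: smooth_on_def Ck_on_add)

lemma smooth_on_mult: "open U \<Longrightarrow> smooth_on f U \<Longrightarrow> smooth_on g U \<Longrightarrow> smooth_on (\<lambda>p. f p * g p) U"
  by (simp add: smooth_on_def Ck_on_mult)

lemma smooth_on_minus: "open U \<Longrightarrow> smooth_on f U \<Longrightarrow> smooth_on (\<lambda>p. - f p) U"
  using smooth_on_mult[OF _ smooth_on_const[of U "-1"], of f] by simp

lemma smooth_on_diff: "open U \<Longrightarrow> smooth_on f U \<Longrightarrow> smooth_on g U \<Longrightarrow> smooth_on (\<lambda>p. f p - g p) U"
  using smooth_on_add[OF _ _ smooth_on_minus, of U f g] by simp

lemma smooth_on_sum: "open U \<Longrightarrow> (\<And>i. i \<in> I \<Longrightarrow> smooth_on (f i) U) \<Longrightarrow> smooth_on (\<lambda>p. \<Sum>i\<in>I. f i p) U"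
  by (induction I rule: infinite_finite_induct) (auto intro: smooth_on_const smooth_on_add)

lemma smooth_on_pd: "smooth_on f U \<Longrightarrow> smooth_on (pd a f) U"
  unfolding smooth_on_def
proof
  fix k assume "\<forall>k. Ck_on k f U"
  then have "Ck_on (Suc k) f U" by blast
  then show "Ck_on k (pd a f) U" by simp
qed

lemma smooth_on_has_grad: "open U \<Longrightarrow> smooth_on f U \<Longrightarrow> p \<in> U \<Longrightarrow> has_grad f (\<lambda>a. pd a f p) p"
  by (rule Ck_on_has_grad[of U 0]) (auto simp: smooth_on_def simp del: Ck_on.simps)

section \<open>Curvature of a conformally rescaled pp-wave\<close>

text \<open>A covector with components along x and y only, the shape of the gradient of any function
  of \<open>zeta\<close>.\<close>

definition gr :: "real \<Rightarrow> real \<Rightarrow> 4 \<Rightarrow> real" where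
  "gr x y i = (if i = 3 then x else if i = 4 then y else 0)"

lemma gr_simps [simp]: "gr x y 1 = 0" "gr x y 2 = 0" "gr x y 3 = x" "gr x y 4 = y"
  by (simp_all add: gr_def)

text \<open>The condition \<open>Q\<close> does not depend on the point: it is a test on tensor
  indices, and tensors defined by index cases are differentiated case by case.\<close>

lemma has_grad_if:
  "(Q \<Longrightarrow> has_grad f d p) \<Longrightarrow> (\<not> Q \<Longrightarrow> has_grad g e p) \<Longrightarrow>
    has_grad (\<lambda>q. if Q then f q else g q) (\<lambda>k. if Q then d k else e k) p"
  by (cases Q) simp_all

text \<open>
  The profile is \<open>h\<close>, with gradient \<open>(h3, h4)\<close> and Hessian \<open>[[tr + a, b], [b, tr - a]]\<close> in \<open>(x, y)\<close>.
  The Cauchy-Riemann type relations between \<open>grad_d3\<close> and \<open>grad_d4\<close> say that \<open>h\<close> is biharmonic.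
  The conformal factor is \<open>W\<close> and \<open>Y\<close> is its logarithmic derivative in the direction \<open>P\<close>;
  \<open>grad_Y\<close> and \<open>first_integral\<close> encode \<open>W'' = - 2 L W\<^sup>3\<close> and \<open>W'\<^sup>2 = K - L W ^ 4\<close>.
\<close>

locale conformal_pp_wave =
  fixes U :: "point set" and g :: metric and pu px py L K :: real
    and W Y h h3 h4 tr a b a3 a4 b3 b4 e f :: "point \<Rightarrow> real"
  fixes P :: "4 \<Rightarrow> real" and \<eta> :: "point \<Rightarrow> 4 \<Rightarrow> 4 \<Rightarrow> real"
  defines "P \<equiv> (\<lambda>i. if i = 1 then pu else gr px py i)"
  defines "\<eta> \<equiv> (\<lambda>p i j. if i = 1 \<and> j = 1 then 2 * h p
     else if (i = 1 \<and> j = 2) \<or> (i = 2 \<and> j = 1) then -1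
     else if (i = 3 \<and> j = 3) \<or> (i = 4 \<and> j = 4) then 1
     else 0)"
  assumes open_U: "open U"
    and g_eq: "\<And>p i j. p \<in> U \<Longrightarrow> g p $ i $ j = (W p)\<^sup>2 * \<eta> p i j"
    and W_nz: "\<And>p. p \<in> U \<Longrightarrow> W p \<noteq> 0"
    and grad_W: "\<And>p. p \<in> U \<Longrightarrow> has_grad W (\<lambda>i. P i * (Y p * W p)) p"
    and grad_Y: "\<And>p. p \<in> U \<Longrightarrow> has_grad Y (\<lambda>i. P i * (- 2 * L * (W p)\<^sup>2 - (Y p)\<^sup>2)) p"
    and first_integral: "\<And>p. p \<in> U \<Longrightarrow> (Y p)\<^sup>2 * (W p)\<^sup>2 = K - L * (W p) ^ 4"
    and grad_h: "\<And>p. p \<in> U \<Longrightarrow> has_grad h (gr (h3 p) (h4 p)) p"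
    and grad_h3: "\<And>p. p \<in> U \<Longrightarrow> has_grad h3 (gr (tr p + a p) (b p)) p"
    and grad_h4: "\<And>p. p \<in> U \<Longrightarrow> has_grad h4 (gr (b p) (tr p - a p)) p"
    and grad_a: "\<And>p. p \<in> U \<Longrightarrow> has_grad a (gr (a3 p) (a4 p)) p"
    and grad_b: "\<And>p. p \<in> U \<Longrightarrow> has_grad b (gr (b3 p) (b4 p)) p"
    and grad_d3: "\<And>p. p \<in> U \<Longrightarrow> has_grad (\<lambda>p. a3 p + b4 p) (gr (e p) (f p)) p"
    and grad_d4: "\<And>p. p \<in> U \<Longrightarrow> has_grad (\<lambda>p. b3 p - a4 p) (gr (f p) (- e p)) p"
    and smooth: "smooth_on W U" "smooth_on Y U" "smooth_on h U" "smooth_on a U" "smooth_on b U"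
begin

lemma P_simps [simp]: "P 1 = pu" "P 2 = 0" "P 3 = px" "P 4 = py"
  by (simp_all add: P_def)

lemma \<eta>_simps [simp]: "\<eta> p 1 1 = 2 * h p" "\<eta> p 1 2 = -1" "\<eta> p 1 3 = 0" "\<eta> p 1 4 = 0"
  "\<eta> p 2 1 = -1" "\<eta> p 2 2 = 0" "\<eta> p 2 3 = 0" "\<eta> p 2 4 = 0"
  "\<eta> p 3 1 = 0" "\<eta> p 3 2 = 0" "\<eta> p 3 3 = 1" "\<eta> p 3 4 = 0"
  "\<eta> p 4 1 = 0" "\<eta> p 4 2 = 0" "\<eta> p 4 3 = 0" "\<eta> p 4 4 = 1"
  by (simp_all add: \<eta>_def)

section \<open>Inverse metric and Levi-Civita connection\<close>

definition \<eta>inv :: "point \<Rightarrow> 4 \<Rightarrow> 4 \<Rightarrow> real" where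
  "\<eta>inv p i j = (if (i = 1 \<and> j = 2) \<or> (i = 2 \<and> j = 1) then -1
     else if i = 2 \<and> j = 2 then - 2 * h p
     else if (i = 3 \<and> j = 3) \<or> (i = 4 \<and> j = 4) then 1
     else 0)"

lemma \<eta>inv_simps [simp]: "\<eta>inv p 1 1 = 0" "\<eta>inv p 1 2 = -1" "\<eta>inv p 1 3 = 0" "\<eta>inv p 1 4 = 0"
  "\<eta>inv p 2 1 = -1" "\<eta>inv p 2 2 = - 2 * h p" "\<eta>inv p 2 3 = 0" "\<eta>inv p 2 4 = 0"
  "\<eta>inv p 3 1 = 0" "\<eta>inv p 3 2 = 0" "\<eta>inv p 3 3 = 1" "\<eta>inv p 3 4 = 0"
  "\<eta>inv p 4 1 = 0" "\<eta>inv p 4 2 = 0" "\<eta>inv p 4 3 = 0" "\<eta>inv p 4 4 = 1"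
  by (simp_all add: \<eta>inv_def)

lemma \<eta>_sym: "\<eta> p i j = \<eta> p j i"
  by (auto simp: \<eta>_def)

lemma ginv_eq:
  assumes "p \<in> U" shows "ginv g p i j = \<eta>inv p i j / (W p)\<^sup>2"
proof -
  define B :: "real ^ 4 ^ 4" where "B = (\<chi> i j. \<eta>inv p i j / (W p)\<^sup>2)"
  have gB: "g p ** B = mat 1" "B ** g p = mat 1"
    using W_nz[OF assms]
    by (simp_all add: vec_eq_iff matrix_matrix_mult_def mat_def B_def forall_4 sum_4 g_eq[OF assms])
  have "matrix_inv (g p) = B"
  proof -
    have "\<exists>A'. g p ** A' = mat 1 \<and> A' ** g p = mat 1" using gB by blast
    then have "g p ** matrix_inv (g p) = mat 1 \<and> matrix_inv (g p) ** g p = mat 1"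
      unfolding matrix_inv_def by (rule someI_ex)
    then show ?thesis using gB
      by (metis matrix_mul_assoc matrix_mul_lid matrix_mul_rid)
  qed
  then show ?thesis by (simp add: ginv_def B_def)
qed

text \<open>The derivative of \<open>Y\<close> with respect to z, from \<open>Y = W' / W\<close> and
  \<open>W'' = - 2 L W^3\<close>.\<close>

definition dY :: "point \<Rightarrow> real" where "dY p = - 2 * L * (W p)\<^sup>2 - (Y p)\<^sup>2"

definition dh :: "point \<Rightarrow> 4 \<Rightarrow> real" where "dh p = gr (h3 p) (h4 p)"

definition d\<eta> :: "point \<Rightarrow> 4 \<Rightarrow> 4 \<Rightarrow> 4 \<Rightarrow> real" where
  "d\<eta> p k i j = (if i = 1 \<and> j = 1 then 2 * dh p k else 0)"

lemma grad_\<eta>: "p \<in> U \<Longrightarrow> has_grad (\<lambda>q. \<eta> q i j) (\<lambda>k. d\<eta> p k i j) p"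
  unfolding \<eta>_def d\<eta>_def dh_def
  by (rule has_grad_eq[OF has_grad_if[OF has_grad_mult[OF has_grad_const grad_h]
        has_grad_if[OF has_grad_const has_grad_if[OF has_grad_const has_grad_const]]]]) auto

lemma grad_g:
  assumes "p \<in> U"
  shows "has_grad (\<lambda>q. g q $ i $ j) (\<lambda>k. (W p)\<^sup>2 * (2 * P k * Y p * \<eta> p i j + d\<eta> p k i j)) p"
  by (rule has_grad_cong[OF open_U assms g_eq], assumption,
      rule has_grad_eq[OF has_grad_mult[OF has_grad_power2[OF grad_W[OF assms]] grad_\<eta>[OF assms]]])
    (simp add: algebra_simps power2_eq_square)

lemmas pd_g = has_grad_pd[OF grad_g]

definition \<Gamma>\<^sub>0 :: "point \<Rightarrow> 4 \<Rightarrow> 4 \<Rightarrow> 4 \<Rightarrow> real" where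
  "\<Gamma>\<^sub>0 p i j k = (if i = 2 \<and> j = 1 then - dh p k else if i = 2 \<and> k = 1 then - dh p j
     else if j = 1 \<and> k = 1 then - dh p i else 0)"

text \<open>\<open>P\<close> with its index raised by \<open>\<eta>inv\<close>; since
  \<open>P 2 = 0\<close>, the profile \<open>h\<close> drops out.\<close>

definition Pup :: "4 \<Rightarrow> real" where "Pup i = (if i = 2 then - pu else gr px py i)"

lemma Pup_simps [simp]: "Pup 1 = 0" "Pup 2 = - pu" "Pup 3 = px" "Pup 4 = py"
  by (simp_all add: Pup_def)

definition dl :: "4 \<Rightarrow> 4 \<Rightarrow> real" where "dl i j = (if i = j then 1 else 0)"

text \<open>Conformal change of the Levi-Civita connection: \<open>\<Gamma>\<^sub>0\<close> belongs
  to the pp-wave \<open>\<eta>\<close>, and \<open>Y p * P i\<close> is the gradient of log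
  \<open>W\<close>.\<close>

definition \<Gamma> :: "point \<Rightarrow> 4 \<Rightarrow> 4 \<Rightarrow> 4 \<Rightarrow> real" where
  "\<Gamma> p i j k = Y p * (dl i j * P k + dl i k * P j - \<eta> p j k * Pup i) + \<Gamma>\<^sub>0 p i j k"

lemma dh_simps [simp]: "dh p 1 = 0" "dh p 2 = 0" "dh p 3 = h3 p" "dh p 4 = h4 p"
  by (simp_all add: dh_def)

lemma christoffel_eq:
  assumes "p \<in> U" shows "christoffel g p i j k = \<Gamma> p i j k"
proof -
  have "\<forall>i j k. christoffel g p i j k = \<Gamma> p i j k"
    using W_nz[OF assms]
    by (simp add: forall_4 christoffel_def sum_4 ginv_eq[OF assms] pd_g[OF assms] d\<eta>_def \<Gamma>_def \<Gamma>\<^sub>0_def dl_def)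
       (simp add: field_simps)
  then show ?thesis by blast
qed

definition ddh :: "point \<Rightarrow> 4 \<Rightarrow> 4 \<Rightarrow> real" where
  "ddh p k i = (if i = 3 then gr (tr p + a p) (b p) k else if i = 4 then gr (b p) (tr p - a p) k else 0)"

lemma ddh_simps [simp]: "ddh p k 1 = 0" "ddh p k 2 = 0" "ddh p 1 i = 0" "ddh p 2 i = 0"
  "ddh p 3 3 = tr p + a p" "ddh p 3 4 = b p" "ddh p 4 3 = b p" "ddh p 4 4 = tr p - a p"
  by (simp_all add: ddh_def)

lemma grad_dh:
  assumes "p \<in> U" shows "has_grad (\<lambda>q. dh q i) (\<lambda>k. ddh p k i) p"
proof -
  have "\<forall>i. has_grad (\<lambda>q. dh q i) (\<lambda>k. ddh p k i) p"
    unfolding forall_4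
    by (auto simp: ddh_def intro: has_grad_const grad_h3[OF assms] grad_h4[OF assms])
  then show ?thesis by blast
qed

definition d\<Gamma>\<^sub>0 :: "point \<Rightarrow> 4 \<Rightarrow> 4 \<Rightarrow> 4 \<Rightarrow> 4 \<Rightarrow> real" where
  "d\<Gamma>\<^sub>0 p l i j k = (if i = 2 \<and> j = 1 then - ddh p l k else if i = 2 \<and> k = 1 then - ddh p l j
     else if j = 1 \<and> k = 1 then - ddh p l i else 0)"

lemma grad_\<Gamma>\<^sub>0: "p \<in> U \<Longrightarrow> has_grad (\<lambda>q. \<Gamma>\<^sub>0 q i j k) (\<lambda>l. d\<Gamma>\<^sub>0 p l i j k) p"
  unfolding \<Gamma>\<^sub>0_def d\<Gamma>\<^sub>0_def
  by (intro has_grad_if has_grad_const has_grad_minus grad_dh)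

definition d\<Gamma> :: "point \<Rightarrow> 4 \<Rightarrow> 4 \<Rightarrow> 4 \<Rightarrow> 4 \<Rightarrow> real" where
  "d\<Gamma> p l i j k = P l * dY p * (dl i j * P k + dl i k * P j - \<eta> p j k * Pup i)
      - Y p * d\<eta> p l j k * Pup i + d\<Gamma>\<^sub>0 p l i j k"

lemma grad_\<Gamma>:
  assumes "p \<in> U" shows "has_grad (\<lambda>q. \<Gamma> q i j k) (\<lambda>l. d\<Gamma> p l i j k) p"
  unfolding \<Gamma>_def
  by (rule has_grad_eq[OF has_grad_add[OF has_grad_mult[OF grad_Y[OF assms]
        has_grad_diff[OF has_grad_const has_grad_mult[OF grad_\<eta>[OF assms] has_grad_const]]]
        grad_\<Gamma>\<^sub>0[OF assms]]])
     (simp add: d\<Gamma>_def dY_def algebra_simps)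

lemma pd_christoffel:
  assumes "p \<in> U" shows "pd l (\<lambda>q. christoffel g q i j k) p = d\<Gamma> p l i j k"
  using pd_cong[OF open_U assms christoffel_eq] has_grad_pd[OF grad_\<Gamma>[OF assms]] by simp

section \<open>Ricci and Weyl tensors\<close>

lemma riemann_up_eq:
  assumes "p \<in> U"
  shows "riemann_up g p i j k l = d\<Gamma> p k i l j - d\<Gamma> p l i k j
     + (\<Sum>m\<in>UNIV. \<Gamma> p i k m * \<Gamma> p m l j - \<Gamma> p i l m * \<Gamma> p m k j)"
  by (simp add: riemann_up_def pd_christoffel[OF assms] christoffel_eq[OF assms])

text \<open>Conformal change of the Ricci tensor in dimension 4. The pp-wave contributes minus the
  Laplacian of \<open>h\<close>, that is \<open>- 2 * tr p\<close>; the coefficient of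
  \<open>P i * P j\<close> is \<open>- 2 * (dY p - (Y p)^2)\<close>; the term with \<open>h3\<close>
  and \<open>h4\<close> comes from the pp-wave connection in the Hessian of log
  \<open>W\<close>.\<close>

definition ric :: "point \<Rightarrow> 4 \<Rightarrow> 4 \<Rightarrow> real" where
  "ric p i j = dl i 1 * dl j 1 * (- 2 * tr p - 2 * Y p * (h3 p * px + h4 p * py))
     + 4 * (L * (W p)\<^sup>2 + (Y p)\<^sup>2) * P i * P j
     - (px\<^sup>2 + py\<^sup>2) * ((Y p)\<^sup>2 - 2 * L * (W p)\<^sup>2) * \<eta> p i j"

lemmas tables = dl_def d\<Gamma>_def d\<Gamma>\<^sub>0_def \<Gamma>_def \<Gamma>\<^sub>0_def d\<eta>_def

lemma ricci_eq:
  assumes "p \<in> U" shows "ricci g p i j = ric p i j"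
proof -
  have "\<forall>i j. ricci g p i j = ric p i j"
    by (simp add: forall_4 ricci_def riemann_up_eq[OF assms] sum_4 ric_def tables)
       (simp add: dY_def algebra_simps power2_eq_square)
  then show ?thesis by blast
qed

text \<open>\<open>du^2\<close> is null and drops out of the trace, and the \<open>Y^2\<close>
  contributions of the other two terms cancel; what remains is constant.\<close>

lemma ricci_scalar_eq:
  assumes "p \<in> U" shows "ricci_scalar g p = 12 * L * (px\<^sup>2 + py\<^sup>2)"
  using W_nz[OF assms]
  by (simp add: ricci_scalar_def ricci_eq[OF assms] ginv_eq[OF assms] sum_4 ric_def dl_def)
     (simp add: field_simps power2_eq_square)

text \<open>The trace-free part of the Hessian of \<open>h\<close> in the (x, y) plane.\<close>

definition wM :: "point \<Rightarrow> 4 \<Rightarrow> 4 \<Rightarrow> real" where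
  "wM p i j = (if i = 3 then gr (a p) (b p) j else if i = 4 then gr (b p) (- a p) j else 0)"

lemma wM_simps [simp]: "wM p 1 i = 0" "wM p 2 i = 0" "wM p i 1 = 0" "wM p i 2 = 0"
  "wM p 3 3 = a p" "wM p 3 4 = b p" "wM p 4 3 = b p" "wM p 4 4 = - a p"
  by (simp_all add: wM_def)

text \<open>Minus the Kulkarni-Nomizu product of \<open>du^2\<close> and \<open>wM\<close>: the Weyl
  tensor of the pp-wave.\<close>

definition wC :: "point \<Rightarrow> 4 \<Rightarrow> 4 \<Rightarrow> 4 \<Rightarrow> 4 \<Rightarrow> real" where
  "wC p i j k l = dl j 1 * dl k 1 * wM p i l + dl i 1 * dl l 1 * wM p j k
     - dl i 1 * dl k 1 * wM p j l - dl j 1 * dl l 1 * wM p i k"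

text \<open>With one index raised the Weyl tensor is conformally invariant; lowering that index with
  \<open>g\<close> produces the factor \<open>W^2\<close>. The identity is checked in all 256
  components.\<close>

lemma weyl_eq:
  assumes "p \<in> U" shows "weyl g p i j k l = (W p)\<^sup>2 * wC p i j k l"
proof -
  have "\<forall>i j k l. weyl g p i j k l = (W p)\<^sup>2 * wC p i j k l"
    unfolding weyl_def riemann_def ricci_scalar_eq[OF assms] ricci_eq[OF assms] g_eq[OF assms]
      riemann_up_eq[OF assms] wC_def
    by (simp add: forall_4 sum_4 ric_def tables)
       (simp add: dY_def field_simps power2_eq_square power4_eq_xxxx)
  then show ?thesis by blast
qed

end

section \<open>The Bach tensor\<close>

lemma sum_lessThan_4: "(\<Sum>i<4. F i) = F 0 + F 1 + F 2 + F (3::nat)" for F :: "nat \<Rightarrow> real"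
  by (simp add: eval_nat_numeral)

lemma sum_lessThan_5: "(\<Sum>i<5. F i) = F 0 + F 1 + F 2 + F 3 + F (4::nat)" for F :: "nat \<Rightarrow> real"
  by (simp add: eval_nat_numeral)

lemma nabla_4:
  "nabla g T p [m, i, j, k, l] = pd m (\<lambda>q. T q [i, j, k, l]) p
     - (\<Sum>n\<in>UNIV. christoffel g p n m i * T p [n, j, k, l] + christoffel g p n m j * T p [i, n, k, l]
         + christoffel g p n m k * T p [i, j, n, l] + christoffel g p n m l * T p [i, j, k, n])"
  by (simp add: nabla_def sum_lessThan_4 sum.distrib)

lemma nabla_5:
  "nabla g T p [s, m, i, j, k, l] = pd s (\<lambda>q. T q [m, i, j, k, l]) p
     - (\<Sum>n\<in>UNIV. christoffel g p n s m * T p [n, i, j, k, l] + christoffel g p n s i * T p [m, n, j, k, l]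
         + christoffel g p n s j * T p [m, i, n, k, l] + christoffel g p n s k * T p [m, i, j, n, l]
         + christoffel g p n s l * T p [m, i, j, k, n])"
  by (simp add: nabla_def sum_lessThan_5 sum.distrib)

text \<open>Relabels dummy indices so that the connection acts on the contracting tensor
  \<open>A\<close> instead of \<open>N\<close>; when \<open>A\<close> is the inverse metric,
  \<open>pd_ginv\<close> turns the result into its derivative.\<close>

lemma contraction_christoffel:
  fixes A B N :: "4 \<Rightarrow> 4 \<Rightarrow> real"
  shows "(\<Sum>l\<in>UNIV. \<Sum>m\<in>UNIV. A l m * (\<Sum>n\<in>UNIV. B n m * N n l + B n l * N m n))
    = (\<Sum>l\<in>UNIV. \<Sum>m\<in>UNIV. (\<Sum>n\<in>UNIV. B l n * A n m + B m n * A l n) * N m l)"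
  by (simp add: sum_4 algebra_simps)

lemma contraction_swap:
  fixes A :: "4 \<Rightarrow> 4 \<Rightarrow> real" and B :: "4 \<Rightarrow> real"
  shows "(\<Sum>l\<in>UNIV. \<Sum>m\<in>UNIV. A l m * (\<Sum>n\<in>UNIV. B n * N n m l))
    = (\<Sum>n\<in>UNIV. B n * (\<Sum>l\<in>UNIV. \<Sum>m\<in>UNIV. A l m * N n m l))"
  by (simp add: sum_4 algebra_simps)

context conformal_pp_wave
begin

lemma grad_inverse_W:
  assumes "p \<in> U" shows "has_grad (\<lambda>q. inverse (W q)) (\<lambda>k. - P k * Y p * inverse (W p)) p"
  by (rule has_grad_eq[OF has_grad_compose[OF DERIV_inverse[OF W_nz[OF assms]] grad_W[OF assms]]])
     (simp add: field_simps power2_eq_square W_nz[OF assms])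

definition d\<eta>inv :: "point \<Rightarrow> 4 \<Rightarrow> 4 \<Rightarrow> 4 \<Rightarrow> real" where
  "d\<eta>inv p k i j = (if i = 2 \<and> j = 2 then - 2 * dh p k else 0)"

lemma grad_\<eta>inv: "p \<in> U \<Longrightarrow> has_grad (\<lambda>q. \<eta>inv q i j) (\<lambda>k. d\<eta>inv p k i j) p"
  unfolding \<eta>inv_def d\<eta>inv_def dh_def
  by (rule has_grad_eq[OF has_grad_if[OF has_grad_const has_grad_if[OF has_grad_mult[OF has_grad_const grad_h]
        has_grad_if[OF has_grad_const has_grad_const]]]]) auto

lemma grad_ginv:
  assumes "p \<in> U"
  shows "has_grad (\<lambda>q. ginv g q i j) (\<lambda>k. (d\<eta>inv p k i j - 2 * P k * Y p * \<eta>inv p i j) / (W p)\<^sup>2) p"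
proof (rule has_grad_cong[OF open_U assms])
  show "ginv g q i j = \<eta>inv q i j * (inverse (W q))\<^sup>2" if "q \<in> U" for q
    using ginv_eq[OF that] by (simp add: field_simps)
  show "has_grad (\<lambda>q. \<eta>inv q i j * (inverse (W q))\<^sup>2)
          (\<lambda>k. (d\<eta>inv p k i j - 2 * P k * Y p * \<eta>inv p i j) / (W p)\<^sup>2) p"
    by (rule has_grad_eq[OF has_grad_mult[OF grad_\<eta>inv[OF assms] has_grad_power2[OF grad_inverse_W[OF assms]]]])
       (simp add: field_simps power2_eq_square W_nz[OF assms])
qed

text \<open>Metric compatibility \<open>\<nabla>\<^sub>k g\<^sup>i\<^sup>j = 0\<close>.\<close>

lemma pd_ginv:
  assumes "p \<in> U"
  shows "pd k (\<lambda>q. ginv g q i j) p =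
    - (\<Sum>n\<in>UNIV. christoffel g p i k n * ginv g p n j + christoffel g p j k n * ginv g p i n)"
proof -
  have "\<forall>i j k. (d\<eta>inv p k i j - 2 * P k * Y p * \<eta>inv p i j) / (W p)\<^sup>2 =
    - (\<Sum>n\<in>UNIV. \<Gamma> p i k n * (\<eta>inv p n j / (W p)\<^sup>2) + \<Gamma> p j k n * (\<eta>inv p i n / (W p)\<^sup>2))"
    using W_nz[OF assms]
    by (simp add: forall_4 sum_4 d\<eta>inv_def tables) (simp add: field_simps)
  then show ?thesis
    by (simp add: has_grad_pd[OF grad_ginv[OF assms]] christoffel_eq[OF assms] ginv_eq[OF assms])
qed

section \<open>Smoothness of the metric, the connection and the Weyl tensor\<close>

lemma smooth_dh: "smooth_on (\<lambda>p. dh p i) U"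
proof -
  have "smooth_on (pd i h) U \<longleftrightarrow> smooth_on (\<lambda>p. dh p i) U"
    by (rule smooth_on_cong[OF open_U]) (simp add: has_grad_pd[OF grad_h] dh_def)
  then show ?thesis using smooth_on_pd[OF smooth(3)] by blast
qed

lemma smooth_on_if: "smooth_on A U \<Longrightarrow> smooth_on B U \<Longrightarrow> smooth_on (\<lambda>p. if Q then A p else B p) U"
  by (cases Q) simp_all

lemmas smooth_intros = smooth_on_if smooth_on_const[OF open_U] smooth_on_add[OF open_U] smooth_on_diff[OF open_U]
  smooth_on_mult[OF open_U] smooth_on_minus[OF open_U] smooth_on_sum[OF open_U] smooth smooth_dh

lemma smooth_g: "smooth_on (\<lambda>p. g p $ i $ j) U"
proof -
  have "smooth_on (\<lambda>p. W p * W p * \<eta> p i j) U"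
    unfolding \<eta>_def by (intro smooth_intros)
  then show ?thesis
    using smooth_on_cong[OF open_U, of "\<lambda>p. g p $ i $ j"] g_eq by (simp add: power2_eq_square)
qed

lemma smooth_weyl: "smooth_on (\<lambda>p. weyl g p i j k l) U"
proof -
  have "smooth_on (\<lambda>p. W p * W p * wC p i j k l) U"
    unfolding wC_def wM_def gr_def by (intro smooth_intros)
  then show ?thesis
    using smooth_on_cong[OF open_U, of "\<lambda>p. weyl g p i j k l"] weyl_eq by (simp add: power2_eq_square)
qed

lemma smooth_christoffel: "smooth_on (\<lambda>p. christoffel g p i j k) U"
proof -
  have "smooth_on (\<lambda>p. \<Gamma> p i j k) U"
    unfolding \<Gamma>_def \<Gamma>\<^sub>0_def \<eta>_def by (intro smooth_intros)
  then show ?thesis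
    using smooth_on_cong[OF open_U, of "\<lambda>p. christoffel g p i j k"] christoffel_eq by simp
qed

abbreviation nC :: tensor_field where "nC \<equiv> nabla g (rank4 (weyl g))"

text \<open>Supplies the differentiability for the product rule in
  \<open>contracted_nabla_nC\<close>, since \<open>nC\<close> is never given a closed form.\<close>

lemma smooth_nC: "smooth_on (\<lambda>p. nC p [m, i, j, k, l]) U"
  unfolding nabla_4 rank4_def
  by (intro smooth_on_diff[OF open_U] smooth_on_sum[OF open_U] smooth_on_add[OF open_U] smooth_on_mult[OF open_U]
      smooth_christoffel smooth_on_pd[unfolded eta_contract_eq]) (simp_all add: smooth_weyl smooth_christoffel)

section \<open>Divergence of the Weyl tensor\<close>

definition divC :: "point \<Rightarrow> 4 \<Rightarrow> 4 \<Rightarrow> 4 \<Rightarrow> real" where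
  "divC p i j k = (\<Sum>l\<in>UNIV. \<Sum>m\<in>UNIV. ginv g p l m * nC p [m, i, j, k, l])"

text \<open>The inverse metric is covariantly constant, so the contraction of \<open>l\<close> with
  \<open>m\<close> commutes with the outer covariant derivative. The right-hand side is the
  covariant derivative of \<open>divC\<close>, which avoids closed forms for tensors of rank 5 and
  6.\<close>

lemma contracted_nabla_nC:
  assumes "p \<in> U"
  shows "(\<Sum>l\<in>UNIV. \<Sum>m\<in>UNIV. ginv g p l m * nabla g nC p [s, m, i, j, k, l])
    = pd s (\<lambda>q. divC q i j k) p - (\<Sum>n\<in>UNIV. christoffel g p n s i * divC p n j k
        + christoffel g p n s j * divC p i n k + christoffel g p n s k * divC p i j n)"
proof -
  let ?X = "christoffel g p" and ?G = "ginv g p"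
  have "has_grad (\<lambda>q. divC q i j k) (\<lambda>s. \<Sum>l\<in>UNIV. \<Sum>m\<in>UNIV.
      pd s (\<lambda>q. ginv g q l m) p * nC p [m, i, j, k, l] + ?G l m * pd s (\<lambda>q. nC q [m, i, j, k, l]) p) p"
    unfolding divC_def
    by (intro has_grad_sum has_grad_mult smooth_on_has_grad[OF open_U smooth_nC assms]
        differentiable_has_grad has_grad_differentiable[OF grad_ginv[OF assms]])
  note pd_divC = has_grad_pd[OF this]
  \<comment> \<open>The connection terms of the two contracted indices are grouped for
    \<open>contraction_christoffel\<close>; those of the free indices \<open>i\<close>,
    \<open>j\<close>, \<open>k\<close> go through \<open>contraction_swap\<close>.\<close>
  have "(\<Sum>l\<in>UNIV. \<Sum>m\<in>UNIV. ?G l m * nabla g nC p [s, m, i, j, k, l])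
    = (\<Sum>l\<in>UNIV. \<Sum>m\<in>UNIV. ?G l m * pd s (\<lambda>q. nC q [m, i, j, k, l]) p)
      - (\<Sum>l\<in>UNIV. \<Sum>m\<in>UNIV. ?G l m * (\<Sum>n\<in>UNIV. ?X n s m * nC p [n, i, j, k, l] + ?X n s l * nC p [m, i, j, k, n]))
      - (\<Sum>l\<in>UNIV. \<Sum>m\<in>UNIV. ?G l m * (\<Sum>n\<in>UNIV. ?X n s i * nC p [m, n, j, k, l]))
      - (\<Sum>l\<in>UNIV. \<Sum>m\<in>UNIV. ?G l m * (\<Sum>n\<in>UNIV. ?X n s j * nC p [m, i, n, k, l]))
      - (\<Sum>l\<in>UNIV. \<Sum>m\<in>UNIV. ?G l m * (\<Sum>n\<in>UNIV. ?X n s k * nC p [m, i, j, n, l]))"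
    unfolding nabla_5 by (simp add: sum.distrib sum_subtractf right_diff_distrib distrib_left)
  also have "\<dots> = pd s (\<lambda>q. divC q i j k) p - (\<Sum>n\<in>UNIV. ?X n s i * divC p n j k)
      - (\<Sum>n\<in>UNIV. ?X n s j * divC p i n k) - (\<Sum>n\<in>UNIV. ?X n s k * divC p i j n)"
    unfolding contraction_christoffel contraction_swap pd_divC divC_def[symmetric]
    by (simp add: pd_ginv[OF assms] sum.distrib sum_negf sum_subtractf algebra_simps)
  finally show ?thesis by (simp add: sum.distrib)
qed

definition dwM :: "point \<Rightarrow> 4 \<Rightarrow> 4 \<Rightarrow> 4 \<Rightarrow> real" where
  "dwM p m i j = (if i = 3 then gr (gr (a3 p) (a4 p) m) (gr (b3 p) (b4 p) m) j
     else if i = 4 then gr (gr (b3 p) (b4 p) m) (- gr (a3 p) (a4 p) m) j else 0)"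

lemma dwM_simps [simp]: "dwM p m 1 i = 0" "dwM p m 2 i = 0" "dwM p m i 1 = 0" "dwM p m i 2 = 0"
  "dwM p m 3 3 = gr (a3 p) (a4 p) m" "dwM p m 3 4 = gr (b3 p) (b4 p) m"
  "dwM p m 4 3 = gr (b3 p) (b4 p) m" "dwM p m 4 4 = - gr (a3 p) (a4 p) m"
  by (simp_all add: dwM_def)

lemma grad_wM:
  assumes "p \<in> U" shows "has_grad (\<lambda>q. wM q i j) (\<lambda>m. dwM p m i j) p"
  unfolding wM_def dwM_def gr_def
  by (intro has_grad_if has_grad_const has_grad_minus grad_a[OF assms, unfolded gr_def] grad_b[OF assms, unfolded gr_def])

definition dwC :: "point \<Rightarrow> 4 \<Rightarrow> 4 \<Rightarrow> 4 \<Rightarrow> 4 \<Rightarrow> 4 \<Rightarrow> real" where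
  "dwC p m i j k l = dl j 1 * dl k 1 * dwM p m i l + dl i 1 * dl l 1 * dwM p m j k
     - dl i 1 * dl k 1 * dwM p m j l - dl j 1 * dl l 1 * dwM p m i k"

lemma pd_weyl:
  assumes "p \<in> U"
  shows "pd m (\<lambda>q. weyl g q i j k l) p = (W p)\<^sup>2 * (2 * P m * Y p * wC p i j k l + dwC p m i j k l)"
proof -
  have "has_grad (\<lambda>q. (W q)\<^sup>2 * wC q i j k l)
      (\<lambda>m. (W p)\<^sup>2 * (2 * P m * Y p * wC p i j k l + dwC p m i j k l)) p"
    unfolding wC_def
    by (rule has_grad_eq[OF has_grad_mult[OF has_grad_power2[OF grad_W[OF assms]]
          has_grad_diff[OF has_grad_diff[OF has_grad_add[OF has_grad_mult[OF has_grad_const grad_wM[OF assms]]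
            has_grad_mult[OF has_grad_const grad_wM[OF assms]]] has_grad_mult[OF has_grad_const grad_wM[OF assms]]]
            has_grad_mult[OF has_grad_const grad_wM[OF assms]]]]])
       (simp add: dwC_def algebra_simps power2_eq_square)
  then show ?thesis
    using pd_cong[OF open_U assms weyl_eq] has_grad_pd by simp
qed

text \<open>The divergence of \<open>wM\<close> plus \<open>Y\<close> times its contraction with
  \<open>P\<close>. The coefficient of \<open>Y\<close> is n - 3 = 1, from the conformal change of a
  Weyl divergence in dimension n = 4.\<close>

definition v :: "point \<Rightarrow> 4 \<Rightarrow> real" where
  "v p = gr (a3 p + b4 p + Y p * (px * a p + py * b p)) (b3 p - a4 p + Y p * (px * b p - py * a p))"

lemma divC_eq:
  assumes "p \<in> U"
  shows "divC p i j k = dl k 1 * (dl j 1 * v p i - dl i 1 * v p j)"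
proof -
  have "\<forall>i j k. divC p i j k = dl k 1 * (dl j 1 * v p i - dl i 1 * v p j)"
    unfolding divC_def nabla_4 rank4_def using W_nz[OF assms]
    by (simp add: pd_weyl[OF assms] christoffel_eq[OF assms] weyl_eq[OF assms] ginv_eq[OF assms]
          forall_4 sum_4 wC_def dwC_def tables v_def)
       (simp add: field_simps)
  then show ?thesis by blast
qed

definition dv :: "point \<Rightarrow> 4 \<Rightarrow> 4 \<Rightarrow> real" where
  "dv p m = gr
     (gr (e p) (f p) m + P m * dY p * (px * a p + py * b p)
        + Y p * (px * gr (a3 p) (a4 p) m + py * gr (b3 p) (b4 p) m))
     (gr (f p) (- e p) m + P m * dY p * (px * b p - py * a p)
        + Y p * (px * gr (b3 p) (b4 p) m - py * gr (a3 p) (a4 p) m))"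

lemma grad_v:
  assumes "p \<in> U" shows "has_grad (\<lambda>q. v q i) (\<lambda>m. dv p m i) p"
proof -
  have "has_grad (\<lambda>q. a3 q + b4 q + Y q * (px * a q + py * b q)) (\<lambda>m. dv p m 3) p"
    by (rule has_grad_eq[OF has_grad_add[OF grad_d3[OF assms] has_grad_mult[OF grad_Y[OF assms]
          has_grad_add[OF has_grad_mult[OF has_grad_const grad_a[OF assms]]
            has_grad_mult[OF has_grad_const grad_b[OF assms]]]]]])
       (simp add: dv_def dY_def algebra_simps)
  moreover have "has_grad (\<lambda>q. b3 q - a4 q + Y q * (px * b q - py * a q)) (\<lambda>m. dv p m 4) p"
    by (rule has_grad_eq[OF has_grad_add[OF grad_d4[OF assms] has_grad_mult[OF grad_Y[OF assms]
          has_grad_diff[OF has_grad_mult[OF has_grad_const grad_b[OF assms]]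
            has_grad_mult[OF has_grad_const grad_a[OF assms]]]]]])
       (simp add: dv_def dY_def algebra_simps)
  moreover have "dv p m 1 = 0" "dv p m 2 = 0" for m by (simp_all add: dv_def)
  ultimately have "\<forall>i. has_grad (\<lambda>q. v q i) (\<lambda>m. dv p m i) p"
    unfolding forall_4 v_def by (simp add: has_grad_const)
  then show ?thesis by blast
qed

lemma pd_divC:
  assumes "p \<in> U"
  shows "pd m (\<lambda>q. divC q i j k) p = dl k 1 * (dl j 1 * dv p m i - dl i 1 * dv p m j)"
proof -
  have "has_grad (\<lambda>q. dl k 1 * (dl j 1 * v q i - dl i 1 * v q j))
      (\<lambda>m. dl k 1 * (dl j 1 * dv p m i - dl i 1 * dv p m j)) p"
    by (rule has_grad_eq[OF has_grad_mult[OF has_grad_const has_grad_diff[OF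
          has_grad_mult[OF has_grad_const grad_v[OF assms]] has_grad_mult[OF has_grad_const grad_v[OF assms]]]]])
       simp
  then show ?thesis
    using pd_cong[OF open_U assms divC_eq] has_grad_pd by simp
qed

text \<open>In the uu component the double divergence of \<open>wM\<close> is
  \<open>e - e = 0\<close> by biharmonicity. The terms with \<open>Y\<close> and a single divergence
  cancel against the connection, and for \<open>wM\<close> contracted twice with \<open>P\<close>
  the coefficients from \<open>dY\<close>, the connection and the Ricci tensor add up to 0.\<close>

lemma bach_eq_0:
  assumes "p \<in> U" shows "bach g p i k = 0"
proof -
  \<comment> \<open>Reorders the fourfold sum so that the pair \<open>l\<close>, \<open>m\<close> is
    contracted innermost.\<close>
  have "(\<Sum>j\<in>UNIV. \<Sum>l\<in>UNIV. \<Sum>s\<in>UNIV. \<Sum>m\<in>UNIV.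
        ginv g p j s * ginv g p l m * nabla g nC p [s, m, i, j, k, l])
    = (\<Sum>j\<in>UNIV. \<Sum>s\<in>UNIV. ginv g p j s * (\<Sum>l\<in>UNIV. \<Sum>m\<in>UNIV.
        ginv g p l m * nabla g nC p [s, m, i, j, k, l]))"
    by (subst sum.swap) (simp add: sum_distrib_left mult.assoc)
  also have "\<dots> = (\<Sum>j\<in>UNIV. \<Sum>s\<in>UNIV. ginv g p j s * (pd s (\<lambda>q. divC q i j k) p
      - (\<Sum>n\<in>UNIV. christoffel g p n s i * divC p n j k
        + christoffel g p n s j * divC p i n k + christoffel g p n s k * divC p i j n)))"
    by (simp add: contracted_nabla_nC[OF assms])
  finally have B: "bach g p i k = \<dots> + (\<Sum>j\<in>UNIV. \<Sum>l\<in>UNIV. ricci_up g p j l * weyl g p i j k l) / 2"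
    by (simp add: bach_def)
  have "\<forall>i k. (\<Sum>j\<in>UNIV. \<Sum>s\<in>UNIV. ginv g p j s * (pd s (\<lambda>q. divC q i j k) p
      - (\<Sum>n\<in>UNIV. christoffel g p n s i * divC p n j k
        + christoffel g p n s j * divC p i n k + christoffel g p n s k * divC p i j n)))
      + (\<Sum>j\<in>UNIV. \<Sum>l\<in>UNIV. ricci_up g p j l * weyl g p i j k l) / 2 = 0"
    unfolding ricci_up_def using W_nz[OF assms]
    by (simp add: pd_divC[OF assms] divC_eq[OF assms] christoffel_eq[OF assms] weyl_eq[OF assms]
          ginv_eq[OF assms] ricci_eq[OF assms] ric_def forall_4 sum_4 wC_def tables v_def dv_def)
       (simp add: dY_def field_simps eval_nat_numeral)
  then show ?thesis using B by simp
qed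

end

section \<open>Field equations and algebraic types\<close>

lemma hessian_eq:
  "hessian g \<phi> p i j = pd i (pd j \<phi>) p - (\<Sum>n\<in>UNIV. christoffel g p n i j * pd n \<phi> p)"
  by (simp add: hessian_def nabla_def rank0_def)

lemma pd_const: "pd i (\<lambda>_. r) p = 0"
  using has_grad_pd[OF has_grad_const] .

text \<open>For \<open>ricci_scalar\<close>, whose value is known on \<open>U\<close> only; openness
  makes its derivatives vanish there.\<close>

lemma hessian_locally_constant:
  assumes "open U" "\<And>q. q \<in> U \<Longrightarrow> \<phi> q = r" "p \<in> U"
  shows "hessian g \<phi> p i j = 0"
proof -
  have 1: "pd i \<phi> q = 0" if "q \<in> U" for q i
    using pd_cong[OF assms(1) that assms(2)] by (simp add: pd_const)
  have "pd i (pd j \<phi>) p = 0"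
    using pd_cong[OF assms(1,3) 1] by (simp add: pd_const)
  then show ?thesis by (simp add: hessian_eq 1[OF assms(3)])
qed

section \<open>Frame components and boost order\<close>

lemma lists_length_Suc: "{as :: 4 list. length as = Suc n} = (\<lambda>(a, as). a # as) ` (UNIV \<times> {as. length as = n})"
  by (force simp: length_Suc_conv image_iff)

text \<open>\<open>frame_component\<close> sums over index lists; peeling off the head gives nested
  sums over indices, which \<open>sum_4\<close> can expand.\<close>

lemma sum_lists_Suc:
  fixes \<phi> :: "4 list \<Rightarrow> real"
  shows "(\<Sum>as | length as = Suc n. \<phi> as) = (\<Sum>a\<in>UNIV. \<Sum>as | length as = n. \<phi> (a # as))"
  unfolding lists_length_Suc
  by (subst sum.reindex) (auto simp: inj_on_def sum.cartesian_product case_prod_unfold)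

lemma sum_lists_0: "(\<Sum>as | length as = 0. \<phi> as) = (\<phi> [] :: real)" for \<phi> :: "4 list \<Rightarrow> real"
  by simp

lemma frame_component_2:
  "frame_component T E [i, j] = (\<Sum>a\<in>UNIV. \<Sum>b\<in>UNIV. T [a, b] * (E i $ a * E j $ b))"
proof -
  have "length [i, j] = Suc (Suc 0)" by simp
  then show ?thesis
    unfolding frame_component_def by (simp only: sum_lists_Suc sum_lists_0) (simp add: mult.assoc)
qed

lemma frame_component_4:
  "frame_component T E [i, j, k, l] = (\<Sum>a\<in>UNIV. \<Sum>b\<in>UNIV. \<Sum>c\<in>UNIV. \<Sum>d\<in>UNIV.
     T [a, b, c, d] * (E i $ a * E j $ b * E k $ c * E l $ d))"
proof -
  have "length [i, j, k, l] = Suc (Suc (Suc (Suc 0)))" by simp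
  then show ?thesis
    unfolding frame_component_def
    by (simp only: sum_lists_Suc sum_lists_0) (simp add: mult.assoc)
qed

text \<open>Replaces the quantifier over index lists by one over indices, so that
  \<open>forall_4\<close> can enumerate all frame components.\<close>

lemma has_boost_order_2I:
  assumes "null_frame G E" "E 1 = l"
    and "frame_component T E [i, j] \<noteq> 0" "boost_weight [i, j] = w"
    and "\<And>i j. frame_component T E [i, j] \<noteq> 0 \<Longrightarrow> boost_weight [i, j] \<le> w"
  shows "has_boost_order G 2 T l w"
  unfolding has_boost_order_def
proof (intro exI[of _ E] conjI allI impI assms(1,2))
  show "\<exists>ks. length ks = 2 \<and> frame_component T E ks \<noteq> 0 \<and> boost_weight ks = w"
    using assms(3,4) by (intro exI[of _ "[i, j]"]) simp
  show "boost_weight ks \<le> w" if "length ks = 2 \<and> frame_component T E ks \<noteq> 0" for ks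
    using that assms(5) by (auto simp: numeral_2_eq_2 length_Suc_conv)
qed

lemma has_boost_order_4I:
  assumes "null_frame G E" "E 1 = l"
    and "frame_component T E [i, j, k, m] \<noteq> 0" "boost_weight [i, j, k, m] = w"
    and "\<And>i j k m. frame_component T E [i, j, k, m] \<noteq> 0 \<Longrightarrow> boost_weight [i, j, k, m] \<le> w"
  shows "has_boost_order G 4 T l w"
  unfolding has_boost_order_def
proof (intro exI[of _ E] conjI allI impI assms(1,2))
  show "\<exists>ks. length ks = 4 \<and> frame_component T E ks \<noteq> 0 \<and> boost_weight ks = w"
    using assms(3,4) by (intro exI[of _ "[i, j, k, m]"]) simp
  show "boost_weight ks \<le> w" if "length ks = 4 \<and> frame_component T E ks \<noteq> 0" for ks
    using that assms(5) by (auto simp: eval_nat_numeral length_Suc_conv)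
qed

context conformal_pp_wave
begin

text \<open>The frame \<open>\<partial>_r\<close>,
  \<open>- W^-2 (\<partial>_u + h \<partial>_r)\<close>, \<open>W^-1 \<partial>_x\<close>,
  \<open>W^-1 \<partial>_y\<close>. As the first vector is to be \<open>d_r\<close> exactly, the
  whole scaling by \<open>W^-2\<close> falls on the second.\<close>

definition fr :: "point \<Rightarrow> 4 \<Rightarrow> real ^ 4" where
  "fr p i = (\<chi> j. if i = 1 then dl j 2
     else if i = 2 then (if j = 1 then - (inverse (W p))\<^sup>2 else if j = 2 then - h p * (inverse (W p))\<^sup>2 else 0)
     else dl i j * inverse (W p))"

lemma fr_simps [simp]:
  "fr p 1 $ 1 = 0" "fr p 1 $ 2 = 1" "fr p 1 $ 3 = 0" "fr p 1 $ 4 = 0"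
  "fr p 2 $ 1 = - (inverse (W p))\<^sup>2" "fr p 2 $ 2 = - h p * (inverse (W p))\<^sup>2" "fr p 2 $ 3 = 0" "fr p 2 $ 4 = 0"
  "fr p 3 $ 1 = 0" "fr p 3 $ 2 = 0" "fr p 3 $ 3 = inverse (W p)" "fr p 3 $ 4 = 0"
  "fr p 4 $ 1 = 0" "fr p 4 $ 2 = 0" "fr p 4 $ 3 = 0" "fr p 4 $ 4 = inverse (W p)"
  by (simp_all add: fr_def dl_def)

lemma null_frame_fr: "p \<in> U \<Longrightarrow> null_frame (g p) (fr p)"
  using W_nz[of p] by (simp add: null_frame_def ip_def sum_4 g_eq) (simp add: field_simps power2_eq_square)

lemma fr_1: "fr p 1 = d_r"
  by (simp add: d_r_def vec_eq_iff forall_4 axis_def)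

lemma lorentzian_metric_g: "lorentzian_metric U g"
  unfolding lorentzian_metric_def
proof (intro conjI ballI allI open_U smooth_g)
  fix p assume p: "p \<in> U"
  show "transpose (g p) = g p"
    by (simp add: vec_eq_iff transpose_def g_eq[OF p] \<eta>_sym)
  \<comment> \<open>From a null pair with product 1: \<open>\<ell> - n / 2\<close> has square -1,
    \<open>\<ell> + n / 2\<close> has square 1, and they are orthogonal.\<close>
  define E where "E i = (if i = 1 then fr p 1 - (1/2) *\<^sub>R fr p 2
    else if i = 2 then fr p 1 + (1/2) *\<^sub>R fr p 2 else fr p i)" for i
  have "\<forall>i j. ip (g p) (E i) (E j) = (if i = j then (if i = 1 then -1 else 1) else 0)"
    using W_nz[OF p] by (simp add: forall_4 ip_def sum_4 g_eq[OF p] E_def) (simp add: field_simps power2_eq_square power4_eq_xxxx)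
  then show "lorentzian_signature (g p)" unfolding lorentzian_signature_def by blast
qed

text \<open>With R = 4 \<Lambda> the Einstein bracket and the traceless Ricci tensor both equal
  \<open>R_ab - \<Lambda> g_ab\<close>; their coefficients \<open>\<gamma>'\<close> and
  \<open>8 \<beta>' \<Lambda>\<close> add up to 0.\<close>

lemma quadratic_gravity:
  assumes "\<Lambda> = 3 * L * (px\<^sup>2 + py\<^sup>2)" "\<gamma>' = - 8 * \<beta>' * \<Lambda>"
  shows "quadratic_gravity_vacuum \<alpha>' \<beta>' \<gamma>' \<Lambda> U g"
  unfolding quadratic_gravity_vacuum_def
proof (intro conjI ballI allI lorentzian_metric_g)
  fix p i j assume p: "p \<in> U"
  have H: "hessian g (ricci_scalar g) p i j = 0" for i j
    by (rule hessian_locally_constant[OF open_U ricci_scalar_eq p])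
  have R: "ricci_scalar g p = 4 * \<Lambda>" using ricci_scalar_eq[OF p] assms(1) by simp
  show "\<gamma>' * (ricci g p i j - ricci_scalar g p * g p $ i $ j / 2 + \<Lambda> * g p $ i $ j)
        - 4 * \<alpha>' * bach g p i j
        + 2 * \<beta>' * ((ricci g p i j - ricci_scalar g p * g p $ i $ j / 4) * ricci_scalar g p
                   + g p $ i $ j * box g (ricci_scalar g) p
                   - hessian g (ricci_scalar g) p j i) = 0"
    unfolding box_def H R bach_eq_0[OF p] assms(2) by (simp add: algebra_simps)
qed

text \<open>The 256-term contraction is evaluated once for arbitrary vectors; only their components
  1, 3, 4 enter, and \<open>M\<close> is the bilinear form of \<open>wM\<close>.\<close>

lemma weyl_vectors:
  fixes x y z t :: "real ^ 4"
  assumes "p \<in> U"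
  shows "(\<Sum>i\<in>UNIV. \<Sum>j\<in>UNIV. \<Sum>k\<in>UNIV. \<Sum>l\<in>UNIV. weyl g p i j k l * (x $ i * y $ j * z $ k * t $ l))
    = (W p)\<^sup>2 * (let M = (\<lambda>r s. a p * r $ 3 * s $ 3 + b p * r $ 3 * s $ 4 + b p * r $ 4 * s $ 3 - a p * r $ 4 * s $ 4)
        in y $ 1 * z $ 1 * M x t + x $ 1 * t $ 1 * M y z - x $ 1 * z $ 1 * M y t - y $ 1 * t $ 1 * M x z)"
  by (simp add: weyl_eq[OF assms] sum_4 wC_def dl_def Let_def) (simp add: algebra_simps)

lemma weyl_frame_component:
  "p \<in> U \<Longrightarrow> frame_component (rank4 (weyl g) p) (fr p) [i, j, k, l] =
    (W p)\<^sup>2 * (let M = (\<lambda>r s. a p * r $ 3 * s $ 3 + b p * r $ 3 * s $ 4 + b p * r $ 4 * s $ 3 - a p * r $ 4 * s $ 4)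
        in fr p j $ 1 * fr p k $ 1 * M (fr p i) (fr p l) + fr p i $ 1 * fr p l $ 1 * M (fr p j) (fr p k)
         - fr p i $ 1 * fr p k $ 1 * M (fr p j) (fr p l) - fr p j $ 1 * fr p l $ 1 * M (fr p i) (fr p k))"
  using weyl_vectors[of p "fr p i" "fr p j" "fr p k" "fr p l"] by (simp add: frame_component_4 rank4_def)

lemma weyl_eq_0_iff: "p \<in> U \<Longrightarrow> weyl g p = (\<lambda>_ _ _ _. 0) \<longleftrightarrow> a p = 0 \<and> b p = 0"
proof
  assume p: "p \<in> U"
  show "a p = 0 \<and> b p = 0" if "weyl g p = (\<lambda>_ _ _ _. 0)"
    using weyl_eq[OF p, of 1 3 1 3] weyl_eq[OF p, of 1 3 1 4] W_nz[OF p] that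
    by (simp add: wC_def dl_def)
  show "weyl g p = (\<lambda>_ _ _ _. 0)" if "a p = 0 \<and> b p = 0"
    using that by (intro ext) (simp add: weyl_eq[OF p] wC_def wM_def gr_def)
qed

text \<open>Only the second frame vector has a u-component, and each term contains two of these. The
  other two slots are paired by \<open>M\<close>, to which only the third and fourth vector
  contribute. So a nonzero component has exactly two n's and no \<open>\<ell>\<close>.\<close>

lemma weyl_type_N:
  assumes p: "p \<in> U" and "weyl g p \<noteq> (\<lambda>_ _ _ _. 0)"
  shows "weyl_boost_order g p d_r (-2)"
proof -
  have ab: "a p \<noteq> 0 \<or> b p \<noteq> 0" using assms weyl_eq_0_iff by blast
  note fc = weyl_frame_component[OF p]
  have le: "\<forall>i j k l. frame_component (rank4 (weyl g) p) (fr p) [i, j, k, l] \<noteq> 0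
      \<longrightarrow> boost_weight [i, j, k, l] \<le> -2"
    unfolding forall_4 fc by (simp add: boost_weight_def)
  \<comment> \<open>\<open>[2, 3, 2, 3]\<close> detects \<open>a p\<close>, and
    \<open>[2, 3, 2, 4]\<close> detects \<open>b p\<close>.\<close>
  obtain m where "frame_component (rank4 (weyl g) p) (fr p) [2, 3, 2, m] \<noteq> 0" "boost_weight [2, 3, 2, m] = -2"
  proof (cases "a p = 0")
    case True then show ?thesis using ab W_nz[OF p] by (intro that[of 4]) (simp_all add: fc boost_weight_def)
  next
    case False then show ?thesis using W_nz[OF p] by (intro that[of 3]) (simp_all add: fc boost_weight_def)
  qed
  then show ?thesis
    unfolding weyl_boost_order_def using le
    by (intro has_boost_order_4I[OF null_frame_fr[OF p] fr_1]) blast+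
qed

text \<open>The null radiation part: the coefficient of the separate \<open>du^2\<close> term in
  \<open>ric\<close>.\<close>

definition nS :: "point \<Rightarrow> real" where
  "nS p = - 2 * tr p - 2 * Y p * (h3 p * px + h4 p * py)"

text \<open>Brings \<open>K\<close> into the curvature: the coefficient \<open>L W^2 + Y^2\<close>
  in \<open>ric\<close> is the first integral divided by \<open>W^2\<close>, so that K = 0 leaves
  only the \<open>du^2\<close> part of the traceless Ricci tensor.\<close>

lemma first_integral': "p \<in> U \<Longrightarrow> L * (W p)\<^sup>2 + (Y p)\<^sup>2 = K / (W p)\<^sup>2"
  using first_integral[of p] W_nz[of p] by (simp add: field_simps power4_eq_xxxx power2_eq_square)

lemma ric_eq:
  assumes "p \<in> U"
  shows "ric p i j = dl i 1 * dl j 1 * nS p + K / (W p)\<^sup>2 * (4 * P i * P j - (px\<^sup>2 + py\<^sup>2) * \<eta> p i j)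
     + 3 * L * (px\<^sup>2 + py\<^sup>2) * (W p)\<^sup>2 * \<eta> p i j"
  unfolding ric_def nS_def first_integral'[OF assms, symmetric] by (simp add: algebra_simps)

lemma traceless_ricci_eq:
  assumes "p \<in> U"
  shows "traceless_ricci g p i j = dl i 1 * dl j 1 * nS p + K / (W p)\<^sup>2 * (4 * P i * P j - (px\<^sup>2 + py\<^sup>2) * \<eta> p i j)"
  by (simp add: traceless_ricci_def ricci_eq[OF assms] ric_eq[OF assms] ricci_scalar_eq[OF assms] g_eq[OF assms])

text \<open>The \<open>du^2\<close> part is null and orthogonal to \<open>P\<close>, hence drops
  out. The trace part gives \<open>R^2 / 4\<close>; the square of
  \<open>4 P P - |P|^2 \<eta>\<close> is \<open>(16 - 8 + 4) |P|^4\<close>, whence the factor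
  12.\<close>

lemma ricci_square_eq:
  assumes "p \<in> U"
  shows "ricci_square g p = 36 * L\<^sup>2 * (px\<^sup>2 + py\<^sup>2)\<^sup>2 + 12 * K\<^sup>2 * (px\<^sup>2 + py\<^sup>2)\<^sup>2 / (W p) ^ 8"
  using W_nz[OF assms]
  by (simp add: ricci_square_def ricci_up_def ricci_eq[OF assms] ric_eq[OF assms] ginv_eq[OF assms] sum_4 dl_def)
     (simp add: field_simps eval_nat_numeral)

lemma ricci_frame_component:
  assumes "p \<in> U"
  shows "frame_component (rank2 (traceless_ricci g) p) (fr p) [i, j] =
    (\<Sum>k\<in>UNIV. \<Sum>l\<in>UNIV. (dl k 1 * dl l 1 * nS p + K / (W p)\<^sup>2 * (4 * P k * P l - (px\<^sup>2 + py\<^sup>2) * \<eta> p k l))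
      * (fr p i $ k * fr p j $ l))"
  by (simp add: frame_component_2 rank2_def traceless_ricci_eq[OF assms])

lemma traceless_ricci_type_II:
  assumes p: "p \<in> U" and "K \<noteq> 0" "px\<^sup>2 + py\<^sup>2 \<noteq> 0"
  shows "ricci_boost_order g p d_r 0"
  unfolding ricci_boost_order_def
proof (rule has_boost_order_2I[OF null_frame_fr[OF p] fr_1])
  note fc = ricci_frame_component[OF p]
  \<comment> \<open>\<open>P\<close> annihilates \<open>d_r\<close>, so the value is
    \<open>- K (px^2 + py^2) / W^4\<close>.\<close>
  show "frame_component (rank2 (traceless_ricci g) p) (fr p) [1, 2] \<noteq> 0"
    unfolding fc using W_nz[OF p] assms(2,3) by (auto simp: sum_4 dl_def)
  show "boost_weight [1, 2] = 0" by (simp add: boost_weight_def)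
  have "\<forall>i j. frame_component (rank2 (traceless_ricci g) p) (fr p) [i, j] \<noteq> 0 \<longrightarrow> boost_weight [i, j] \<le> 0"
    unfolding forall_4 fc by (simp add: boost_weight_def sum_4 dl_def)
  then show "frame_component (rank2 (traceless_ricci g) p) (fr p) [i, j] \<noteq> 0 \<Longrightarrow> boost_weight [i, j] \<le> 0" for i j
    by blast
qed

lemma traceless_ricci_eq_0_iff:
  assumes p: "p \<in> U" and "K = 0" shows "traceless_ricci g p = (\<lambda>_ _. 0) \<longleftrightarrow> nS p = 0"
proof
  show "nS p = 0" if "traceless_ricci g p = (\<lambda>_ _. 0)"
    using that traceless_ricci_eq[OF p, of 1 1] assms(2) by (simp add: dl_def)
  show "traceless_ricci g p = (\<lambda>_ _. 0)" if "nS p = 0"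
    using that by (intro ext) (simp add: traceless_ricci_eq[OF p] assms(2))
qed

lemma traceless_ricci_type_N:
  assumes p: "p \<in> U" and "K = 0" "traceless_ricci g p \<noteq> (\<lambda>_ _. 0)"
  shows "ricci_boost_order g p d_r (-2)"
  unfolding ricci_boost_order_def
proof (rule has_boost_order_2I[OF null_frame_fr[OF p] fr_1])
  note fc = ricci_frame_component[OF p]
  \<comment> \<open>The only surviving frame component, equal to \<open>nS / W^4\<close>.\<close>
  show "frame_component (rank2 (traceless_ricci g) p) (fr p) [2, 2] \<noteq> 0"
    unfolding fc using W_nz[OF p] assms(2,3) traceless_ricci_eq_0_iff[OF p] by (simp add: sum_4 dl_def)
  show "boost_weight [2, 2] = -2" by (simp add: boost_weight_def)
  have "\<forall>i j. frame_component (rank2 (traceless_ricci g) p) (fr p) [i, j] \<noteq> 0 \<longrightarrow> boost_weight [i, j] \<le> -2"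
    unfolding forall_4 fc by (simp add: boost_weight_def sum_4 dl_def assms(2))
  then show "frame_component (rank2 (traceless_ricci g) p) (fr p) [i, j] \<noteq> 0 \<Longrightarrow> boost_weight [i, j] \<le> -2" for i j
    by blast
qed

end

section \<open>The seed metric\<close>

text \<open>Lets the differentiation rules build the gradient as a schematic variable, whose four
  components are then compared with the expected ones.\<close>

lemma has_grad_eq4:
  assumes "has_grad f d p" "d 1 = d' 1" "d 2 = d' 2" "d 3 = d' 3" "d 4 = d' 4"
  shows "has_grad f d' p"
proof -
  have "\<forall>i. d i = d' i" using assms by (simp add: forall_4)
  then show ?thesis using assms(1) has_grad_eq by blast
qed

lemma zeta_eq: "zeta p = of_real (p $ 3) + \<i> * of_real (p $ 4)"
  by (simp add: zeta_def complex_eq_iff)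

lemma continuous_on_zeta: "continuous_on A zeta"
  unfolding zeta_eq[abs_def] by (intro continuous_intros)

lemma continuous_on_lin: "continuous_on A (lin pu px py)"
  unfolding lin_def[abs_def] by (intro continuous_intros)

lemma grad_lin: "has_grad (lin pu px py) (\<lambda>i. if i = 1 then pu else gr px py i) p"
  unfolding lin_def[abs_def]
  by (rule has_grad_eq4, (rule has_grad_add has_grad_mult has_grad_const has_grad_coord)+) auto

text \<open>Since \<open>zeta\<close> is real linear, the chain rule multiplies by the complex
  derivative; its y-component carries a factor i, whence the Cauchy-Riemann pattern.\<close>

lemma grad_holomorphic:
  assumes "open D" "f holomorphic_on D" "zeta p \<in> D"
  shows "has_grad (\<lambda>q. Re (f (zeta q))) (gr (Re (deriv f (zeta p))) (- Im (deriv f (zeta p)))) p"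
    and "has_grad (\<lambda>q. Im (f (zeta q))) (gr (Im (deriv f (zeta p))) (Re (deriv f (zeta p)))) p"
proof -
  have "(f has_field_derivative deriv f (zeta p)) (at (zeta p))"
    using assms holomorphic_derivI by blast
  then have f: "(f has_derivative (*) (deriv f (zeta p))) (at (zeta p))"
    by (simp add: has_field_derivative_def)
  have "(zeta has_derivative zeta) (at p)"
    unfolding zeta_eq[abs_def]
    by (intro bounded_linear_imp_has_derivative bounded_linear_add
      bounded_linear_compose[OF bounded_linear_of_real bounded_linear_vec_nth]
      bounded_linear_compose[OF bounded_linear_mult_right bounded_linear_compose[OF bounded_linear_of_real bounded_linear_vec_nth]])
  note D = has_derivative_compose[OF this f]
  show "has_grad (\<lambda>q. Re (f (zeta q))) (gr (Re (deriv f (zeta p))) (- Im (deriv f (zeta p)))) p"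
    using bounded_linear.has_derivative[OF bounded_linear_Re D]
    by (simp add: has_grad_def sum_4 zeta_eq)
  show "has_grad (\<lambda>q. Im (f (zeta q))) (gr (Im (deriv f (zeta p))) (Re (deriv f (zeta p)))) p"
    using bounded_linear.has_derivative[OF bounded_linear_Im D]
    by (simp add: has_grad_def sum_4 zeta_eq algebra_simps)
qed

lemma Ck_on_if: "Ck_on k A U \<Longrightarrow> Ck_on k B U \<Longrightarrow> Ck_on k (\<lambda>p. if Q then A p else B p) U"
  by (cases Q) simp_all

text \<open>Real and imaginary part are treated jointly and for all \<open>f\<close> at once,
  because the gradient of either consists of both parts of \<open>deriv f\<close>.\<close>

lemma Ck_on_holomorphic:
  assumes "open D" "open U" "\<And>p. p \<in> U \<Longrightarrow> zeta p \<in> D"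
  shows "f holomorphic_on D \<Longrightarrow> Ck_on k (\<lambda>p. Re (f (zeta p))) U \<and> Ck_on k (\<lambda>p. Im (f (zeta p))) U"
proof (induction k arbitrary: f)
  case 0
  have "continuous_on U (\<lambda>p. f (zeta p))"
    by (rule continuous_on_compose2[OF holomorphic_on_imp_continuous_on[OF 0] continuous_on_zeta])
      (use assms(3) in auto)
  then show ?case by (auto intro!: continuous_on_Re continuous_on_Im)
next
  case (Suc k)
  note f = Suc.prems
  have f': "Ck_on k (\<lambda>p. Re (deriv f (zeta p))) U" "Ck_on k (\<lambda>p. Im (deriv f (zeta p))) U"
    using Suc.IH[OF holomorphic_deriv[OF f assms(1)]] by auto
  have m: "Ck_on k (\<lambda>p. - Im (deriv f (zeta p))) U"
    using Ck_on_mult[OF assms(2) Ck_on_const[OF assms(2), of k "-1"] f'(2)] by simp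
  show ?case
    by (intro conjI Ck_on_SucI[OF assms(2) grad_holomorphic(1)[OF assms(1) f assms(3), unfolded gr_def]]
        Ck_on_SucI[OF assms(2) grad_holomorphic(2)[OF assms(1) f assms(3), unfolded gr_def]]
        Ck_on_if f' m Ck_on_const[OF assms(2)])
qed

lemma smooth_on_holomorphic:
  assumes "open D" "open U" "\<And>p. p \<in> U \<Longrightarrow> zeta p \<in> D" "f holomorphic_on D"
  shows "smooth_on (\<lambda>p. Re (f (zeta p))) U" "smooth_on (\<lambda>p. Im (f (zeta p))) U"
  using Ck_on_holomorphic[OF assms] by (simp_all add: smooth_on_def)

lemma smooth_on_coord: "open U \<Longrightarrow> smooth_on (\<lambda>p. p $ i) U"
proof -
  assume U: "open U"
  have "Ck_on k (\<lambda>p. p $ i) U" for k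
  proof (cases k)
    case (Suc n)
    show ?thesis unfolding Suc
      by (rule Ck_on_SucI[OF U has_grad_coord]) (simp add: Ck_on_const[OF U])
  qed (auto intro: continuous_intros)
  then show ?thesis by (simp add: smooth_on_def)
qed

text \<open>The data in one variable: \<open>w\<close> is the conformal factor as a function of z
  and \<open>y\<close> its logarithmic derivative, that is \<open>W\<close> and \<open>Y\<close>
  before composition with \<open>lin\<close>.\<close>

locale conformal_seed =
  fixes F G :: "complex \<Rightarrow> complex" and D :: "complex set" and pu px py L K :: real
    and w y :: "real \<Rightarrow> real" and T :: "real set"
  assumes open_D: "open D" and F: "F holomorphic_on D" and G: "G holomorphic_on D" and open_T: "open T"
    and w_nz: "\<And>t. t \<in> T \<Longrightarrow> w t \<noteq> 0"
    and dw: "\<And>t. t \<in> T \<Longrightarrow> (w has_real_derivative y t * w t) (at t)"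
    and dy: "\<And>t. t \<in> T \<Longrightarrow> (y has_real_derivative (- 2 * L * (w t)\<^sup>2 - (y t)\<^sup>2)) (at t)"
    and y2: "\<And>t. t \<in> T \<Longrightarrow> (y t)\<^sup>2 * (w t)\<^sup>2 = K - L * (w t) ^ 4"
begin

abbreviation "z \<equiv> lin pu px py"

abbreviation "U \<equiv> {p. zeta p \<in> D \<and> z p \<in> T}"

abbreviation "g \<equiv> conformal (\<lambda>p. w (z p)) (seed_metric F G)"

lemma open_U: "open U"
proof -
  have "open (zeta -` D \<inter> UNIV)" "open (z -` T \<inter> UNIV)"
    using continuous_open_vimage continuous_on_zeta continuous_on_lin open_D open_T
    by (metis continuous_on_open_vimage open_UNIV)+
  then have "open ((zeta -` D) \<inter> (z -` T))" by auto
  then show ?thesis by (simp add: Collect_conj_eq vimage_def)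
qed

text \<open>The differential equations for \<open>w\<close> and \<open>y\<close> form a closed
  polynomial system, so each step of a joint induction raises the order of both by one.\<close>

lemma smooth_factor: "smooth_on (\<lambda>p. w (z p)) U" "smooth_on (\<lambda>p. y (z p)) U"
proof -
  have "Ck_on k (\<lambda>p. w (z p)) U \<and> Ck_on k (\<lambda>p. y (z p)) U" for k
  proof (induction k)
    case 0
    have "continuous_on T w" "continuous_on T y"
      using dw dy by (auto intro!: continuous_at_imp_continuous_on DERIV_isCont)
    then show ?case
      by (auto intro!: continuous_on_compose2[OF _ continuous_on_lin])
  next
    case (Suc k)
    note I = Ck_on_if Ck_on_mult[OF open_U] Ck_on_add[OF open_U] Ck_on_const[OF open_U]
    have w: "has_grad (\<lambda>p. w (z p)) (\<lambda>i. (y (z p) * w (z p)) * (if i = 1 then pu else gr px py i)) p" if "p \<in> U" for p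
      using that by (intro has_grad_compose[OF dw grad_lin]) auto
    have y: "has_grad (\<lambda>p. y (z p)) (\<lambda>i. ((- 2 * L) * (w (z p) * w (z p)) + (-1) * (y (z p) * y (z p))) * (if i = 1 then pu else gr px py i)) p" if "p \<in> U" for p
      using that has_grad_compose[OF dy[of "z p"] grad_lin[of pu px py p]] by (simp add: power2_eq_square)
    show ?case
      unfolding gr_def
      by (intro conjI Ck_on_SucI[OF open_U w[unfolded gr_def]] Ck_on_SucI[OF open_U y[unfolded gr_def]] I)
         (use Suc.IH in auto)
  qed
  then show "smooth_on (\<lambda>p. w (z p)) U" "smooth_on (\<lambda>p. y (z p)) U"
    by (simp_all add: smooth_on_def)
qed

abbreviation "R \<phi> \<equiv> (\<lambda>p. Re (\<phi> (zeta p)))"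
abbreviation "I \<phi> \<equiv> (\<lambda>p. Im (\<phi> (zeta p)))"
abbreviation "F1 \<equiv> deriv F"
abbreviation "F2 \<equiv> deriv F1"
abbreviation "F3 \<equiv> deriv F2"
abbreviation "G1 \<equiv> deriv G"
abbreviation "G2 \<equiv> deriv G1"
abbreviation "G3 \<equiv> deriv G2"

lemmas holo = F G holomorphic_deriv[OF F open_D] holomorphic_deriv[OF G open_D]
  holomorphic_deriv[OF holomorphic_deriv[OF F open_D] open_D]
  holomorphic_deriv[OF holomorphic_deriv[OF G open_D] open_D]

lemmas grads = has_grad_add has_grad_diff has_grad_mult has_grad_minus has_grad_const has_grad_coord
  grad_holomorphic[OF open_D F] grad_holomorphic[OF open_D G]
  grad_holomorphic[OF open_D holo(3)] grad_holomorphic[OF open_D holo(4)]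
  grad_holomorphic[OF open_D holo(5)] grad_holomorphic[OF open_D holo(6)]

lemma seed_profile_eq: "seed_profile F G u (p $ 3) (p $ 4) = 2 * R F p + 2 * (p $ 3 * R G p + p $ 4 * I G p)"
  by (simp add: seed_profile_def Let_def zeta_def)

text \<open>The entries are complex derivatives of the profile: \<open>h3 - i h4\<close> is twice
  \<open>F' + cnj \<zeta> G' + cnj G\<close>, \<open>a - i b\<close> is twice
  \<open>F'' + cnj \<zeta> G''\<close>, and \<open>tr = 4 Re G'\<close> is half the Laplacian. The
  last two entries are \<open>4 Re G'''\<close> and \<open>- 4 Im G'''\<close>, because the
  divergence of \<open>wM\<close> is \<open>4 G''\<close> in complex form.\<close>

lemma conformal_pp_wave: "conformal_pp_wave U g pu px py L K (\<lambda>p. w (z p)) (\<lambda>p. y (z p))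
  (\<lambda>p. 2 * R F p + 2 * (p $ 3 * R G p + p $ 4 * I G p))
  (\<lambda>p. 2 * (R F1 p + p $ 3 * R G1 p + p $ 4 * I G1 p + R G p))
  (\<lambda>p. - 2 * (I F1 p + p $ 3 * I G1 p - p $ 4 * R G1 p - I G p))
  (\<lambda>p. 4 * R G1 p)
  (\<lambda>p. 2 * (R F2 p + p $ 3 * R G2 p + p $ 4 * I G2 p))
  (\<lambda>p. - 2 * (I F2 p + p $ 3 * I G2 p - p $ 4 * R G2 p))
  (\<lambda>p. 2 * (R F3 p + p $ 3 * R G3 p + p $ 4 * I G3 p + R G2 p))
  (\<lambda>p. 2 * (p $ 4 * R G3 p - I F3 p - p $ 3 * I G3 p + I G2 p))
  (\<lambda>p. - 2 * (I F3 p + p $ 3 * I G3 p - p $ 4 * R G3 p + I G2 p))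
  (\<lambda>p. - 2 * (R F3 p + p $ 3 * R G3 p + p $ 4 * I G3 p - R G2 p))
  (\<lambda>p. 4 * R G3 p) (\<lambda>p. - 4 * I G3 p)"
proof (unfold_locales, goal_cases)
  case 1 show ?case by (rule open_U)
next
  case (2 p i j) then show ?case
    by (simp add: conformal_def seed_metric_def pp_wave_def seed_profile_eq[of _ p])
next
  case (3 p) then show ?case using w_nz by simp
next
  case (4 p) then show ?case
    using has_grad_compose[OF dw[of "z p"] grad_lin[of pu px py p]] by (simp add: mult.commute)
next
  case (5 p) then show ?case
    using has_grad_compose[OF dy[of "z p"] grad_lin[of pu px py p]] by (simp add: mult.commute)
next
  case (6 p) then show ?case using y2 by simp
next
  case (7 p) then show ?case
    by - (rule has_grad_eq4, (rule grads | simp; fail)+; (simp add: algebra_simps)?)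
next
  case (8 p) then show ?case
    by - (rule has_grad_eq4, (rule grads | simp; fail)+; (simp add: algebra_simps)?)
next
  case (9 p) then show ?case
    by - (rule has_grad_eq4, (rule grads | simp; fail)+; (simp add: algebra_simps)?)
next
  case (10 p) then show ?case
    by - (rule has_grad_eq4, (rule grads | simp; fail)+; (simp add: algebra_simps)?)
next
  case (11 p) then show ?case
    by - (rule has_grad_eq4, (rule grads | simp; fail)+; (simp add: algebra_simps)?)
next
  case (12 p)
  \<comment> \<open>In \<open>a3 + b4\<close> the third derivatives cancel and the harmonic function
    \<open>4 Re G''\<close> is left; similarly \<open>b3 - a4\<close> is
    \<open>- 4 Im G''\<close>.\<close>
  then have "has_grad (\<lambda>p. 4 * R G2 p) (gr (4 * R G3 p) (- 4 * I G3 p)) p"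
    by - (rule has_grad_eq4, (rule grads | simp; fail)+; (simp add: algebra_simps)?)
  then show ?case by (simp add: algebra_simps)
next
  case (13 p)
  then have "has_grad (\<lambda>p. - 4 * I G2 p) (gr (- 4 * I G3 p) (- (4 * R G3 p))) p"
    by - (rule has_grad_eq4, (rule grads | simp; fail)+; (simp add: algebra_simps)?)
  then show ?case by (simp add: algebra_simps)
next
  case 14 show ?case by (rule smooth_factor)
next
  case 15 show ?case by (rule smooth_factor)
next
  case 16 show ?case
    by (intro smooth_on_add smooth_on_mult smooth_on_const smooth_on_coord open_U smooth_on_holomorphic[OF open_D] holo) auto
next
  case 17 show ?case
    by (intro smooth_on_add smooth_on_mult smooth_on_const smooth_on_coord open_U smooth_on_holomorphic[OF open_D] holo) auto
next
  case 18 show ?case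
    by (intro smooth_on_add smooth_on_diff smooth_on_mult smooth_on_const smooth_on_coord open_U smooth_on_holomorphic[OF open_D] holo) auto
qed

interpretation C: conformal_pp_wave U g pu px py L K "\<lambda>p. w (z p)" "\<lambda>p. y (z p)"
  "\<lambda>p. 2 * R F p + 2 * (p $ 3 * R G p + p $ 4 * I G p)"
  "\<lambda>p. 2 * (R F1 p + p $ 3 * R G1 p + p $ 4 * I G1 p + R G p)"
  "\<lambda>p. - 2 * (I F1 p + p $ 3 * I G1 p - p $ 4 * R G1 p - I G p)"
  "\<lambda>p. 4 * R G1 p"
  "\<lambda>p. 2 * (R F2 p + p $ 3 * R G2 p + p $ 4 * I G2 p)"
  "\<lambda>p. - 2 * (I F2 p + p $ 3 * I G2 p - p $ 4 * R G2 p)"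
  "\<lambda>p. 2 * (R F3 p + p $ 3 * R G3 p + p $ 4 * I G3 p + R G2 p)"
  "\<lambda>p. 2 * (p $ 4 * R G3 p - I F3 p - p $ 3 * I G3 p + I G2 p)"
  "\<lambda>p. - 2 * (I F3 p + p $ 3 * I G3 p - p $ 4 * R G3 p + I G2 p)"
  "\<lambda>p. - 2 * (R F3 p + p $ 3 * R G3 p + p $ 4 * I G3 p - R G2 p)"
  "\<lambda>p. 4 * R G3 p" "\<lambda>p. - 4 * I G3 p"
  "\<lambda>i. if i = 1 then pu else gr px py i" 
  "\<lambda>p i j. if i = 1 \<and> j = 1 then 2 * (2 * R F p + 2 * (p $ 3 * R G p + p $ 4 * I G p))
     else if (i = 1 \<and> j = 2) \<or> (i = 2 \<and> j = 1) then -1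
     else if (i = 3 \<and> j = 3) \<or> (i = 4 \<and> j = 4) then 1
     else 0"
  by (rule conformal_pp_wave)

lemmas lorentzian_metric_g = C.lorentzian_metric_g
lemmas quadratic_gravity = C.quadratic_gravity
lemmas ricci_scalar_eq = C.ricci_scalar_eq
lemmas ricci_square_eq = C.ricci_square_eq
lemmas weyl_type_N = C.weyl_type_N
lemmas traceless_ricci_type_II = C.traceless_ricci_type_II
lemmas traceless_ricci_type_N = C.traceless_ricci_type_N

text \<open>The complex number on the right is \<open>(a - i b) / 2\<close>.\<close>

lemma weyl_eq_0_iff:
  "p \<in> U \<Longrightarrow> weyl g p = (\<lambda>_ _ _ _. 0) \<longleftrightarrow> F2 (zeta p) + cnj (zeta p) * G2 (zeta p) = 0"
  by (subst C.weyl_eq_0_iff) (auto simp: complex_eq_iff zeta_def algebra_simps)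

text \<open>\<open>h3 px + h4 py\<close> is the real part of \<open>(px + i py) (h3 - i h4)\<close>,
  so the condition is \<open>nS = 0\<close> divided by 4.\<close>

lemma traceless_ricci_eq_0_iff:
  "p \<in> U \<Longrightarrow> K = 0 \<Longrightarrow> traceless_ricci g p = (\<lambda>_ _. 0) \<longleftrightarrow>
     - 2 * Re (G1 (zeta p)) = y (z p) * Re (Complex px py *
       (F1 (zeta p) + cnj (zeta p) * G1 (zeta p) + cnj (G (zeta p))))"
  by (subst C.traceless_ricci_eq_0_iff, simp, simp, subst C.nS_def) (auto simp: zeta_def algebra_simps)

end

section \<open>The lemniscate sine\<close>

text \<open>By the identity theorem the functions agree on a punctured neighbourhood of every point.
  This determines the value of a nicely meromorphic function: 0 at a pole, the limit
  elsewhere.\<close>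

lemma nicely_meromorphic_eqI:
  assumes f: "f nicely_meromorphic_on UNIV" and g: "g nicely_meromorphic_on UNIV"
    and eq: "eventually (\<lambda>z. f z = g z) (at z0)"
  shows "f = g"
proof
  fix z
  have "(\<lambda>z. f z - g z) meromorphic_on UNIV"
    using f g by (intro meromorphic_on_diff) (auto simp: nicely_meromorphic_on_def)
  from meromorphic_imp_constant_or_avoid[OF this open_UNIV connected_UNIV, of 0]
  have "eventually (\<lambda>z. f z - g z = 0) (cosparse UNIV)"
  proof
    assume "\<forall>\<^sub>\<approx>z\<in>UNIV. f z - g z \<noteq> 0"
    then have "eventually (\<lambda>z. f z - g z \<noteq> 0) (at z0)"
      by (simp add: eventually_cosparse_open_eq)
    with eq have "eventually (\<lambda>z. False) (at z0)" by eventually_elim simp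
    then show ?thesis by simp
  qed
  then have ev: "eventually (\<lambda>z. f z = g z) (at z)"
    by (simp add: eventually_cosparse_open_eq)
  then have "is_pole f z \<longleftrightarrow> is_pole g z" by (intro is_pole_cong) auto
  moreover have "is_pole h z \<Longrightarrow> \<not> h \<midarrow>z\<rightarrow> l" for h :: "complex \<Rightarrow> complex" and l
    using not_tendsto_and_filterlim_at_infinity[of "at z" h l] unfolding is_pole_def by auto
  moreover have "(f \<midarrow>z\<rightarrow> l) \<longleftrightarrow> (g \<midarrow>z\<rightarrow> l)" for l by (intro tendsto_cong ev)
  ultimately show "f z = g z"
    using f g unfolding nicely_meromorphic_on_def by (metis LIM_unique UNIV_I)
qed

text \<open>Keeps \<open>1 - v ^ 4\<close> away from 0 and from the branch cut of
  \<open>csqrt\<close>.\<close>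

lemma one_minus_pow4_Re:
  fixes v :: complex assumes "norm v < 1" shows "Re (1 - v ^ 4) > 0"
proof -
  have "norm (v ^ 4) < 1" using assms by (simp add: norm_power power_less_one_iff)
  then show ?thesis using complex_Re_le_cmod[of "v ^ 4"] by simp
qed

text \<open>
  Separation of variables: \<open>h\<close> is a primitive of \<open>1 / csqrt (1 - v ^ 4)\<close>, so solutions of the
  initial value problem are local inverses of \<open>h\<close>.
\<close>

lemma lemniscate_primitive:
  obtains h r where "0 < r" "r \<le> 1" "h holomorphic_on ball 0 r" "inj_on h (ball 0 r)" "open (h ` ball 0 r)"
    "h 0 = 0" "\<And>v. v \<in> ball 0 r \<Longrightarrow> (h has_field_derivative inverse (csqrt (1 - v ^ 4))) (at v)"
proof -
  have nz: "csqrt (1 - v ^ 4) \<noteq> 0" if "v \<in> ball 0 1" for v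
    using one_minus_pow4_Re[of v] that by auto
  have np: "1 - v ^ 4 \<notin> \<real>\<^sub>\<le>\<^sub>0" if "v \<in> ball 0 1" for v :: complex
    using one_minus_pow4_Re[of v] that by (simp add: complex_nonpos_Reals_iff)
  have hol: "(\<lambda>v. inverse (csqrt (1 - v ^ 4))) holomorphic_on ball 0 1"
    by (intro holomorphic_intros nz np)
  obtain h0 where h0: "\<And>v. v \<in> ball 0 1 \<Longrightarrow> (h0 has_field_derivative inverse (csqrt (1 - v ^ 4))) (at v within ball 0 1)"
    using holomorphic_convex_primitive'[OF convex_ball open_ball hol] by blast
  define h where "h v = h0 v - h0 0" for v
  have h: "(h has_field_derivative inverse (csqrt (1 - v ^ 4))) (at v)" if "v \<in> ball 0 1" for v
    unfolding h_def using h0[OF that] at_within_open[OF that open_ball]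
    by (auto intro!: derivative_eq_intros)
  have hh: "h holomorphic_on ball 0 1"
    unfolding holomorphic_on_open[OF open_ball] using h by blast
  have "deriv h 0 \<noteq> 0" using DERIV_imp_deriv[OF h[of 0]] by simp
  then obtain r where r: "0 < r" "ball 0 r \<subseteq> ball (0::complex) 1" "open (h ` ball 0 r)" "inj_on h (ball 0 r)"
    using has_complex_derivative_locally_invertible[OF hh, of 0] by auto
  have "r \<le> 1" using r(1,2) by (simp add: ball_subset_ball_iff)
  show ?thesis
    by (rule that[OF r(1) \<open>r \<le> 1\<close> holomorphic_on_subset[OF hh r(2)] r(4,3)])
       (use h r(2) in \<open>auto simp: h_def\<close>)
qed

text \<open>The equation fixes \<open>deriv f\<close> up to sign. Near 0 it is close to 1, hence it
  is the root with positive real part, \<open>csqrt (1 - f z ^ 4)\<close>; then \<open>h\<close>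
  composed with \<open>f\<close> has derivative 1 and fixes 0.\<close>

lemma lemniscate_ivp_eq:
  assumes h: "\<And>v. v \<in> ball 0 r \<Longrightarrow> (h has_field_derivative inverse (csqrt (1 - v ^ 4))) (at v)" "h 0 = 0"
    and r: "0 < r" "r \<le> 1"
    and \<rho>: "0 < \<rho>" and f: "f holomorphic_on ball 0 \<rho>" "f 0 = 0" "deriv f 0 = 1"
      "\<And>z. z \<in> ball 0 \<rho> \<Longrightarrow> (deriv f z)\<^sup>2 = 1 - f z ^ 4"
  shows "eventually (\<lambda>z. f z \<in> ball 0 r \<and> h (f z) = z) (nhds 0)"
proof -
  have "isCont f 0"
    using holomorphic_on_imp_continuous_on[OF f(1)] \<rho> by (simp add: continuous_on_eq_continuous_at)
  moreover have "isCont (deriv f) 0"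
    using holomorphic_on_imp_continuous_on[OF holomorphic_deriv[OF f(1) open_ball]] \<rho>
    by (simp add: continuous_on_eq_continuous_at)
  ultimately have *: "(f \<longlongrightarrow> 0) (nhds 0)" "(deriv f \<longlongrightarrow> 1) (nhds 0)"
    unfolding isCont_def tendsto_at_iff_tendsto_nhds using f(2,3) by simp_all
  have "eventually (\<lambda>z. f z \<in> ball 0 r) (nhds 0)"
    using topological_tendstoD[OF *(1) open_ball, of 0 r] r by simp
  moreover have "eventually (\<lambda>z. Re (deriv f z) > 0) (nhds 0)"
    using order_tendstoD(1)[OF tendsto_Re[OF *(2)], of 0] by simp
  moreover have "eventually (\<lambda>z. z \<in> ball 0 \<rho>) (nhds (0::complex))"
    using \<rho> by (intro eventually_nhds_in_open) auto
  ultimately have "eventually (\<lambda>z. f z \<in> ball 0 r \<and> Re (deriv f z) > 0 \<and> z \<in> ball 0 \<rho>) (nhds 0)"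
    by eventually_elim blast
  then obtain d where d: "d > 0" "\<And>z. z \<in> ball 0 d \<Longrightarrow> f z \<in> ball 0 r \<and> Re (deriv f z) > 0 \<and> z \<in> ball 0 \<rho>"
    unfolding eventually_nhds_metric by (auto simp: dist_commute)
  have "((\<lambda>z. h (f z) - z) has_field_derivative 0) (at z within ball 0 d)" if z: "z \<in> ball 0 d" for z
  proof -
    have "(f has_field_derivative deriv f z) (at z)"
      using d(2)[OF z] f(1) holomorphic_derivI[OF _ open_ball] by blast
    from DERIV_chain2[OF h(1) this] d(2)[OF z]
    have "((\<lambda>z. h (f z)) has_field_derivative inverse (csqrt (1 - f z ^ 4)) * deriv f z) (at z)" by blast
    moreover have c: "csqrt (1 - f z ^ 4) = deriv f z"
      using d(2)[OF z] f(4)[of z] by (intro csqrt_unique) auto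
    moreover have "deriv f z \<noteq> 0" using d(2)[OF z] by auto
    ultimately have "((\<lambda>z. h (f z)) has_field_derivative 1) (at z)" by simp
    from DERIV_diff[OF this DERIV_ident] show ?thesis
      by (simp add: has_field_derivative_at_within)
  qed
  then have "\<exists>k. \<forall>z\<in>ball 0 d. h (f z) - z = k"
    by (intro has_field_derivative_zero_constant convex_ball) auto
  then obtain k where k: "\<And>z. z \<in> ball 0 d \<Longrightarrow> h (f z) - z = k" by blast
  have "k = 0" using k[of 0] d(1) f(2) h(2) by simp
  then show ?thesis
    unfolding eventually_nhds_metric using d k by (intro exI[of _ d]) (auto simp: dist_commute)
qed

lemma lemniscate_ivp_unique:
  assumes "0 < \<rho>" "f holomorphic_on ball 0 \<rho>" "f 0 = 0" "deriv f 0 = 1"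
    "\<And>z. z \<in> ball 0 \<rho> \<Longrightarrow> (deriv f z)\<^sup>2 = 1 - f z ^ 4"
    and "0 < \<sigma>" "g holomorphic_on ball 0 \<sigma>" "g 0 = 0" "deriv g 0 = 1"
    "\<And>z. z \<in> ball 0 \<sigma> \<Longrightarrow> (deriv g z)\<^sup>2 = 1 - g z ^ 4"
  shows "eventually (\<lambda>z. f z = g z) (nhds 0)"
proof -
  obtain h r where h: "0 < r" "r \<le> 1" "inj_on h (ball 0 r)" "h 0 = 0"
    "\<And>v. v \<in> ball 0 r \<Longrightarrow> (h has_field_derivative inverse (csqrt (1 - v ^ 4))) (at v)"
    by (metis lemniscate_primitive)
  have "eventually (\<lambda>z. f z \<in> ball 0 r \<and> h (f z) = z) (nhds 0)"
    by (rule lemniscate_ivp_eq[of r h \<rho> f]) (use h assms in auto)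
  moreover have "eventually (\<lambda>z. g z \<in> ball 0 r \<and> h (g z) = z) (nhds 0)"
    by (rule lemniscate_ivp_eq[of r h \<sigma> g]) (use h assms in auto)
  ultimately show ?thesis
    by eventually_elim (metis h(3) inj_onD)
qed

text \<open>The solution is the inverse of the primitive. The last clause serves to cancel
  \<open>deriv f\<close> when the second-order equation is derived.\<close>

lemma lemniscate_ivp_exists:
  obtains \<rho> f where "0 < \<rho>" "f holomorphic_on ball 0 \<rho>" "f 0 = 0" "deriv f 0 = 1"
    "\<And>z. z \<in> ball 0 \<rho> \<Longrightarrow> (deriv f z)\<^sup>2 = 1 - f z ^ 4"
    "\<And>z. z \<in> ball 0 \<rho> \<Longrightarrow> deriv f z \<noteq> 0"
proof -
  obtain h r where h: "0 < r" "r \<le> 1" "h holomorphic_on ball 0 r" "inj_on h (ball 0 r)" "open (h ` ball 0 r)" "h 0 = 0"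
    "\<And>v. v \<in> ball 0 r \<Longrightarrow> (h has_field_derivative inverse (csqrt (1 - v ^ 4))) (at v)"
    by (metis lemniscate_primitive)
  obtain s where s: "s holomorphic_on h ` ball 0 r" "\<And>z. z \<in> ball 0 r \<Longrightarrow> deriv h z * deriv s (h z) = 1"
    "\<And>z. z \<in> ball 0 r \<Longrightarrow> s (h z) = z"
    using holomorphic_has_inverse[OF h(3) open_ball h(4)] by metis
  have "0 \<in> h ` ball 0 r" using h(1,6) by (intro image_eqI[of _ _ 0]) auto
  then obtain \<rho> where \<rho>: "0 < \<rho>" "ball 0 \<rho> \<subseteq> h ` ball 0 r"
    using h(5) open_contains_ball by blast
  have ds: "deriv s z = csqrt (1 - s z ^ 4) \<and> s z \<in> ball 0 r" if z: "z \<in> ball 0 \<rho>" for z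
  proof -
    obtain x where x: "x \<in> ball 0 r" "z = h x" using subsetD[OF \<rho>(2) z] by (metis imageE)
    have "inverse (csqrt (1 - x ^ 4)) * deriv s z = 1"
      using s(2)[OF x(1)] DERIV_imp_deriv[OF h(7)[OF x(1)]] x(2) by simp
    then have "deriv s z = csqrt (1 - x ^ 4)" by (metis inverse_inverse_eq inverse_unique)
    then show ?thesis using s(3)[OF x(1)] x by simp
  qed
  have s0: "s 0 = 0" using s(3)[of 0] h(1,6) by simp
  show ?thesis
  proof (rule that[OF \<rho>(1) holomorphic_on_subset[OF s(1) \<rho>(2)] s0])
    show "deriv s 0 = 1" using ds[of 0] \<rho>(1) s0 by simp
    show "(deriv s z)\<^sup>2 = 1 - s z ^ 4" if "z \<in> ball 0 \<rho>" for z using ds[OF that] by simp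
    show "deriv s z \<noteq> 0" if "z \<in> ball 0 \<rho>" for z
      using ds[OF that] one_minus_pow4_Re[of "s z"] h(2) by auto
  qed
qed

text \<open>
  Where \<open>D \<noteq> 0\<close> the function \<open>s = N / D\<close> satisfies \<open>s' = M / D\<^sup>2\<close>, \<open>s'\<^sup>2 = 1 - s ^ 4\<close> and
  \<open>s'' = - 2 s\<^sup>3\<close>; the equations below express this without denominators.
\<close>

definition sn_triple :: "real \<Rightarrow> (complex \<Rightarrow> complex) \<Rightarrow> (complex \<Rightarrow> complex) \<Rightarrow> (complex \<Rightarrow> complex) \<Rightarrow> bool" where
  "sn_triple R N D M \<longleftrightarrow> 0 < R \<and> N holomorphic_on ball 0 R \<and> D holomorphic_on ball 0 R \<and> M holomorphic_on ball 0 R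
    \<and> N 0 = 0 \<and> D 0 = 1 \<and> M 0 = 1
    \<and> (\<forall>z\<in>ball 0 R. (N z \<noteq> 0 \<or> D z \<noteq> 0) \<and> M z ^ 2 = D z ^ 4 - N z ^ 4
        \<and> deriv N z * D z - N z * deriv D z = M z \<and> deriv M z * D z - 2 * M z * deriv D z = - 2 * N z ^ 3)"

lemma sn_triple_exists_small: obtains \<rho> N D M where "sn_triple \<rho> N D M"
proof -
  obtain \<rho> f where f: "0 < \<rho>" "f holomorphic_on ball 0 \<rho>" "f 0 = 0" "deriv f 0 = 1"
    "\<And>z. z \<in> ball 0 \<rho> \<Longrightarrow> (deriv f z)\<^sup>2 = 1 - f z ^ 4"
    "\<And>z. z \<in> ball 0 \<rho> \<Longrightarrow> deriv f z \<noteq> 0"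
    by (metis lemniscate_ivp_exists)
  have f': "deriv f holomorphic_on ball 0 \<rho>" by (rule holomorphic_deriv[OF f(2) open_ball])
  have "deriv (deriv f) z = - 2 * f z ^ 3" if z: "z \<in> ball 0 \<rho>" for z
  proof -
    have d1: "((\<lambda>z. (deriv f z)\<^sup>2) has_field_derivative 2 * deriv f z * deriv (deriv f) z) (at z)"
      using holomorphic_derivI[OF f' open_ball z] by (auto intro!: derivative_eq_intros)
    have "((\<lambda>z. 1 - f z ^ 4) has_field_derivative - (4 * f z ^ 3 * deriv f z)) (at z)"
      using holomorphic_derivI[OF f(2) open_ball z] by (auto intro!: derivative_eq_intros)
    then have d2: "((\<lambda>z. (deriv f z)\<^sup>2) has_field_derivative - (4 * f z ^ 3 * deriv f z)) (at z)"
      by (rule has_field_derivative_transform_within_open[OF _ open_ball z]) (simp add: f(5))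
    have "2 * deriv f z * deriv (deriv f) z = - (4 * f z ^ 3 * deriv f z)"
      by (rule DERIV_unique[OF d1 d2])
    \<comment> \<open>Both derivatives of \<open>s'^2 = 1 - s^4\<close> contain the nonzero factor
      \<open>s'\<close>, which is cancelled.\<close>
    then have "deriv f z * (deriv (deriv f) z - (- 2 * f z ^ 3)) = 0" by algebra
    then show ?thesis using f(6)[OF z] mult_eq_0_iff right_minus_eq by blast
  qed
  then have "sn_triple \<rho> f (\<lambda>_. 1) (deriv f)"
    using f f' unfolding sn_triple_def by simp
  then show ?thesis by (rule that)
qed

text \<open>The first derivative equation of the doubled triple. With \<open>s = n / d\<close> and
  \<open>s' = m / d^2\<close>, clearing \<open>d^4\<close> in \<open>2 s s' / (1 + s^4)\<close>
  gives the numerator \<open>2 n m d\<close> and the denominator \<open>d^4 + n^4\<close>; the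
  brackets with primes are their z-derivatives at argument z / 2.\<close>

lemma double_identity_1:
  fixes n d m n' d' m' :: complex
  assumes "n' * d - n * d' = m" "m' * d - 2 * m * d' = - 2 * n ^ 3" "m ^ 2 = d ^ 4 - n ^ 4"
  shows "(n' * m * d + n * m' * d + n * m * d') * (d ^ 4 + n ^ 4) - (2 * n * m * d) * (2 * d ^ 3 * d' + 2 * n ^ 3 * n')
    = d ^ 8 - 6 * n ^ 4 * d ^ 4 + n ^ 8"
proof -
  have "(n' * m * d + n * m' * d + n * m * d') * (d ^ 4 + n ^ 4) - (2 * n * m * d) * (2 * d ^ 3 * d' + 2 * n ^ 3 * n')
    = ((n' * d) * m + n * (m' * d) + n * m * d') * (d ^ 4 + n ^ 4) - 4 * n * m * d ^ 4 * d' - 4 * n ^ 4 * m * (n' * d)"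
    by (simp add: algebra_simps eval_nat_numeral)
  also have "n' * d = m + n * d'" using assms(1) by (simp add: algebra_simps)
  also have "m' * d = 2 * m * d' - 2 * n ^ 3" using assms(2) by (simp add: algebra_simps)
  \<comment> \<open>After the two substitutions all terms with \<open>d'\<close> cancel.\<close>
  also have "((m + n * d') * m + n * (2 * m * d' - 2 * n ^ 3) + n * m * d') * (d ^ 4 + n ^ 4) - 4 * n * m * d ^ 4 * d'
      - 4 * n ^ 4 * m * (m + n * d')
    = m ^ 2 * (d ^ 4 + n ^ 4) - 2 * n ^ 4 * (d ^ 4 + n ^ 4) - 4 * n ^ 4 * m ^ 2"
    by (simp add: algebra_simps eval_nat_numeral)
  also have "\<dots> = d ^ 8 - 6 * n ^ 4 * d ^ 4 + n ^ 8"
    unfolding assms(3) by (simp add: algebra_simps eval_nat_numeral)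
  finally show ?thesis .
qed

text \<open>The second derivative equation of the doubled triple, whose third function comes from
  \<open>s'(2 w) = (1 - 6 s^4 + s^8) / (1 + s^4)^2\<close>.\<close>

lemma double_identity_2:
  fixes n d m n' d' :: complex
  assumes "n' * d - n * d' = m" "m ^ 2 = d ^ 4 - n ^ 4"
  shows "(4 * d ^ 7 * d' - 12 * n ^ 3 * d ^ 3 * (n' * d + n * d') + 4 * n ^ 7 * n') * (d ^ 4 + n ^ 4)
      - 2 * (d ^ 8 - 6 * n ^ 4 * d ^ 4 + n ^ 8) * (2 * d ^ 3 * d' + 2 * n ^ 3 * n') = - 2 * (2 * n * m * d) ^ 3"
proof -
  have "(4 * d ^ 7 * d' - 12 * n ^ 3 * d ^ 3 * (n' * d + n * d') + 4 * n ^ 7 * n') * (d ^ 4 + n ^ 4)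
      - 2 * (d ^ 8 - 6 * n ^ 4 * d ^ 4 + n ^ 8) * (2 * d ^ 3 * d' + 2 * n ^ 3 * n')
    = - 16 * n ^ 3 * d ^ 3 * (d ^ 4 - n ^ 4) * (n' * d - n * d')"
    by (simp add: algebra_simps eval_nat_numeral)
  also have "\<dots> = - 16 * n ^ 3 * d ^ 3 * m ^ 2 * m" using assms by simp
  finally show ?thesis by (simp add: algebra_simps eval_nat_numeral)
qed

lemma sn_triple_double:
  assumes "sn_triple R N D M"
  shows "sn_triple (2 * R) (\<lambda>z. 2 * N (z / 2) * M (z / 2) * D (z / 2)) (\<lambda>z. D (z / 2) ^ 4 + N (z / 2) ^ 4)
    (\<lambda>z. D (z / 2) ^ 8 - 6 * N (z / 2) ^ 4 * D (z / 2) ^ 4 + N (z / 2) ^ 8)"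
proof -
  note T = assms[unfolded sn_triple_def]
  have half: "z / 2 \<in> ball 0 R" if "z \<in> ball 0 (2 * R)" for z :: complex
    using that by (simp add: norm_divide)
  have hol: "f holomorphic_on ball 0 R \<Longrightarrow> (\<lambda>z. f (z / 2)) holomorphic_on ball 0 (2 * R)" for f :: "complex \<Rightarrow> complex"
    by (rule holomorphic_on_compose_gen[of "\<lambda>z. z / 2", unfolded o_def]) (use half in \<open>auto intro!: holomorphic_intros\<close>)
  have der: "((\<lambda>z. f (z / 2)) has_field_derivative deriv f (z / 2) / 2) (at z)"
    if "f holomorphic_on ball 0 R" "z \<in> ball 0 (2 * R)" for f :: "complex \<Rightarrow> complex" and z
  proof -
    have 1: "(f has_field_derivative deriv f (z / 2)) (at (z / 2))"
      by (rule holomorphic_derivI[OF that(1) open_ball half[OF that(2)]])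
    have 2: "((\<lambda>z. z / 2) has_field_derivative 1 / 2) (at z)"
      by (auto intro!: derivative_eq_intros)
    from DERIV_chain2[of f _ "\<lambda>z. z / 2", OF 1 2] show ?thesis by simp
  qed
  have "(let n = N (z/2); d = D (z/2); m = M (z/2) in
      (2 * n * m * d \<noteq> 0 \<or> d ^ 4 + n ^ 4 \<noteq> 0)
      \<and> (d ^ 8 - 6 * n ^ 4 * d ^ 4 + n ^ 8) ^ 2 = (d ^ 4 + n ^ 4) ^ 4 - (2 * n * m * d) ^ 4)"
    if z: "z \<in> ball 0 (2 * R)" for z
  proof -
    define n d m where nd: "n = N (z/2)" "d = D (z/2)" "m = M (z/2)"
    have a: "n \<noteq> 0 \<or> d \<noteq> 0" "m ^ 2 = d ^ 4 - n ^ 4"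
      using T half[OF z] unfolding nd by blast+
    \<comment> \<open>A common zero would give \<open>d^4 = - n^4\<close> together with
      \<open>m = 0\<close>, hence \<open>d^4 = n^4\<close>, or with \<open>n = 0\<close> or
      \<open>d = 0\<close>; each case forces n = d = 0.\<close>
    have 1: "2 * n * m * d \<noteq> 0 \<or> d ^ 4 + n ^ 4 \<noteq> 0"
    proof (rule ccontr)
      assume "\<not> ?thesis"
      then have b: "n = 0 \<or> m = 0 \<or> d = 0" "d ^ 4 + n ^ 4 = 0" by auto
      then show False
      proof (cases "m = 0")
        case True
        then have "d ^ 4 = n ^ 4" using a(2) by simp
        then have "d ^ 4 = 0" "n ^ 4 = 0" using b(2) by simp_all
        then show False using a(1) by simp
      qed (use a(1) b in auto)
    qed
    have "(2 * n * m * d) ^ 4 = 16 * n ^ 4 * d ^ 4 * (m ^ 2) ^ 2"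
      by (simp add: power_mult_distrib power_mult[symmetric])
    then have 2: "(d ^ 8 - 6 * n ^ 4 * d ^ 4 + n ^ 8) ^ 2 = (d ^ 4 + n ^ 4) ^ 4 - (2 * n * m * d) ^ 4"
      unfolding a(2) by (simp add: algebra_simps eval_nat_numeral)
    show ?thesis using 1 2 by (simp add: nd Let_def)
  qed
  note alg = this
  \<comment> \<open>The new functions are variables with defining equations, so that
    \<open>deriv\<close> meets atoms; \<open>refl\<close> discharges the equations at the
    end.\<close>
  have dd: "deriv N2 z * D2 z - N2 z * deriv D2 z = M2 z \<and> deriv M2 z * D2 z - 2 * M2 z * deriv D2 z = - 2 * N2 z ^ 3"
    if z: "z \<in> ball 0 (2 * R)"
      and defs: "N2 = (\<lambda>z. 2 * N (z / 2) * M (z / 2) * D (z / 2))" "D2 = (\<lambda>z. D (z / 2) ^ 4 + N (z / 2) ^ 4)"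
        "M2 = (\<lambda>z. D (z / 2) ^ 8 - 6 * N (z / 2) ^ 4 * D (z / 2) ^ 4 + N (z / 2) ^ 8)"
    for z N2 D2 M2
  proof -
    define n d m n' d' m' where nd: "n = N (z/2)" "d = D (z/2)" "m = M (z/2)"
      "n' = deriv N (z/2)" "d' = deriv D (z/2)" "m' = deriv M (z/2)"
    have a: "n' * d - n * d' = m" "m' * d - 2 * m * d' = - 2 * n ^ 3" "m ^ 2 = d ^ 4 - n ^ 4"
      using T half[OF z] unfolding nd by blast+
    have N: "((\<lambda>z. N (z / 2)) has_field_derivative n' / 2) (at z)" and D: "((\<lambda>z. D (z / 2)) has_field_derivative d' / 2) (at z)"
      and M: "((\<lambda>z. M (z / 2)) has_field_derivative m' / 2) (at z)"
      unfolding nd using T der[OF _ z] by blast+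
    have "(N2 has_field_derivative n' * m * d + n * m' * d + n * m * d') (at z)"
      unfolding defs by (rule derivative_eq_intros N D M refl)+ (simp add: nd algebra_simps)
    moreover have "(D2 has_field_derivative 2 * d ^ 3 * d' + 2 * n ^ 3 * n') (at z)"
      unfolding defs by (rule derivative_eq_intros N D M refl)+ (simp add: nd algebra_simps)
    moreover have "(M2 has_field_derivative 4 * d ^ 7 * d' - 12 * n ^ 3 * d ^ 3 * (n' * d + n * d') + 4 * n ^ 7 * n') (at z)"
      unfolding defs by (rule derivative_eq_intros N D M refl)+ (simp add: nd algebra_simps eval_nat_numeral)
    ultimately have der2: "deriv N2 z = n' * m * d + n * m' * d + n * m * d'" "deriv D2 z = 2 * d ^ 3 * d' + 2 * n ^ 3 * n'"
      "deriv M2 z = 4 * d ^ 7 * d' - 12 * n ^ 3 * d ^ 3 * (n' * d + n * d') + 4 * n ^ 7 * n'"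
      by (simp_all add: DERIV_imp_deriv)
    have v: "N2 z = 2 * n * m * d" "D2 z = d ^ 4 + n ^ 4" "M2 z = d ^ 8 - 6 * n ^ 4 * d ^ 4 + n ^ 8"
      by (simp_all add: defs nd)
    show ?thesis
      unfolding der2 v using double_identity_1[OF a] double_identity_2[OF a(1,3)] by simp
  qed
  show ?thesis
    unfolding sn_triple_def
    using T alg dd[OF _ refl refl refl] by (auto intro!: holomorphic_intros hol simp: Let_def)
qed

lemma sn_triple_mono:
  assumes "sn_triple R N D M" "0 < S" "S \<le> R" shows "sn_triple S N D M"
proof -
  have "ball (0::complex) S \<subseteq> ball 0 R" using assms by auto
  then show ?thesis using assms holomorphic_on_subset unfolding sn_triple_def by blast
qed

text \<open>Finitely many doublings reach any radius; the global function is assembled from these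
  triples.\<close>

lemma sn_triple_exists: "0 < R \<Longrightarrow> \<exists>N D M. sn_triple R N D M"
proof -
  assume R: "0 < R"
  obtain \<rho> N D M where \<rho>: "sn_triple \<rho> N D M" by (rule sn_triple_exists_small)
  then have "0 < \<rho>" by (simp add: sn_triple_def)
  have *: "\<exists>N D M. sn_triple (2 ^ n * \<rho>) N D M" for n
  proof (induction n)
    case 0 then show ?case using \<rho> by auto
  next
    case (Suc n)
    then obtain N D M where "sn_triple (2 ^ n * \<rho>) N D M" by blast
    from sn_triple_double[OF this] show ?case
      unfolding power_Suc mult.assoc by blast
  qed
  obtain n where "R / \<rho> < 2 ^ n" using real_arch_pow[of 2 "R / \<rho>"] by auto
  then have "R \<le> 2 ^ n * \<rho>" using \<open>0 < \<rho>\<close> by (simp add: field_simps)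
  then show ?thesis using * sn_triple_mono R by blast
qed

text \<open>For triples obtained by rotation, conjugation or translation, where explicit derivatives
  are at hand.\<close>

lemma sn_tripleI:
  assumes "0 < R" "N 0 = 0" "D 0 = 1" "M 0 = 1"
    and d: "\<And>z. z \<in> ball 0 R \<Longrightarrow> (N has_field_derivative N' z) (at z)"
      "\<And>z. z \<in> ball 0 R \<Longrightarrow> (D has_field_derivative D' z) (at z)"
      "\<And>z. z \<in> ball 0 R \<Longrightarrow> (M has_field_derivative M' z) (at z)"
    and "\<And>z. z \<in> ball 0 R \<Longrightarrow> N z \<noteq> 0 \<or> D z \<noteq> 0"
    and "\<And>z. z \<in> ball 0 R \<Longrightarrow> M z ^ 2 = D z ^ 4 - N z ^ 4"
    and "\<And>z. z \<in> ball 0 R \<Longrightarrow> N' z * D z - N z * D' z = M z"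
    and "\<And>z. z \<in> ball 0 R \<Longrightarrow> M' z * D z - 2 * M z * D' z = - 2 * N z ^ 3"
  shows "sn_triple R N D M"
proof -
  have "N holomorphic_on ball 0 R" "D holomorphic_on ball 0 R" "M holomorphic_on ball 0 R"
    unfolding holomorphic_on_open[OF open_ball] using d by blast+
  then show ?thesis
    unfolding sn_triple_def using assms DERIV_imp_deriv[OF d(1)] DERIV_imp_deriv[OF d(2)] DERIV_imp_deriv[OF d(3)]
    by simp
qed

lemma sn_tripleD:
  assumes "sn_triple R N D M" "z \<in> ball 0 R"
  shows "(N has_field_derivative deriv N z) (at z)" "(D has_field_derivative deriv D z) (at z)"
    "(M has_field_derivative deriv M z) (at z)" "N z \<noteq> 0 \<or> D z \<noteq> 0" "M z ^ 2 = D z ^ 4 - N z ^ 4"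
    "deriv N z * D z - N z * deriv D z = M z" "deriv M z * D z - 2 * M z * deriv D z = - 2 * N z ^ 3"
  using assms unfolding sn_triple_def by (auto intro: holomorphic_derivI)

lemma sn_triple_quotient:
  assumes "sn_triple R N D M" "z \<in> ball 0 R" "D z \<noteq> 0"
  shows "((\<lambda>z. N z / D z) has_field_derivative M z / D z ^ 2) (at z)"
  using DERIV_divide[OF sn_tripleD(1,2)[OF assms(1,2)] assms(3)] sn_tripleD(6)[OF assms(1,2)]
  by (simp add: power2_eq_square)

text \<open>\<open>D 0 = 1\<close> excludes that \<open>D\<close> vanishes identically, so its zeros
  are isolated.\<close>

lemma sn_triple_denominator_eventually:
  assumes "sn_triple R N D M" "z \<in> ball 0 R"
  shows "eventually (\<lambda>w. D w \<noteq> 0) (at z)"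
proof (cases "D z = 0")
  case True
  have T: "D holomorphic_on ball 0 R" "0 \<in> ball (0::complex) R" "D 0 \<noteq> 0"
    using assms(1) by (simp_all add: sn_triple_def)
  from isolated_zeros[OF T(1) open_ball connected_ball assms(2) True T(2,3)]
  obtain r where r: "0 < r" "\<And>w. w \<in> ball z r - {z} \<Longrightarrow> D w \<noteq> 0" by metis
  show ?thesis
    unfolding eventually_at using r by (intro exI[of _ r]) (auto simp: dist_commute)
next
  case False
  have "isCont D z" using sn_tripleD(2)[OF assms] DERIV_isCont by blast
  then show ?thesis
    using False tendsto_imp_eventually_ne unfolding isCont_def by blast
qed

section \<open>Independence of the triple and the global function sn\<close>

lemma sn_triple_ball:
  assumes T: "sn_triple R N D M"
  obtains \<rho> where "0 < \<rho>" "\<rho> \<le> R" "(\<lambda>z. N z / D z) holomorphic_on ball 0 \<rho>" "deriv (\<lambda>z. N z / D z) 0 = 1"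
    "\<forall>z\<in>ball (0::complex) \<rho>. (deriv (\<lambda>z. N z / D z) z)\<^sup>2 = 1 - (N z / D z) ^ 4"
    "\<forall>z\<in>ball (0::complex) \<rho>. D z \<noteq> 0"
proof -
  note T' = T[unfolded sn_triple_def]
  have 0: "0 \<in> ball 0 R" using T' by simp
  have "eventually (\<lambda>w. D w \<noteq> 0) (nhds 0)"
    using sn_triple_denominator_eventually[OF T 0] T' by (simp add: eventually_nhds_conv_at)
  then obtain r where r: "0 < r" "\<And>w. w \<in> ball 0 r \<Longrightarrow> D w \<noteq> 0"
    unfolding eventually_nhds_metric by (auto simp: dist_commute)
  define \<rho> where "\<rho> = min r R"
  have \<rho>: "0 < \<rho>" "\<rho> \<le> R" "\<And>w. w \<in> ball 0 \<rho> \<Longrightarrow> D w \<noteq> 0 \<and> w \<in> ball 0 R"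
    using r T' by (auto simp: \<rho>_def)
  have d: "((\<lambda>z. N z / D z) has_field_derivative M z / D z ^ 2) (at z)" if "z \<in> ball 0 \<rho>" for z
    using sn_triple_quotient[OF T] \<rho>(3)[OF that] by blast
  show ?thesis
  proof (rule that[OF \<rho>(1,2)])
    show "(\<lambda>z. N z / D z) holomorphic_on ball 0 \<rho>"
      unfolding holomorphic_on_open[OF open_ball] using d by blast
    show "deriv (\<lambda>z. N z / D z) 0 = 1"
      using DERIV_imp_deriv[OF d[of 0]] \<rho>(1) T' by simp
    show "\<forall>z\<in>ball (0::complex) \<rho>. (deriv (\<lambda>z. N z / D z) z)\<^sup>2 = 1 - (N z / D z) ^ 4"
    proof
      fix z assume z: "z \<in> ball (0::complex) \<rho>"
      have "D z \<noteq> 0" "M z ^ 2 = D z ^ 4 - N z ^ 4" using \<rho>(3)[OF z] sn_tripleD(5)[OF T] by auto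
      then show "(deriv (\<lambda>z. N z / D z) z)\<^sup>2 = 1 - (N z / D z) ^ 4"
        unfolding DERIV_imp_deriv[OF d[OF z]] by (simp add: power_divide diff_divide_distrib power_mult[symmetric])
    qed
    show "\<forall>z\<in>ball (0::complex) \<rho>. D z \<noteq> 0" using \<rho>(3) by blast
  qed
qed

text \<open>Uniqueness near 0 makes \<open>N D' - N' D\<close> vanish there, and the identity
  theorem extends this to the smaller ball. Since neither pair has a common zero, the denominators
  vanish together and the quotients agree.\<close>

lemma sn_triple_agree:
  assumes "sn_triple R N D M" "sn_triple R' N' D' M'" "z \<in> ball 0 R" "z \<in> ball 0 R'"
  shows "N z / D z = N' z / D' z" "D z = 0 \<longleftrightarrow> D' z = 0"
proof -
  define S where "S = min R R'"
  have S: "0 < S" "z \<in> ball 0 S" "S \<le> R" "S \<le> R'" using assms by (auto simp: S_def sn_triple_def)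
  have T: "sn_triple S N D M" and T': "sn_triple S N' D' M'"
    using assms(1,2) S sn_triple_mono by blast+
  obtain \<rho> where \<rho>: "0 < \<rho>" "\<rho> \<le> S" "(\<lambda>z. N z / D z) holomorphic_on ball 0 \<rho>" "deriv (\<lambda>z. N z / D z) 0 = 1"
    "\<forall>z\<in>ball (0::complex) \<rho>. (deriv (\<lambda>z. N z / D z) z)\<^sup>2 = 1 - (N z / D z) ^ 4"
    "\<forall>z\<in>ball (0::complex) \<rho>. D z \<noteq> 0"
    using sn_triple_ball[OF T] by blast
  obtain \<sigma> where \<sigma>: "0 < \<sigma>" "\<sigma> \<le> S" "(\<lambda>z. N' z / D' z) holomorphic_on ball 0 \<sigma>" "deriv (\<lambda>z. N' z / D' z) 0 = 1"
    "\<forall>z\<in>ball (0::complex) \<sigma>. (deriv (\<lambda>z. N' z / D' z) z)\<^sup>2 = 1 - (N' z / D' z) ^ 4"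
    "\<forall>z\<in>ball (0::complex) \<sigma>. D' z \<noteq> 0"
    using sn_triple_ball[OF T'] by blast
  have "eventually (\<lambda>z. N z / D z = N' z / D' z) (nhds 0)"
    by (rule lemniscate_ivp_unique[OF \<rho>(1,3) _ \<rho>(4) _ \<sigma>(1,3) _ \<sigma>(4)])
       (use T T' \<rho>(5) \<sigma>(5) in \<open>auto simp: sn_triple_def\<close>)
  then obtain d where d: "0 < d" "\<And>z. z \<in> ball 0 d \<Longrightarrow> N z / D z = N' z / D' z"
    unfolding eventually_nhds_metric by (auto simp: dist_commute)
  define e where "e = min d (min \<rho> \<sigma>)"
  have e: "0 < e" "e \<le> S" using d(1) \<rho>(1,2) \<sigma>(1) by (auto simp: e_def)
  have eq: "N z * D' z - N' z * D z = 0"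
  proof (rule analytic_continuation[of "\<lambda>z. N z * D' z - N' z * D z" "ball 0 S" "ball 0 e" 0 z])
    show "(\<lambda>z. N z * D' z - N' z * D z) holomorphic_on ball 0 S"
      using T T' by (auto simp: sn_triple_def intro!: holomorphic_intros)
    show "(0::complex) islimpt ball 0 e" using e by (simp add: islimpt_ball)
    show "N w * D' w - N' w * D w = 0" if "w \<in> ball 0 e" for w
    proof -
      have "D w \<noteq> 0" "D' w \<noteq> 0" "N w / D w = N' w / D' w"
        using that \<rho>(6) \<sigma>(6) d(2)[of w] by (auto simp: e_def)
      then show ?thesis by (simp add: frac_eq_eq)
    qed
  qed (use e S in auto)
  show iff: "D z = 0 \<longleftrightarrow> D' z = 0"
    using eq sn_tripleD(4)[OF T S(2)] sn_tripleD(4)[OF T' S(2)] by auto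
  show "N z / D z = N' z / D' z"
    using eq iff by (cases "D z = 0") (auto simp: frac_eq_eq)
qed

text \<open>The characterisation inside \<open>jacobi_sn\<close> for m = -1, with the factor -1 left
  unevaluated to match it literally.\<close>

definition is_sn :: "(complex \<Rightarrow> complex) \<Rightarrow> bool" where
  "is_sn s \<longleftrightarrow> s nicely_meromorphic_on UNIV \<and>
      (\<forall>v. \<not> is_pole s v \<longrightarrow> (deriv s v)\<^sup>2 = (1 - (s v)\<^sup>2) * (1 - (-1) * (s v)\<^sup>2)) \<and>
      s 0 = 0 \<and> (s has_field_derivative 1) (at 0)"

lemma is_sn_ball:
  assumes "is_sn s"
  obtains \<rho> where "0 < \<rho>" "s holomorphic_on ball 0 \<rho>" "s 0 = 0" "deriv s 0 = 1"
    "\<forall>z\<in>ball (0::complex) \<rho>. (deriv s z)\<^sup>2 = 1 - s z ^ 4"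
proof -
  note s = assms[unfolded is_sn_def]
  have "isCont s 0" using s DERIV_isCont by blast
  then have "\<not> is_pole s 0"
    using not_tendsto_and_filterlim_at_infinity[of "at 0" s] unfolding is_pole_def isCont_def by auto
  then have "s analytic_on {0}" using s nicely_meromorphic_on_imp_analytic_at by blast
  then obtain \<rho> where \<rho>: "0 < \<rho>" "s holomorphic_on ball 0 \<rho>" using analytic_at_ball by blast
  show ?thesis
  proof (rule that[OF \<rho>])
    show "s 0 = 0" "deriv s 0 = 1" using s DERIV_imp_deriv by auto
    show "\<forall>z\<in>ball (0::complex) \<rho>. (deriv s z)\<^sup>2 = 1 - s z ^ 4"
    proof
      fix z assume "z \<in> ball (0::complex) \<rho>"
      then have "\<not> is_pole s z" using \<rho>(2) not_is_pole_holomorphic[OF open_ball] by blast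
      then show "(deriv s z)\<^sup>2 = 1 - s z ^ 4"
        using s by (simp add: algebra_simps power4_eq_xxxx power2_eq_square)
    qed
  qed
qed

lemma is_sn_unique:
  assumes f: "is_sn f" and g: "is_sn g" shows "f = g"
proof -
  obtain \<rho> where \<rho>: "0 < \<rho>" "f holomorphic_on ball 0 \<rho>" "f 0 = 0" "deriv f 0 = 1"
    "\<forall>z\<in>ball (0::complex) \<rho>. (deriv f z)\<^sup>2 = 1 - f z ^ 4" using is_sn_ball[OF f] by blast
  obtain \<sigma> where \<sigma>: "0 < \<sigma>" "g holomorphic_on ball 0 \<sigma>" "g 0 = 0" "deriv g 0 = 1"
    "\<forall>z\<in>ball (0::complex) \<sigma>. (deriv g z)\<^sup>2 = 1 - g z ^ 4" using is_sn_ball[OF g] by blast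
  have "eventually (\<lambda>z. f z = g z) (nhds 0)"
    by (rule lemniscate_ivp_unique[OF \<rho>(1-4) _ \<sigma>(1-4)]) (use \<rho>(5) \<sigma>(5) in auto)
  then have "eventually (\<lambda>z. f z = g z) (at 0)" by (simp add: eventually_nhds_conv_at)
  then show ?thesis using f g nicely_meromorphic_eqI unfolding is_sn_def by blast
qed

text \<open>By \<open>sn_triple_agree\<close> the choice does not matter. At a zero of
  \<open>D\<close> division by zero yields 0, which is also the value that a nicely meromorphic
  function takes at a pole.\<close>

definition sn_quot :: "complex \<Rightarrow> complex" where
  "sn_quot z = (SOME w. \<exists>R N D M. sn_triple R N D M \<and> z \<in> ball 0 R \<and> w = N z / D z)"

lemma sn_quot_eq:
  assumes "sn_triple R N D M" "z \<in> ball 0 R" shows "sn_quot z = N z / D z"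
proof -
  have "\<exists>w R N D M. sn_triple R N D M \<and> z \<in> ball 0 R \<and> w = N z / D z" using assms by blast
  from someI_ex[OF this] obtain R' N' D' M' where
    "sn_triple R' N' D' M'" "z \<in> ball 0 R'" "sn_quot z = N' z / D' z"
    unfolding sn_quot_def by blast
  then show ?thesis using sn_triple_agree(1)[OF assms(1) _ assms(2)] by metis
qed

lemma sn_quot_eventually:
  assumes "sn_triple R N D M" "z \<in> ball 0 R"
  shows "eventually (\<lambda>w. sn_quot w = N w / D w) (nhds z)"
  using eventually_nhds_in_open[OF open_ball assms(2)]
  by eventually_elim (rule sn_quot_eq[OF assms(1)])

text \<open>\<open>N\<close> and \<open>D\<close> have no common zero, so a zero of \<open>D\<close>
  is a genuine pole.\<close>

lemma sn_quot_pole: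
  assumes "sn_triple R N D M" "z \<in> ball 0 R" "D z = 0"
  shows "is_pole sn_quot z" "sn_quot z = 0"
proof -
  have "isCont N z" "isCont D z"
    using sn_tripleD(1,2)[OF assms(1,2)] DERIV_isCont by blast+
  then have "is_pole (\<lambda>w. N w / D w) z"
    using sn_triple_denominator_eventually[OF assms(1,2)] sn_tripleD(4)[OF assms(1,2)] assms(3)
    by (intro is_pole_divide) (auto simp: filterlim_at isCont_def)
  then show "is_pole sn_quot z"
    using sn_quot_eventually[OF assms(1,2)] is_pole_cong[of sn_quot "\<lambda>w. N w / D w" z z]
    by (auto simp: eventually_nhds_conv_at)
  show "sn_quot z = 0" using sn_quot_eq[OF assms(1,2)] assms(3) by simp
qed

lemma sn_quot_derivative:
  assumes "sn_triple R N D M" "z \<in> ball 0 R" "D z \<noteq> 0"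
  shows "(sn_quot has_field_derivative M z / D z ^ 2) (at z)"
  using sn_triple_quotient[OF assms]
  by (rule has_field_derivative_transform_within_open[OF _ open_ball assms(2)]) (simp add: sn_quot_eq[OF assms(1)])

lemma is_pole_not_isCont: "is_pole f z \<Longrightarrow> \<not> isCont f z" for f :: "complex \<Rightarrow> complex"
  using not_tendsto_and_filterlim_at_infinity[of "at z" f] unfolding is_pole_def isCont_def by auto

lemma sn_triple_at:
  fixes z :: complex
  obtains R N D M where "sn_triple R N D M" "z \<in> ball 0 R"
proof -
  have "0 < norm z + 1" using norm_ge_zero[of z] by linarith
  then obtain N D M where "sn_triple (norm z + 1) N D M" using sn_triple_exists by blast
  then show ?thesis by (rule that) simp
qed

lemma is_sn_sn_quot: "is_sn sn_quot"
  unfolding is_sn_def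
proof (intro conjI allI impI)
  show "sn_quot nicely_meromorphic_on UNIV"
    unfolding nicely_meromorphic_on_def
  proof (intro conjI ballI)
    show "sn_quot meromorphic_on UNIV"
      unfolding meromorphic_on_meromorphic_at[of sn_quot UNIV]
    proof
      fix z :: complex
      obtain R N D M where T: "sn_triple R N D M" "z \<in> ball 0 R" by (rule sn_triple_at)
      have "N analytic_on {z}" "D analytic_on {z}"
        using T unfolding sn_triple_def by (auto simp: analytic_at intro!: exI[of _ "ball 0 R"])
      then have "(\<lambda>w. N w / D w) meromorphic_on {z}"
        by (intro meromorphic_on_divide analytic_on_imp_meromorphic_on)
      then show "sn_quot meromorphic_on {z}"
        using sn_quot_eventually[OF T] meromorphic_on_cong[of "{z}" sn_quot "\<lambda>w. N w / D w" "{z}"]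
        by (auto simp: eventually_nhds_conv_at)
    qed
    fix z :: complex
    obtain R N D M where T: "sn_triple R N D M" "z \<in> ball 0 R" by (rule sn_triple_at)
    show "is_pole sn_quot z \<and> sn_quot z = 0 \<or> sn_quot \<midarrow>z\<rightarrow> sn_quot z"
      using sn_quot_pole[OF T] DERIV_isCont[OF sn_quot_derivative[OF T]] unfolding isCont_def by blast
  qed
  fix v assume np: "\<not> is_pole sn_quot v"
  obtain R N D M where T: "sn_triple R N D M" "v \<in> ball 0 R" by (rule sn_triple_at)
  have D: "D v \<noteq> 0" using sn_quot_pole[OF T] np by blast
  have "(deriv sn_quot v)\<^sup>2 = 1 - (N v / D v) ^ 4"
    unfolding DERIV_imp_deriv[OF sn_quot_derivative[OF T D]] using D sn_tripleD(5)[OF T]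
    by (simp add: power_divide diff_divide_distrib power_mult[symmetric])
  then show "(deriv sn_quot v)\<^sup>2 = (1 - (sn_quot v)\<^sup>2) * (1 - (-1) * (sn_quot v)\<^sup>2)"
    unfolding sn_quot_eq[OF T] by (simp add: algebra_simps power4_eq_xxxx power2_eq_square)
next
  obtain R N D M where T: "sn_triple R N D M" "(0::complex) \<in> ball 0 R" by (rule sn_triple_at)
  then have "N 0 = 0" "D 0 = 1" "M 0 = 1" by (simp_all add: sn_triple_def)
  then show "sn_quot 0 = 0" "(sn_quot has_field_derivative 1) (at 0)"
    using sn_quot_eq[OF T] sn_quot_derivative[OF T] by simp_all
qed

lemma jacobi_sn_eq_sn_quot: "jacobi_sn w (-1) = sn_quot w"
proof -
  have "(THE s. is_sn s) = sn_quot"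
    by (rule the_equality, rule is_sn_sn_quot, erule is_sn_unique[OF _ is_sn_sn_quot])
  then show ?thesis unfolding jacobi_sn_def is_sn_def by simp
qed

lemma sn_pole_eq: "sn_pole w (-1) \<longleftrightarrow> is_pole sn_quot w"
  by (simp add: sn_pole_def jacobi_sn_eq_sn_quot)

lemma is_pole_sn_quot_iff:
  assumes "sn_triple R N D M" "z \<in> ball 0 R"
  shows "is_pole sn_quot z \<longleftrightarrow> D z = 0"
  using sn_quot_pole(1)[OF assms] DERIV_isCont[OF sn_quot_derivative[OF assms]] is_pole_not_isCont by blast

lemma sn_quot_at_pole: "is_pole sn_quot z \<Longrightarrow> sn_quot z = 0"
  by (rule sn_triple_at[of z]) (metis is_pole_sn_quot_iff sn_quot_pole(2))

lemma deriv_sn_quot: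
  assumes "\<not> is_pole sn_quot z"
  shows "(sn_quot has_field_derivative deriv sn_quot z) (at z)" "(deriv sn_quot z)\<^sup>2 = 1 - sn_quot z ^ 4"
    "(deriv sn_quot has_field_derivative - 2 * sn_quot z ^ 3) (at z)"
proof -
  obtain R N D M where T: "sn_triple R N D M" "z \<in> ball 0 R" by (rule sn_triple_at)
  have D: "D z \<noteq> 0" using assms is_pole_sn_quot_iff[OF T] by blast
  note d = sn_quot_derivative[OF T D]
  show "(sn_quot has_field_derivative deriv sn_quot z) (at z)"
    using d DERIV_imp_deriv[OF d] by simp
  show "(deriv sn_quot z)\<^sup>2 = 1 - sn_quot z ^ 4"
    unfolding DERIV_imp_deriv[OF d] sn_quot_eq[OF T] using D sn_tripleD(5)[OF T]
    by (simp add: power_divide diff_divide_distrib power_mult[symmetric])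
  have "((\<lambda>w. M w / D w ^ 2) has_field_derivative (deriv M z * D z ^ 2 - M z * (2 * D z * deriv D z)) / (D z ^ 2 * D z ^ 2)) (at z)"
    using D by (auto intro!: derivative_eq_intros sn_tripleD[OF T])
  \<comment> \<open>One factor \<open>D z\<close> is split off so that the last equation of the
    triple applies.\<close>
  also have "(deriv M z * D z ^ 2 - M z * (2 * D z * deriv D z)) / (D z ^ 2 * D z ^ 2)
    = D z * (deriv M z * D z - 2 * M z * deriv D z) / (D z ^ 2 * D z ^ 2)"
    by (simp add: power2_eq_square algebra_simps)
  also have "\<dots> = - 2 * sn_quot z ^ 3"
    unfolding sn_tripleD(7)[OF T] sn_quot_eq[OF T] using D by (simp add: field_simps eval_nat_numeral)
  finally have q: "((\<lambda>w. M w / D w ^ 2) has_field_derivative - 2 * sn_quot z ^ 3) (at z)" .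
  have "eventually (\<lambda>w. D w \<noteq> 0) (nhds z)"
    using sn_triple_denominator_eventually[OF T] D by (simp add: eventually_nhds_conv_at)
  moreover have "eventually (\<lambda>w. w \<in> ball 0 R) (nhds z)" by (rule eventually_nhds_in_open[OF open_ball T(2)])
  ultimately have "eventually (\<lambda>w. M w / D w ^ 2 = deriv sn_quot w) (nhds z)"
    by eventually_elim (metis DERIV_imp_deriv sn_quot_derivative[OF T(1)])
  from DERIV_cong_ev[OF refl this refl, THEN iffD1, OF q]
  show "(deriv sn_quot has_field_derivative - 2 * sn_quot z ^ 3) (at z)" .
qed

section \<open>Values at the origin, symmetries and translations of sn\<close>

lemma sn_quot_0: "sn_quot 0 = 0" "deriv sn_quot 0 = 1" "\<not> is_pole sn_quot 0"
  using is_sn_sn_quot DERIV_imp_deriv DERIV_isCont is_pole_not_isCont unfolding is_sn_def by blast+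

lemma open_sn_quot_regular: "open {z. \<not> is_pole sn_quot z}"
proof (subst open_subopen, safe)
  fix z assume np: "\<not> is_pole sn_quot z"
  obtain R N D M where T: "sn_triple R N D M" "z \<in> ball 0 R" by (rule sn_triple_at)
  have "continuous_on (ball 0 R) D"
    using T(1) unfolding sn_triple_def by (auto intro: holomorphic_on_imp_continuous_on)
  then have "open (D -` (- {0}) \<inter> ball 0 R)"
    by (intro continuous_on_open_vimage[THEN iffD1, rule_format]) auto
  then show "\<exists>W. open W \<and> z \<in> W \<and> W \<subseteq> {z. \<not> is_pole sn_quot z}"
    using np is_pole_sn_quot_iff[OF T(1)] T(2) by (intro exI[of _ "D -` (- {0}) \<inter> ball 0 R"]) auto
qed

text \<open>The equation \<open>s'^2 = 1 - s^4\<close> is invariant under multiplying argument and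
  value by i, so \<open>- i s(i z)\<close> is the quotient of another triple and equals
  \<open>s(z)\<close>.\<close>

lemma sn_quot_ii:
  shows "sn_quot (\<i> * z) = \<i> * sn_quot z" "is_pole sn_quot (\<i> * z) \<longleftrightarrow> is_pole sn_quot z"
proof -
  obtain R N D M where T: "sn_triple R N D M" "z \<in> ball 0 R" by (rule sn_triple_at)
  have i1: "- \<i> * x * (\<i> * y) = x * y" for x y by (simp add: complex_eq_iff)
  have i3: "(- \<i> * x) ^ 3 = \<i> * x ^ 3" for x
    unfolding power_mult_distrib by (simp add: power3_eq_cube)
  have b: "\<i> * w \<in> ball 0 R \<longleftrightarrow> w \<in> ball 0 R" for w by (simp add: norm_mult)
  have d: "((\<lambda>w. f (\<i> * w)) has_field_derivative \<i> * deriv f (\<i> * w)) (at w)"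
    if "(f has_field_derivative deriv f (\<i> * w)) (at (\<i> * w))" for f w
  proof -
    have "((\<lambda>w. \<i> * w) has_field_derivative \<i>) (at w)" by (auto intro!: derivative_eq_intros)
    from DERIV_chain2[of f, OF that this] show ?thesis by (rule DERIV_cong) (rule mult.commute)
  qed
  have T2: "sn_triple R (\<lambda>w. - \<i> * N (\<i> * w)) (\<lambda>w. D (\<i> * w)) (\<lambda>w. M (\<i> * w))"
  proof (rule sn_tripleI[where N'="\<lambda>w. deriv N (\<i> * w)" and D'="\<lambda>w. \<i> * deriv D (\<i> * w)" and M'="\<lambda>w. \<i> * deriv M (\<i> * w)"])
    fix w assume "w \<in> ball (0::complex) R"
    then have w: "\<i> * w \<in> ball 0 R" by (simp add: norm_mult)
    note W = sn_tripleD[OF T(1) w]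
    show "((\<lambda>w. - \<i> * N (\<i> * w)) has_field_derivative deriv N (\<i> * w)) (at w)"
      using DERIV_cmult[OF d[OF W(1)], of "- \<i>"] by (simp add: mult.assoc[symmetric])
    show "((\<lambda>w. D (\<i> * w)) has_field_derivative \<i> * deriv D (\<i> * w)) (at w)"
      "((\<lambda>w. M (\<i> * w)) has_field_derivative \<i> * deriv M (\<i> * w)) (at w)"
      by (rule d W)+
    show "- \<i> * N (\<i> * w) \<noteq> 0 \<or> D (\<i> * w) \<noteq> 0" using W(4) by simp
    show "(M (\<i> * w))\<^sup>2 = D (\<i> * w) ^ 4 - (- \<i> * N (\<i> * w)) ^ 4"
      using W(5) by (simp add: power_mult_distrib)
    show "deriv N (\<i> * w) * D (\<i> * w) - - \<i> * N (\<i> * w) * (\<i> * deriv D (\<i> * w)) = M (\<i> * w)"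
      using W(6) by (simp only: i1)
    have "\<i> * deriv M (\<i> * w) * D (\<i> * w) - 2 * M (\<i> * w) * (\<i> * deriv D (\<i> * w))
      = \<i> * (deriv M (\<i> * w) * D (\<i> * w) - 2 * M (\<i> * w) * deriv D (\<i> * w))" by (simp add: algebra_simps)
    also have "\<dots> = - 2 * (- \<i> * N (\<i> * w)) ^ 3" unfolding W(7) i3 by simp
    finally show "\<i> * deriv M (\<i> * w) * D (\<i> * w) - 2 * M (\<i> * w) * (\<i> * deriv D (\<i> * w)) = - 2 * (- \<i> * N (\<i> * w)) ^ 3" .
  qed (use T(1) in \<open>auto simp: sn_triple_def\<close>)
  have iz: "\<i> * z \<in> ball 0 R" using T(2) b by simp
  have "sn_quot z = - \<i> * N (\<i> * z) / D (\<i> * z)" by (rule sn_quot_eq[OF T2 T(2)])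
  also have "\<dots> = - \<i> * sn_quot (\<i> * z)" using sn_quot_eq[OF T(1) iz] by simp
  finally show "sn_quot (\<i> * z) = \<i> * sn_quot z" by (simp add: complex_eq_iff)
  show "is_pole sn_quot (\<i> * z) \<longleftrightarrow> is_pole sn_quot z"
    using is_pole_sn_quot_iff[OF T2 T(2)] is_pole_sn_quot_iff[OF T(1) iz] by simp
qed

text \<open>The equations of a triple have real coefficients, so conjugation produces another
  triple.\<close>

lemma sn_quot_cnj: "sn_quot (cnj z) = cnj (sn_quot z)"
proof -
  obtain R N D M where T: "sn_triple R N D M" "z \<in> ball 0 R" by (rule sn_triple_at)
  have d: "((\<lambda>w. cnj (f (cnj w))) has_field_derivative cnj (deriv f (cnj w))) (at w)"
    if "(f has_field_derivative deriv f (cnj w)) (at (cnj w))" for f w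
    using has_field_derivative_cnj_cnj[OF that] by (simp add: o_def)
  have T2: "sn_triple R (\<lambda>w. cnj (N (cnj w))) (\<lambda>w. cnj (D (cnj w))) (\<lambda>w. cnj (M (cnj w)))"
  proof (rule sn_tripleI[where N'="\<lambda>w. cnj (deriv N (cnj w))" and D'="\<lambda>w. cnj (deriv D (cnj w))" and M'="\<lambda>w. cnj (deriv M (cnj w))"])
    fix w assume "w \<in> ball (0::complex) R"
    then have w: "cnj w \<in> ball 0 R" by simp
    note W = sn_tripleD[OF T(1) w]
    show "((\<lambda>w. cnj (N (cnj w))) has_field_derivative cnj (deriv N (cnj w))) (at w)"
      "((\<lambda>w. cnj (D (cnj w))) has_field_derivative cnj (deriv D (cnj w))) (at w)"
      "((\<lambda>w. cnj (M (cnj w))) has_field_derivative cnj (deriv M (cnj w))) (at w)"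
      by (rule d W)+
    show "cnj (N (cnj w)) \<noteq> 0 \<or> cnj (D (cnj w)) \<noteq> 0" using W(4) by simp
    show "(cnj (M (cnj w)))\<^sup>2 = cnj (D (cnj w)) ^ 4 - cnj (N (cnj w)) ^ 4"
      using arg_cong[OF W(5), of cnj] by simp
    show "cnj (deriv N (cnj w)) * cnj (D (cnj w)) - cnj (N (cnj w)) * cnj (deriv D (cnj w)) = cnj (M (cnj w))"
      using arg_cong[OF W(6), of cnj] by simp
    show "cnj (deriv M (cnj w)) * cnj (D (cnj w)) - 2 * cnj (M (cnj w)) * cnj (deriv D (cnj w)) = - 2 * cnj (N (cnj w)) ^ 3"
      using arg_cong[OF W(7), of cnj] by simp
  qed (use T(1) in \<open>auto simp: sn_triple_def\<close>)
  have cz: "cnj z \<in> ball 0 R" using T(2) by simp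
  show ?thesis using sn_quot_eq[OF T2 cz] sn_quot_eq[OF T] by simp
qed

text \<open>At a zero with slope \<open>\<epsilon>\<close> the function
  \<open>\<epsilon> s(z + a)\<close> satisfies the initial conditions of \<open>s\<close>. Division
  by powers of \<open>D a\<close> normalises the translated triple to the values 0, 1, 1 at the
  origin.\<close>

lemma sn_quot_translate:
  assumes a: "\<not> is_pole sn_quot a" "sn_quot a = 0" "deriv sn_quot a = \<epsilon>" and \<epsilon>: "\<epsilon> = 1 \<or> \<epsilon> = -1"
  shows "sn_quot (z + a) = \<epsilon> * sn_quot z" "is_pole sn_quot (z + a) \<longleftrightarrow> is_pole sn_quot z"
proof -
  define S where "S = norm z + 1"
  \<comment> \<open>Large enough for \<open>w + a\<close> to stay in the ball of the triple when
    \<open>w\<close> lies in the ball of radius \<open>S\<close>.\<close>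
  define R where "R = S + norm a"
  have "0 < R" "0 < S"
    unfolding R_def S_def using norm_ge_zero[of z] norm_ge_zero[of a] by linarith+
  then obtain N D M where T: "sn_triple R N D M" using sn_triple_exists by blast
  have sub: "w + a \<in> ball 0 R" if "w \<in> ball 0 S" for w
    using that norm_triangle_ineq[of w a] by (simp add: R_def)
  have aR: "a \<in> ball 0 R" using sub[of 0] \<open>0 < S\<close> by simp
  define d where "d = D a"
  have d: "d \<noteq> 0" using a(1) is_pole_sn_quot_iff[OF T aR] by (simp add: d_def)
  have Na: "N a = 0" using a(2) sn_quot_eq[OF T aR] d by (simp add: d_def)
  have Ma: "M a = \<epsilon> * d ^ 2"
    using a(3) DERIV_imp_deriv[OF sn_quot_derivative[OF T aR]] d by (simp add: d_def field_simps)
  have e2: "\<epsilon> * \<epsilon> = 1" "\<epsilon> ^ 2 = 1" "\<epsilon> ^ 4 = 1" "\<epsilon> ^ 3 = \<epsilon>" "\<epsilon> \<noteq> 0" using \<epsilon> by auto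
  have T2: "sn_triple S (\<lambda>w. \<epsilon> / d * N (w + a)) (\<lambda>w. 1 / d * D (w + a)) (\<lambda>w. \<epsilon> / d ^ 2 * M (w + a))"
  proof (rule sn_tripleI[where N'="\<lambda>w. \<epsilon> / d * deriv N (w + a)" and D'="\<lambda>w. 1 / d * deriv D (w + a)" and M'="\<lambda>w. \<epsilon> / d ^ 2 * deriv M (w + a)"])
    fix w assume "w \<in> ball (0::complex) S"
    note W = sn_tripleD[OF T sub[OF this]]
    show "((\<lambda>w. \<epsilon> / d * N (w + a)) has_field_derivative \<epsilon> / d * deriv N (w + a)) (at w)"
      "((\<lambda>w. 1 / d * D (w + a)) has_field_derivative 1 / d * deriv D (w + a)) (at w)"
      "((\<lambda>w. \<epsilon> / d ^ 2 * M (w + a)) has_field_derivative \<epsilon> / d ^ 2 * deriv M (w + a)) (at w)"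
      by (intro DERIV_cmult W(1-3)[unfolded DERIV_shift])+
    show "\<epsilon> / d * N (w + a) \<noteq> 0 \<or> 1 / d * D (w + a) \<noteq> 0" using W(4) e2 d by simp
    show "(\<epsilon> / d ^ 2 * M (w + a))\<^sup>2 = (1 / d * D (w + a)) ^ 4 - (\<epsilon> / d * N (w + a)) ^ 4"
      using W(5) d by (simp add: power_mult_distrib power_divide e2 field_simps)
    have "\<epsilon> / d * deriv N (w + a) * (1 / d * D (w + a)) - \<epsilon> / d * N (w + a) * (1 / d * deriv D (w + a))
      = \<epsilon> / d ^ 2 * (deriv N (w + a) * D (w + a) - N (w + a) * deriv D (w + a))"
      using d by (simp add: field_simps power2_eq_square)
    then show "\<epsilon> / d * deriv N (w + a) * (1 / d * D (w + a)) - \<epsilon> / d * N (w + a) * (1 / d * deriv D (w + a))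
      = \<epsilon> / d ^ 2 * M (w + a)" unfolding W(6) .
    have "\<epsilon> / d ^ 2 * deriv M (w + a) * (1 / d * D (w + a)) - 2 * (\<epsilon> / d ^ 2 * M (w + a)) * (1 / d * deriv D (w + a))
      = \<epsilon> / d ^ 3 * (deriv M (w + a) * D (w + a) - 2 * M (w + a) * deriv D (w + a))"
      using d by (simp add: field_simps power2_eq_square power3_eq_cube)
    also have "\<dots> = - 2 * (\<epsilon> / d * N (w + a)) ^ 3" unfolding W(7) by (simp add: power_mult_distrib power_divide e2)
    finally show "\<epsilon> / d ^ 2 * deriv M (w + a) * (1 / d * D (w + a)) - 2 * (\<epsilon> / d ^ 2 * M (w + a)) * (1 / d * deriv D (w + a))
      = - 2 * (\<epsilon> / d * N (w + a)) ^ 3" .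
  qed (use \<open>0 < S\<close> d e2 in \<open>auto simp: Na Ma d_def[symmetric]\<close>)
  have z: "z \<in> ball 0 S" by (simp add: S_def)
  have "sn_quot z = \<epsilon> * (N (z + a) / D (z + a))"
    using sn_quot_eq[OF T2 z] d by simp
  then have "sn_quot z = \<epsilon> * sn_quot (z + a)" using sn_quot_eq[OF T sub[OF z]] by simp
  then have "\<epsilon> * sn_quot z = (\<epsilon> * \<epsilon>) * sn_quot (z + a)" by simp
  then show "sn_quot (z + a) = \<epsilon> * sn_quot z" using e2(1) by simp
  show "is_pole sn_quot (z + a) \<longleftrightarrow> is_pole sn_quot z"
    using is_pole_sn_quot_iff[OF T2 z] is_pole_sn_quot_iff[OF T sub[OF z]] d by simp
qed

text \<open>The slope at \<open>2 z\<close> is \<open>M / D^2\<close> of the doubled triple: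
  \<open>n^8 / n^8 = 1\<close> if \<open>d = 0\<close>, and \<open>(1 - 6 + 1) / 2^2 = -1\<close> if
  \<open>m = 0\<close>, where \<open>n^4 = d^4\<close>.\<close>

lemma sn_quot_double:
  assumes "is_pole sn_quot z \<and> \<epsilon> = 1 \<or> \<not> is_pole sn_quot z \<and> deriv sn_quot z = 0 \<and> \<epsilon> = -1"
  shows "\<not> is_pole sn_quot (2 * z)" "sn_quot (2 * z) = 0" "deriv sn_quot (2 * z) = \<epsilon>"
proof -
  obtain R N D M where T: "sn_triple R N D M" "z \<in> ball 0 R" by (rule sn_triple_at)
  define n d m where nd: "n = N z" "d = D z" "m = M z"
  note T2 = sn_triple_double[OF T(1)]
  have z2: "2 * z \<in> ball 0 (2 * R)" using T(2) by (simp add: norm_mult)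
  have i: "n \<noteq> 0 \<or> d \<noteq> 0" "m ^ 2 = d ^ 4 - n ^ 4" using sn_tripleD(4,5)[OF T] by (simp_all add: nd)
  have *: "d ^ 4 + n ^ 4 \<noteq> 0 \<and> n * m * d = 0 \<and> (d ^ 8 - 6 * n ^ 4 * d ^ 4 + n ^ 8) / (d ^ 4 + n ^ 4) ^ 2 = \<epsilon>"
    using assms
  proof
    assume "is_pole sn_quot z \<and> \<epsilon> = 1"
    then have "d = 0" "\<epsilon> = 1" using is_pole_sn_quot_iff[OF T] by (simp_all add: nd)
    then show ?thesis using i(1) by (simp add: power_mult[symmetric])
  next
    assume A: "\<not> is_pole sn_quot z \<and> deriv sn_quot z = 0 \<and> \<epsilon> = -1"
    then have d: "d \<noteq> 0" using is_pole_sn_quot_iff[OF T] by (simp add: nd)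
    then have m: "m = 0" using A DERIV_imp_deriv[OF sn_quot_derivative[OF T]] by (simp add: nd)
    then have n4: "n ^ 4 = d ^ 4" using i(2) by simp
    have n8: "n ^ 8 = d ^ 8" using arg_cong[OF n4, of "\<lambda>x. x ^ 2"] by (simp add: power_mult[symmetric])
    have d8: "d ^ 4 * d ^ 4 = d ^ 8" by (simp add: power_add[symmetric])
    show ?thesis using d A m by (simp add: n4 n8 power2_eq_square d8 field_simps)
  qed
  then have D2: "D (2 * z / 2) ^ 4 + N (2 * z / 2) ^ 4 \<noteq> 0" by (simp add: nd)
  show "\<not> is_pole sn_quot (2 * z)" using is_pole_sn_quot_iff[OF T2 z2] D2 by simp
  show "sn_quot (2 * z) = 0" using sn_quot_eq[OF T2 z2] * by (simp add: nd)
  show "deriv sn_quot (2 * z) = \<epsilon>"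
    using DERIV_imp_deriv[OF sn_quot_derivative[OF T2 z2 D2]] * by (simp add: nd)
qed

section \<open>The lemniscate sine on a ray\<close>

lemma sn_quot_rotate:
  assumes "\<epsilon> ^ 4 = 1"
  shows "sn_quot (\<epsilon> * z) = \<epsilon> * sn_quot z" "is_pole sn_quot (\<epsilon> * z) \<longleftrightarrow> is_pole sn_quot z"
proof -
  have "(\<epsilon> - 1) * (\<epsilon> + 1) * ((\<epsilon> - \<i>) * (\<epsilon> + \<i>)) = \<epsilon> ^ 4 - 1"
    by (simp add: algebra_simps power4_eq_xxxx)
  then have "(\<epsilon> - 1) * (\<epsilon> + 1) * ((\<epsilon> - \<i>) * (\<epsilon> + \<i>)) = 0" using assms by simp
  then consider "\<epsilon> = 1" | "\<epsilon> = -1" | "\<epsilon> = \<i>" | "\<epsilon> = - \<i>"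
    by (auto simp: eq_neg_iff_add_eq_0)
  then have "sn_quot (\<epsilon> * z) = \<epsilon> * sn_quot z \<and> (is_pole sn_quot (\<epsilon> * z) \<longleftrightarrow> is_pole sn_quot z)"
  proof cases
    case 2 then show ?thesis using sn_quot_ii[of "\<i> * z"] sn_quot_ii[of z] by simp
  next
    case 4
    then have e: "\<epsilon> * z = - (\<i> * z)" by simp
    show ?thesis unfolding e 4 using sn_quot_ii[of "- (\<i> * z)"] by (simp add: complex_eq_iff)
  qed (use sn_quot_ii in auto)
  then show "sn_quot (\<epsilon> * z) = \<epsilon> * sn_quot z" "is_pole sn_quot (\<epsilon> * z) \<longleftrightarrow> is_pole sn_quot z" by auto
qed

lemma closed_first_point:
  fixes A :: "real set"
  assumes "closed A" "x \<in> A" "0 < x" "0 \<notin> A"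
  obtains x0 where "0 < x0" "x0 \<in> A" "\<And>y. 0 \<le> y \<Longrightarrow> y < x0 \<Longrightarrow> y \<notin> A"
proof -
  define B where "B = A \<inter> {0..}"
  have B: "closed B" "B \<noteq> {}" "bdd_below B" using assms by (auto simp: B_def intro: bdd_belowI[of _ 0])
  have i: "Inf B \<in> B" by (rule closed_contains_Inf[OF B(2,3,1)])
  show ?thesis
  proof (rule that[of "Inf B"])
    show "0 < Inf B" using i assms(4) by (auto simp: B_def order_le_less)
    show "Inf B \<in> A" using i by (auto simp: B_def)
    show "y \<notin> A" if "0 \<le> y" "y < Inf B" for y
      using that cInf_lower[OF _ B(3), of y] by (auto simp: B_def)
  qed
qed

text \<open>On the real multiples of \<open>\<eta>\<close> the function is \<open>\<eta>\<close>
  times a real function \<open>f\<close> with \<open>f'^2 = 1 - \<delta> f^4\<close>. The case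
  \<open>\<delta> = 1\<close> is the real axis and \<open>\<delta> = -1\<close> a diagonal, on which
  \<open>cnj \<eta> = - \<i> * \<eta>\<close> lets conjugation be replaced by a rotation.\<close>

locale lemniscate_ray =
  fixes \<eta> :: complex and \<delta> :: real
  assumes ray: "\<eta> = 1 \<and> \<delta> = 1 \<or> \<eta> ^ 4 = -1 \<and> cnj \<eta> = - \<i> * \<eta> \<and> \<delta> = -1"
begin

lemma \<eta>4: "\<eta> ^ 4 = of_real \<delta>" and \<delta>_cases: "\<delta> = 1 \<or> \<delta> = -1" and \<eta>_nz: "\<eta> \<noteq> 0"
  using ray by auto

definition f :: "real \<Rightarrow> real" where "f x = Re (sn_quot (\<eta> * of_real x) / \<eta>)"
definition f' :: "real \<Rightarrow> real" where "f' x = Re (deriv sn_quot (\<eta> * of_real x))"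
definition reg :: "real \<Rightarrow> bool" where "reg x \<longleftrightarrow> \<not> is_pole sn_quot (\<eta> * of_real x)"

lemma sn_quot_ray: "sn_quot (\<eta> * of_real x) = \<eta> * of_real (f x)"
proof -
  have "cnj (sn_quot (\<eta> * of_real x) / \<eta>) = sn_quot (\<eta> * of_real x) / \<eta>"
    using ray
  proof
    assume "\<eta> = 1 \<and> \<delta> = 1" then show ?thesis using sn_quot_cnj[of "of_real x"] by simp
  next
    assume A: "\<eta> ^ 4 = -1 \<and> cnj \<eta> = - \<i> * \<eta> \<and> \<delta> = -1"
    have "cnj (sn_quot (\<eta> * of_real x)) = sn_quot (- \<i> * \<eta> * of_real x)"
      using sn_quot_cnj[of "\<eta> * of_real x"] A by simp
    also have "\<dots> = - \<i> * sn_quot (\<eta> * of_real x)"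
      using sn_quot_rotate(1)[of "- \<i>" "\<eta> * of_real x"] by (simp add: mult.assoc)
    finally show ?thesis using A by simp
  qed
  then have "sn_quot (\<eta> * of_real x) / \<eta> \<in> \<real>" using Reals_cnj_iff by blast
  then have "of_real (f x) = sn_quot (\<eta> * of_real x) / \<eta>" unfolding f_def using of_real_Re by blast
  then show ?thesis using \<eta>_nz by simp
qed

lemma f_not_reg: "\<not> reg x \<Longrightarrow> f x = 0"
  using sn_quot_at_pole unfolding f_def reg_def by simp

lemma open_reg: "open {x. reg x}"
proof -
  have "open ((\<lambda>x. \<eta> * of_real x) -` {z. \<not> is_pole sn_quot z})"
    using open_sn_quot_regular by (intro continuous_open_vimage) (auto intro!: continuous_intros)
  then show ?thesis by (simp add: vimage_def reg_def)
qed

lemma ray_vector_derivative: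
  assumes "(g has_field_derivative d) (at (\<eta> * of_real x))"
  shows "((\<lambda>x. g (\<eta> * of_real x)) has_vector_derivative \<eta> * d) (at x)"
proof -
  have "((\<lambda>x. \<eta> * of_real x) has_vector_derivative \<eta>) (at x)"
    by (auto intro!: derivative_eq_intros)
  from field_vector_diff_chain_at[OF this assms] show ?thesis by (simp add: o_def)
qed

text \<open>Along the line the complex derivative is the derivative of the real function
  \<open>f\<close>, hence real.\<close>

lemma deriv_ray:
  assumes "reg x"
  shows "deriv sn_quot (\<eta> * of_real x) = of_real (f' x)" "(f has_real_derivative f' x) (at x)"
proof -
  note S = deriv_sn_quot[OF assms[unfolded reg_def]]
  have "((\<lambda>x. sn_quot (\<eta> * of_real x) / \<eta>) has_vector_derivative (\<eta> * deriv sn_quot (\<eta> * of_real x)) / \<eta>) (at x)"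
    using ray_vector_derivative[OF S(1)] by (rule has_vector_derivative_divide)
  then have d: "((\<lambda>x. of_real (f x) :: complex) has_vector_derivative deriv sn_quot (\<eta> * of_real x)) (at x)"
    using \<eta>_nz by (simp add: sn_quot_ray)
  have "((\<lambda>x. Re (of_real (f x) :: complex)) has_vector_derivative Re (deriv sn_quot (\<eta> * of_real x))) (at x)"
    by (rule bounded_linear.has_vector_derivative[OF bounded_linear_Re d])
  then show r: "(f has_real_derivative f' x) (at x)"
    by (simp add: f'_def has_real_derivative_iff_has_vector_derivative)
  have "((\<lambda>x. of_real (f x) :: complex) has_vector_derivative of_real (f' x)) (at x)"
    using r has_vector_derivative_of_real by (simp add: has_real_derivative_iff_has_vector_derivative)
  then show "deriv sn_quot (\<eta> * of_real x) = of_real (f' x)"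
    using vector_derivative_unique_at[OF d] by simp
qed

lemma f'_square: "reg x \<Longrightarrow> (f' x)\<^sup>2 = 1 - \<delta> * f x ^ 4"
proof -
  assume r: "reg x"
  have "complex_of_real ((f' x)\<^sup>2) = of_real (1 - \<delta> * f x ^ 4)"
    using deriv_sn_quot(2)[OF r[unfolded reg_def]] unfolding deriv_ray(1)[OF r] sn_quot_ray
    by (simp add: power_mult_distrib \<eta>4)
  then show ?thesis using of_real_eq_iff by blast
qed

lemma f'_derivative:
  assumes "reg x" shows "(f' has_real_derivative - 2 * \<delta> * f x ^ 3) (at x)"
proof -
  have d: "((\<lambda>x. deriv sn_quot (\<eta> * of_real x)) has_vector_derivative \<eta> * (- 2 * sn_quot (\<eta> * of_real x) ^ 3)) (at x)"
    by (rule ray_vector_derivative[OF deriv_sn_quot(3)[OF assms[unfolded reg_def]]])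
  have "\<eta> * (- 2 * sn_quot (\<eta> * of_real x) ^ 3) = - 2 * (\<eta> ^ 4) * of_real (f x) ^ 3"
    unfolding sn_quot_ray by (simp add: power_mult_distrib eval_nat_numeral)
  also have "\<dots> = of_real (- 2 * \<delta> * f x ^ 3)" by (simp add: \<eta>4)
  finally have e: "Re (\<eta> * (- 2 * sn_quot (\<eta> * of_real x) ^ 3)) = - 2 * \<delta> * f x ^ 3"
    by (metis Re_complex_of_real)
  have "((\<lambda>x. Re (deriv sn_quot (\<eta> * of_real x))) has_vector_derivative - 2 * \<delta> * f x ^ 3) (at x)"
    using bounded_linear.has_vector_derivative[OF bounded_linear_Re d] unfolding e .
  then show ?thesis by (simp add: f'_def[abs_def] has_real_derivative_iff_has_vector_derivative)
qed

section \<open>First critical point, first pole and period\<close>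

lemma at_0: "reg 0" "f 0 = 0" "f' 0 = 1"
  using sn_quot_0 by (simp_all add: reg_def f_def f'_def)

lemma f_minus: "f (- x) = - f x" "reg (- x) \<longleftrightarrow> reg x"
  using sn_quot_rotate[of "-1" "\<eta> * of_real x"] by (simp_all add: f_def reg_def)

lemma f'_pos:
  assumes "0 \<le> x" "\<And>y. 0 \<le> y \<Longrightarrow> y \<le> x \<Longrightarrow> reg y \<and> f' y \<noteq> 0" shows "f' x > 0"
proof (rule ccontr)
  assume "\<not> f' x > 0"
  then have "\<exists>y. 0 \<le> y \<and> y \<le> x \<and> f' y = 0"
    using assms at_0 DERIV_isCont[OF f'_derivative] by (intro IVT2) auto
  then show False using assms by blast
qed

lemma f_increasing:
  assumes "0 \<le> x" "x < y" "\<And>t. 0 \<le> t \<Longrightarrow> t \<le> y \<Longrightarrow> reg t" "\<And>t. 0 \<le> t \<Longrightarrow> t < y \<Longrightarrow> f' t \<noteq> 0"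
  shows "f x < f y"
proof (rule DERIV_pos_imp_increasing_open[OF assms(2)])
  fix t assume t: "x < t" "t < y"
  have "f' t > 0" using t assms by (intro f'_pos) auto
  then show "\<exists>d. (f has_real_derivative d) (at t) \<and> 0 < d"
    using deriv_ray(2)[OF assms(3)[of t]] t assms(1) by auto
next
  show "continuous_on {x..y} f"
    using assms(1,3) by (intro continuous_at_imp_continuous_on ballI DERIV_isCont[OF deriv_ray(2)]) auto
qed

text \<open>Near a pole the modulus is at least 2, in particular at nearby points of the real axis,
  where regularity would give \<open>f^4 \<le> 1\<close>.\<close>

lemma reg_pos: assumes "\<delta> = 1" shows "reg x"
proof (rule ccontr)
  assume "\<not> reg x"
  then have "filterlim sn_quot at_infinity (at (\<eta> * of_real x))" by (simp add: reg_def is_pole_def)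
  then have "eventually (\<lambda>w. 2 \<le> norm (sn_quot w)) (at (\<eta> * of_real x))"
    by (auto simp: filterlim_at_infinity[of 0])
  then obtain d where d: "0 < d" "\<And>w. w \<noteq> \<eta> * of_real x \<Longrightarrow> dist w (\<eta> * of_real x) < d \<Longrightarrow> 2 \<le> norm (sn_quot w)"
    unfolding eventually_at by blast
  have \<eta>: "\<eta> = 1" using ray assms by auto
  have "dist (of_real (x + d / 2) :: complex) (of_real x) = norm (of_real (d / 2) :: complex)"
    unfolding dist_norm by (rule arg_cong[of _ _ norm]) simp
  then have "dist (\<eta> * of_real (x + d / 2)) (\<eta> * of_real x) < d" using d(1) \<eta> by (simp add: norm_divide)
  moreover have "\<eta> * of_real (x + d / 2) \<noteq> \<eta> * of_real x" using d(1) \<eta> by simp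
  ultimately have "2 \<le> norm (sn_quot (\<eta> * of_real (x + d / 2)))" by (intro d(2))
  then have 2: "2 \<le> \<bar>f (x + d / 2)\<bar>" unfolding sn_quot_ray using \<eta> by (simp add: norm_mult)
  \<comment> \<open>\<open>f\<close> is 0 at poles, so a value of modulus at least 2 certifies
    regularity.\<close>
  then have "reg (x + d / 2)" using f_not_reg by force
  then have "0 \<le> 1 - f (x + d / 2) ^ 4" using f'_square[of "x + d / 2"] assms by (metis mult_1 zero_le_power2)
  moreover have "2 ^ 4 \<le> \<bar>f (x + d / 2)\<bar> ^ 4" using 2 by (intro power_mono) auto
  ultimately show False by simp
qed

lemma f'_nz: assumes "\<delta> = -1" "reg x" shows "f' x \<noteq> 0" "(f x)\<^sup>2 \<le> \<bar>f' x\<bar>"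
proof -
  have e: "(f' x)\<^sup>2 = 1 + f x ^ 4" using f'_square[OF assms(2)] assms(1) by simp
  then have "0 < (f' x)\<^sup>2" by (simp add: add_pos_nonneg)
  then show "f' x \<noteq> 0" by auto
  have "((f x)\<^sup>2)\<^sup>2 \<le> (f' x)\<^sup>2" using e by (simp add: power_mult[symmetric])
  then show "(f x)\<^sup>2 \<le> \<bar>f' x\<bar>" using abs_le_square_iff[of "(f x)\<^sup>2" "f' x"] by simp
qed

text \<open>Without a critical point \<open>f\<close> increases, so beyond 1 it stays above
  \<open>m = f 1\<close> and \<open>f'' = - 2 f^3 \<le> - 2 m^3\<close>, which drives
  \<open>f'\<close> below 0.\<close>

lemma turning_point: assumes "\<delta> = 1" shows "\<exists>x>0. f' x = 0"
proof (rule ccontr)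
  assume "\<not> ?thesis"
  then have nz: "f' x \<noteq> 0" if "0 \<le> x" for x using that at_0(3) by (cases "x = 0") auto
  note reg = reg_pos[OF assms]
  have inc: "f x < f y" if "0 \<le> x" "x < y" for x y using that reg nz by (intro f_increasing) auto
  define m where "m = f 1"
  have m: "0 < m" using inc[of 0 1] at_0 by (simp add: m_def)
  \<comment> \<open>Chosen so that the resulting upper bound for \<open>f' X\<close> is exactly
    \<open>- 2 * m ^ 3\<close>.\<close>
  define X where "X = 2 + f' 1 / (2 * m ^ 3)"
  have f1: "f' 1 > 0" using reg nz by (intro f'_pos) auto
  have X: "1 < X" using f1 m unfolding X_def by (smt (verit) divide_pos_pos zero_less_power)
  have "\<exists>\<xi>. 1 < \<xi> \<and> \<xi> < X \<and> f' X - f' 1 = (X - 1) * (- 2 * \<delta> * f \<xi> ^ 3)"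
    by (intro MVT2 X f'_derivative reg)
  then obtain \<xi> where \<xi>: "1 < \<xi>" "f' X - f' 1 = (X - 1) * (- 2 * f \<xi> ^ 3)" using assms by auto
  have "m ^ 3 \<le> f \<xi> ^ 3" using inc[of 1 \<xi>] \<xi>(1) m by (intro power_mono) (auto simp: m_def)
  then have "(X - 1) * (2 * m ^ 3) \<le> (X - 1) * (2 * f \<xi> ^ 3)" using X by (intro mult_left_mono) auto
  then have "f' X \<le> f' 1 - (X - 1) * (2 * m ^ 3)" using \<xi>(2) by simp
  also have "\<dots> = - 2 * m ^ 3" using m by (simp add: X_def field_simps)
  also have "\<dots> < 0" using m by simp
  finally have "f' X < 0" .
  moreover have "f' X > 0" using reg nz X by (intro f'_pos) auto
  ultimately show False by simp
qed

text \<open>\<open>1 / f\<close> has derivative \<open>- f' / f^2 \<le> -1\<close> because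
  \<open>f'^2 = 1 + f^4\<close>, so from 1 on it would reach 0 within the distance
  \<open>1 / f 1\<close>.\<close>

lemma pole_on_ray: assumes "\<delta> = -1" shows "\<exists>x>0. \<not> reg x"
proof (rule ccontr)
  assume "\<not> ?thesis"
  then have reg: "reg x" if "0 \<le> x" for x using that at_0(1) by (cases "x = 0") auto
  have inc: "f x < f y" if "0 \<le> x" "x < y" for x y using that reg f'_nz[OF assms] by (intro f_increasing) auto
  have pos: "0 < f x" if "0 < x" for x using inc[of 0 x] that at_0 by simp
  define X where "X = 1 + inverse (f 1)"
  have X: "1 < X" using pos[of 1] by (simp add: X_def)
  have d: "((\<lambda>x. inverse (f x)) has_real_derivative - (f' x / (f x)\<^sup>2)) (at x)" if "1 \<le> x" for x
    using pos[of x] that deriv_ray(2)[OF reg[of x]]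
    by (auto intro!: derivative_eq_intros simp: field_simps power2_eq_square)
  have "\<exists>\<xi>. 1 < \<xi> \<and> \<xi> < X \<and> inverse (f X) - inverse (f 1) = (X - 1) * - (f' \<xi> / (f \<xi>)\<^sup>2)"
    by (intro MVT2 X d)
  then obtain \<xi> where \<xi>: "1 < \<xi>" "inverse (f X) - inverse (f 1) = (X - 1) * - (f' \<xi> / (f \<xi>)\<^sup>2)" by blast
  have "f' \<xi> > 0" using \<xi>(1) reg f'_nz[OF assms] by (intro f'_pos) auto
  then have "1 \<le> f' \<xi> / (f \<xi>)\<^sup>2"
    using f'_nz(2)[OF assms reg[of \<xi>]] \<xi>(1) pos[of \<xi>] by (simp add: field_simps)
  then have "(X - 1) * 1 \<le> (X - 1) * (f' \<xi> / (f \<xi>)\<^sup>2)" using X by (intro mult_left_mono) auto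
  then have "inverse (f X) - inverse (f 1) \<le> - (X - 1)" unfolding \<xi>(2) mult_minus_right by simp
  then have "inverse (f X) \<le> 0" unfolding X_def by linarith
  then show False using pos[of X] X by simp
qed

lemma half_period:
  obtains x0 where "0 < x0" "\<And>x. 0 < x \<Longrightarrow> x < x0 \<Longrightarrow> reg x \<and> 0 < f x"
    "\<delta> = 1 \<and> reg x0 \<and> 0 < f x0 \<and> f' x0 = 0 \<or> \<delta> = -1 \<and> \<not> reg x0"
  using \<delta>_cases
proof
  assume 1: "\<delta> = 1"
  note reg = reg_pos[OF 1]
  have "continuous_on UNIV f'" by (intro continuous_at_imp_continuous_on ballI DERIV_isCont[OF f'_derivative] reg)
  then have "closed {x. f' x = 0}" by (intro closed_Collect_eq) auto
  moreover obtain x where "0 < x" "f' x = 0" using turning_point[OF 1] by blast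
  ultimately obtain x0 where x0: "0 < x0" "f' x0 = 0" "\<And>y. 0 \<le> y \<Longrightarrow> y < x0 \<Longrightarrow> f' y \<noteq> 0"
    using closed_first_point[of "{x. f' x = 0}" x] at_0(3) by auto
  have "0 < f x" if "0 < x" "x \<le> x0" for x
    using f_increasing[of 0 x] that x0(3) reg at_0 by auto
  then show ?thesis using that[of x0] x0 1 reg by auto
next
  assume 1: "\<delta> = -1"
  have "closed {x. \<not> reg x}" using open_reg by (simp add: closed_def Collect_neg_eq[symmetric])
  moreover obtain x where "0 < x" "\<not> reg x" using pole_on_ray[OF 1] by blast
  ultimately obtain x0 where x0: "0 < x0" "\<not> reg x0" "\<And>y. 0 \<le> y \<Longrightarrow> y < x0 \<Longrightarrow> reg y"
    using closed_first_point[of "{x. \<not> reg x}" x] at_0(1) by auto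
  have "0 < f x" if "0 < x" "x < x0" for x
    using f_increasing[of 0 x] that x0(3) f'_nz(1)[OF 1] at_0 by auto
  then show ?thesis using that[of x0] x0 1 by auto
qed

text \<open>\<open>p\<close> is twice the first critical point or pole, hence a zero with slope
  \<open>- \<delta>\<close>. The fourth claim is about regular points because for
  \<open>\<delta> = -1\<close> there is a pole at \<open>p / 2\<close>, where \<open>f\<close> is 0;
  the fifth claim stops before it.\<close>

lemma period:
  obtains p where "0 < p" "\<And>x. f (x + p) = - \<delta> * f x" "\<And>x. reg (x + p) \<longleftrightarrow> reg x"
    "\<And>x. 0 < x \<Longrightarrow> x < p \<Longrightarrow> reg x \<Longrightarrow> f x \<noteq> 0" "\<And>x. 0 < x \<Longrightarrow> x < p / 2 \<Longrightarrow> f x \<noteq> 0"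
proof -
  obtain x0 where x0: "0 < x0" "\<And>x. 0 < x \<Longrightarrow> x < x0 \<Longrightarrow> reg x \<and> 0 < f x"
    "\<delta> = 1 \<and> reg x0 \<and> 0 < f x0 \<and> f' x0 = 0 \<or> \<delta> = -1 \<and> \<not> reg x0" by (rule half_period) blast
  define p where "p = 2 * x0"
  have "is_pole sn_quot (\<eta> * of_real x0) \<and> complex_of_real (- \<delta>) = 1
      \<or> \<not> is_pole sn_quot (\<eta> * of_real x0) \<and> deriv sn_quot (\<eta> * of_real x0) = 0 \<and> complex_of_real (- \<delta>) = -1"
    using x0(3) deriv_ray(1)[of x0] by (auto simp: reg_def)
  note D = sn_quot_double[OF this]
  have e: "2 * (\<eta> * of_real x0) = \<eta> * of_real p" by (simp add: p_def)
  note T = sn_quot_translate[OF D[unfolded e]]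
  have t: "sn_quot (z + \<eta> * of_real p) = of_real (- \<delta>) * sn_quot z"
     "is_pole sn_quot (z + \<eta> * of_real p) \<longleftrightarrow> is_pole sn_quot z" for z
    using T[of z] \<delta>_cases by auto
  have shift: "f (x + p) = - \<delta> * f x" "reg (x + p) \<longleftrightarrow> reg x" for x
  proof -
    have "sn_quot (\<eta> * of_real (x + p)) / \<eta> = of_real (- \<delta>) * (sn_quot (\<eta> * of_real x) / \<eta>)"
      using t(1)[of "\<eta> * of_real x"] by (simp add: distrib_left)
    also have "\<dots> = of_real (- \<delta> * f x)" unfolding sn_quot_ray using \<eta>_nz by simp
    finally show "f (x + p) = - \<delta> * f x" unfolding f_def by (metis Re_complex_of_real)
    show "reg (x + p) \<longleftrightarrow> reg x" using t(2)[of "\<eta> * of_real x"] by (simp add: reg_def distrib_left)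
  qed
  show ?thesis
  proof (rule that[OF _ shift])
    show "0 < p" using x0(1) by (simp add: p_def)
    show "f x \<noteq> 0" if "0 < x" "x < p / 2" for x using x0(2)[of x] that by (simp add: p_def)
    show "f x \<noteq> 0" if xp: "0 < x" "x < p" "reg x" for x
    proof -
      \<comment> \<open>By oddness and the shift, \<open>f x\<close> equals
        \<open>\<delta> * f (p - x)\<close>, which reflects the second half of the interval to the
        first.\<close>
      consider "x < x0" | "x = x0" | "0 < p - x" "p - x < x0"
        using xp unfolding p_def by linarith
      then show ?thesis
      proof cases
        case 1 then show ?thesis using x0(2)[of x] xp by simp
      next
        case 2 then show ?thesis using x0(3) xp by auto
      next
        case 3
        have "f (- (p - x) + p) = - \<delta> * f (- (p - x))" by (rule shift)
        then have "f x = \<delta> * f (p - x)" unfolding f_minus by simp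
        then show ?thesis using x0(2)[OF 3] \<delta>_cases by auto
      qed
    qed
  qed
qed

text \<open>The shift by \<open>p\<close> is an antiperiod for \<open>\<delta> = 1\<close> and a
  period for \<open>\<delta> = -1\<close>; hence P is 2 p or p, while the zeros are spaced by p in
  both cases.\<close>

lemma zeros_and_period:
  obtains P where "least_period f P"
    "\<And>x. reg x \<and> f x = 0 \<longleftrightarrow> (\<exists>n::int. x = (if \<delta> = 1 then of_int n * P / 2 else of_int n * P))"
proof -
  obtain p where p: "0 < p" "\<And>x. f (x + p) = - \<delta> * f x" "\<And>x. reg (x + p) \<longleftrightarrow> reg x"
    "\<And>x. 0 < x \<Longrightarrow> x < p \<Longrightarrow> reg x \<Longrightarrow> f x \<noteq> 0" "\<And>x. 0 < x \<Longrightarrow> x < p / 2 \<Longrightarrow> f x \<noteq> 0"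
    by (rule period) blast
  define Z where "Z x \<longleftrightarrow> reg x \<and> f x = 0" for x
  have Z1: "Z (x + p) \<longleftrightarrow> Z x" for x using p(2,3)[of x] \<delta>_cases by (auto simp: Z_def)
  have Zn: "Z (x + of_int n * p) \<longleftrightarrow> Z x" for x n
  proof (induction n rule: int_induct[of _ 0])
    case (step1 i) then show ?case using Z1[of "x + of_int i * p"] by (simp add: algebra_simps)
  next
    case (step2 i) then show ?case using Z1[of "x + of_int (i - 1) * p"] by (simp add: algebra_simps)
  qed simp
  have Z: "Z x \<longleftrightarrow> (\<exists>n::int. x = of_int n * p)" for x
  proof
    assume "\<exists>n::int. x = of_int n * p"
    then show "Z x" using Zn[of 0] at_0 by (auto simp: Z_def)
  next
    assume x: "Z x"
    define n where "n = \<lfloor>x / p\<rfloor>"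
    define y where "y = x - of_int n * p"
    have "Z y" using Zn[of y n] x by (simp add: y_def)
    moreover have "of_int n \<le> x / p" "x / p < of_int n + 1" by (auto simp: n_def)
    then have "of_int n * p \<le> x" "x < (of_int n + 1) * p" using p(1) by (simp_all add: field_simps)
    then have "0 \<le> y" "y < p" by (simp_all add: y_def algebra_simps)
    ultimately have "y = 0" using p(4)[of y] by (force simp: Z_def)
    then show "\<exists>n::int. x = of_int n * p" by (auto simp: y_def)
  qed
  define P where "P = (if \<delta> = 1 then 2 * p else p)"
  show ?thesis
  proof (rule that[of P])
    show "reg x \<and> f x = 0 \<longleftrightarrow> (\<exists>n::int. x = (if \<delta> = 1 then of_int n * P / 2 else of_int n * P))" for x
      using Z[of x] by (simp add: Z_def P_def)
    show "least_period f P"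
      unfolding least_period_def
    proof (intro conjI allI impI)
      show "0 < P" using p(1) by (simp add: P_def)
      show "f (t + P) = f t" for t
      proof (cases "\<delta> = 1")
        case True then show ?thesis using p(2)[of "t + p"] p(2)[of t] by (simp add: P_def algebra_simps)
      next
        case False then show ?thesis using p(2)[of t] \<delta>_cases by (simp add: P_def)
      qed
      fix Q assume Q: "0 < Q \<and> Q < P"
      \<comment> \<open>For an odd function with period Q, comparing the values at - Q / 2 and Q / 2
        would give \<open>f (Q / 2) = 0\<close>.\<close>
      have "f (Q / 2) \<noteq> 0"
        using Q p(4)[of "Q / 2"] p(5)[of "Q / 2"] reg_pos by (cases "\<delta> = 1") (auto simp: P_def)
      moreover have "f (- (Q / 2)) = - f (Q / 2)" by (rule f_minus)
      ultimately have "f (- (Q / 2) + Q) \<noteq> f (- (Q / 2))" by simp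
      then show "\<exists>t. f (t + Q) \<noteq> f t" by blast
    qed
  qed
qed

lemma continuous_on_f: "continuous_on {x. reg x} f"
  by (intro continuous_at_imp_continuous_on ballI DERIV_isCont[OF deriv_ray(2)]) simp

lemma open_nonzero: "open {x. f x \<noteq> 0}"
proof -
  have "open (f -` (- {0}) \<inter> {x. reg x})"
    using continuous_on_open_vimage[OF open_reg] continuous_on_f by blast
  moreover have "f -` (- {0}) \<inter> {x. reg x} = {x. f x \<noteq> 0}" using f_not_reg by auto
  ultimately show ?thesis by simp
qed

lemma zero_isolated:
  assumes "reg x" "f x = 0" shows "eventually (\<lambda>t. f t \<noteq> 0) (at x)"
proof -
  have "(f' x)\<^sup>2 = 1" using f'_square[OF assms(1)] assms(2) by simp
  then have "f' x \<noteq> 0" by auto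
  moreover have "((\<lambda>t. (f t - f x) / (t - x)) \<longlongrightarrow> f' x) (at x)"
    using deriv_ray(2)[OF assms(1)] by (simp add: has_field_derivative_iff)
  ultimately have "eventually (\<lambda>t. (f t - f x) / (t - x) \<noteq> 0) (at x)"
    using tendsto_imp_eventually_ne by blast
  then show ?thesis by eventually_elim (use assms(2) in auto)
qed

end

section \<open>The two families of solutions\<close>

context conformal_seed
begin

text \<open>\<open>ricci_square\<close> is at least a positive multiple of \<open>w^-8\<close>,
  which tends to infinity at a zero of \<open>w\<close>. That \<open>x\<close> is a limit point of
  \<open>U\<close> is shown along a straight line on which z varies.\<close>

lemma curvature_singularity:
  assumes x: "zeta x \<in> D" "z x \<notin> T" and w: "isCont w (z x)" "w (z x) = 0"
    and T: "eventually (\<lambda>t. t \<in> T) (at (z x))" and nz: "K \<noteq> 0" "px\<^sup>2 + py\<^sup>2 \<noteq> 0"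
  shows "curvature_singularity U (ricci_square g) x"
  unfolding curvature_singularity_def
proof (intro conjI)
  define P2 where "P2 = px\<^sup>2 + py\<^sup>2"
  \<comment> \<open>Moving in the direction (px, py) of the wave plane changes z at the nonzero rate
    \<open>P2\<close>.\<close>
  define \<phi> where "\<phi> s = x + s *\<^sub>R (px *\<^sub>R axis 3 1 + py *\<^sub>R axis 4 1)" for s :: real
  have z\<phi>: "z (\<phi> s) = z x + s * P2" for s
    by (simp add: lin_def \<phi>_def P2_def axis_def algebra_simps power2_eq_square)
  have P2: "P2 \<noteq> 0" using nz(2) by (simp add: P2_def)
  have e: "(px *\<^sub>R axis 3 1 + py *\<^sub>R axis 4 1 :: point) \<noteq> 0"
    using P2 by (auto simp: vec_eq_iff forall_4 axis_def P2_def)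
  have "((\<lambda>s. x + s *\<^sub>R (px *\<^sub>R axis 3 1 + py *\<^sub>R axis 4 1)) \<longlongrightarrow> x + 0 *\<^sub>R (px *\<^sub>R axis 3 1 + py *\<^sub>R axis 4 1)) (at (0::real))"
    by (intro tendsto_intros)
  then have "(\<phi> \<longlongrightarrow> x) (at 0)" by (simp add: \<phi>_def[abs_def])
  moreover have "eventually (\<lambda>s::real. s \<noteq> 0) (at 0)" by (auto simp: eventually_at_filter)
  then have "eventually (\<lambda>s. \<phi> s \<noteq> x) (at 0)"
    by eventually_elim (use e in \<open>simp add: \<phi>_def\<close>)
  ultimately have \<phi>: "filterlim \<phi> (at x) (at 0)" by (simp add: filterlim_at)
  have "((\<lambda>s. z x + s * P2) \<longlongrightarrow> z x + 0 * P2) (at (0::real))" by (intro tendsto_intros)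
  moreover have "eventually (\<lambda>s. z x + s * P2 \<noteq> z x) (at 0)"
    using P2 by (auto simp: eventually_at_filter)
  ultimately have "filterlim (\<lambda>s. z (\<phi> s)) (at (z x)) (at 0)" unfolding z\<phi> by (simp add: filterlim_at)
  from eventually_compose_filterlim[OF T this]
  have 1: "eventually (\<lambda>s. z (\<phi> s) \<in> T) (at 0)" by simp
  show "x islimpt U"
    unfolding islimpt_iff_eventually
  proof
    assume "eventually (\<lambda>p. p \<notin> U) (at x)"
    from eventually_compose_filterlim[OF this \<phi>] have 2: "eventually (\<lambda>s. \<phi> s \<notin> U) (at 0)" .
    have "open (zeta -` D)"
      using open_D continuous_on_zeta[of UNIV] by (simp add: continuous_on_open_vimage[OF open_UNIV])
    then have "eventually (\<lambda>p. p \<in> zeta -` D) (nhds x)" using x(1) by (intro eventually_nhds_in_open) auto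
    then have "eventually (\<lambda>p. p \<in> zeta -` D) (at x)" by (simp add: eventually_at_filter eventually_mono)
    from eventually_compose_filterlim[OF this \<phi>] have 3: "eventually (\<lambda>s. \<phi> s \<in> zeta -` D) (at 0)" .
    from 1 2 3 have "eventually (\<lambda>s::real. False) (at 0)" by eventually_elim auto
    then show False by simp
  qed
  show "x \<notin> U" using x by simp
  have "isCont z x" using continuous_on_lin[of UNIV] by (simp add: continuous_on_eq_continuous_at)
  then have "isCont (\<lambda>p. w (z p)) x" using w(1) by (rule isCont_o2)
  then have "isCont (\<lambda>p. w (z p) ^ 8) x" by (intro continuous_intros)
  then have "((\<lambda>p. w (z p) ^ 8) \<longlongrightarrow> 0) (at x within U)"
    using w(2) by (simp add: isCont_def tendsto_within_subset[of _ _ _ UNIV])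
  moreover have U: "eventually (\<lambda>p. p \<in> U) (at x within U)" by (auto simp: eventually_at_filter)
  then have "eventually (\<lambda>p. 0 < w (z p) ^ 8) (at x within U)"
    by eventually_elim (use w_nz in \<open>simp add: zero_less_power_eq\<close>)
  ultimately have "filterlim (\<lambda>p. inverse (w (z p) ^ 8)) at_top (at x within U)"
    by (rule filterlim_inverse_at_top)
  moreover have "0 < 12 * K\<^sup>2 * P2\<^sup>2" using nz(1) P2 by simp
  ultimately have lim: "filterlim (\<lambda>p. 12 * K\<^sup>2 * P2\<^sup>2 * inverse (w (z p) ^ 8)) at_top (at x within U)"
    by (intro filterlim_tendsto_pos_mult_at_top[OF tendsto_const])
  show "filterlim (\<lambda>p. \<bar>ricci_square g p\<bar>) at_top (at x within U)"
  proof (rule filterlim_at_top_mono[OF lim])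
    show "eventually (\<lambda>p. 12 * K\<^sup>2 * P2\<^sup>2 * inverse (w (z p) ^ 8) \<le> \<bar>ricci_square g p\<bar>) (at x within U)"
      using U
    proof eventually_elim
      case (elim p)
      have "0 \<le> 36 * L\<^sup>2 * (px\<^sup>2 + py\<^sup>2)\<^sup>2" by simp
      then have "12 * K\<^sup>2 * P2\<^sup>2 * inverse (w (z p) ^ 8) \<le> ricci_square g p"
        unfolding ricci_square_eq[OF elim] P2_def divide_inverse by linarith
      then show ?case by linarith
    qed
  qed
qed

end

text \<open>A rescaling of \<open>f\<close>: for \<open>K = k^4\<close> and
  \<open>L = \<delta> \<kappa>^4\<close> the factor satisfies \<open>w' = k^2 f'\<close>, which
  turns \<open>f'^2 = 1 - \<delta> f^4\<close> into \<open>w'^2 = K - L w^4\<close>.\<close>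

lemma (in lemniscate_ray) conformal_seed_sn:
  assumes "open D" "F holomorphic_on D" "G holomorphic_on D" and k: "k > 0" and \<kappa>: "\<kappa> > 0"
  shows "conformal_seed F G D (\<delta> * \<kappa> ^ 4) (k ^ 4) (\<lambda>t. k / \<kappa> * f (k * \<kappa> * (t - c)))
    (\<lambda>t. k * \<kappa> * f' (k * \<kappa> * (t - c)) / f (k * \<kappa> * (t - c))) {t. f (k * \<kappa> * (t - c)) \<noteq> 0}"
proof
  show "open {t. f (k * \<kappa> * (t - c)) \<noteq> 0}"
  proof -
    have "open ((\<lambda>t. k * \<kappa> * (t - c)) -` {x. f x \<noteq> 0})"
      using open_nonzero by (intro continuous_open_vimage) (auto intro!: continuous_intros)
    then show ?thesis by (simp add: vimage_def)
  qed
  fix t assume t: "t \<in> {t. f (k * \<kappa> * (t - c)) \<noteq> 0}"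
  define s where "s = k * \<kappa> * (t - c)"
  have s: "f s \<noteq> 0" "reg s" using t f_not_reg by (auto simp: s_def)
  have d: "((\<lambda>t. k * \<kappa> * (t - c)) has_real_derivative k * \<kappa>) (at t)"
    by (auto intro!: derivative_eq_intros)
  have df: "((\<lambda>t. f (k * \<kappa> * (t - c))) has_real_derivative f' s * (k * \<kappa>)) (at t)"
    using DERIV_chain2[of f "f' s" "\<lambda>t. k * \<kappa> * (t - c)", OF _ d] deriv_ray(2)[OF s(2)] by (simp add: s_def)
  have df': "((\<lambda>t. f' (k * \<kappa> * (t - c))) has_real_derivative - 2 * \<delta> * f s ^ 3 * (k * \<kappa>)) (at t)"
    using DERIV_chain2[of f' "- 2 * \<delta> * f s ^ 3" "\<lambda>t. k * \<kappa> * (t - c)", OF _ d] f'_derivative[OF s(2)] by (simp add: s_def)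
  show "k / \<kappa> * f (k * \<kappa> * (t - c)) \<noteq> 0" using t k \<kappa> by simp
  show "((\<lambda>t. k / \<kappa> * f (k * \<kappa> * (t - c))) has_real_derivative
      k * \<kappa> * f' (k * \<kappa> * (t - c)) / f (k * \<kappa> * (t - c)) * (k / \<kappa> * f (k * \<kappa> * (t - c)))) (at t)"
    by (rule DERIV_cong[OF DERIV_cmult[OF df]], unfold s_def[symmetric]) (use s(1) \<kappa> in \<open>simp add: field_simps\<close>)
  have "f (k * \<kappa> * (t - c)) \<noteq> 0" using t by simp
  note D = DERIV_divide[OF DERIV_cmult[OF df'] df this, of "k * \<kappa>"]
  show "((\<lambda>t. k * \<kappa> * f' (k * \<kappa> * (t - c)) / f (k * \<kappa> * (t - c))) has_real_derivative
      - 2 * (\<delta> * \<kappa> ^ 4) * (k / \<kappa> * f (k * \<kappa> * (t - c)))\<^sup>2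
      - (k * \<kappa> * f' (k * \<kappa> * (t - c)) / f (k * \<kappa> * (t - c)))\<^sup>2) (at t)"
    by (rule DERIV_cong[OF D], unfold s_def[symmetric]) (use s(1) \<kappa> in \<open>simp add: field_simps eval_nat_numeral\<close>)
  have "(k * \<kappa> * f' s / f s)\<^sup>2 * (k / \<kappa> * f s)\<^sup>2 = k ^ 4 * (f' s)\<^sup>2"
    using s(1) \<kappa> by (simp add: field_simps eval_nat_numeral)
  also have "\<dots> = k ^ 4 - \<delta> * \<kappa> ^ 4 * (k / \<kappa> * f s) ^ 4"
    unfolding f'_square[OF s(2)] using \<kappa> by (simp add: field_simps eval_nat_numeral)
  finally show "(k * \<kappa> * f' (k * \<kappa> * (t - c)) / f (k * \<kappa> * (t - c)))\<^sup>2 * (k / \<kappa> * f (k * \<kappa> * (t - c)))\<^sup>2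
      = k ^ 4 - \<delta> * \<kappa> ^ 4 * (k / \<kappa> * f (k * \<kappa> * (t - c))) ^ 4" by (simp add: s_def)
qed (use assms in auto)

text \<open>Covers every choice of the fourth root: relative to the standard root
  \<open>\<eta> * of_real \<kappa>\<close> it differs by a fourth root of unity
  \<open>\<epsilon>\<close>, and sn commutes with multiplication by
  \<open>\<epsilon>\<close>.\<close>

lemma fourth_root_ray:
  fixes q :: complex and L :: real
  assumes "q ^ 4 = of_real L" "L \<noteq> 0"
  obtains \<eta> \<delta> \<epsilon> \<kappa> where "lemniscate_ray \<eta> \<delta>" "\<epsilon> ^ 4 = 1" "\<kappa> > 0" "q = \<epsilon> * \<eta> * of_real \<kappa>" "L = \<delta> * \<kappa> ^ 4" "\<delta> = sgn L"
proof -
  define \<kappa> where "\<kappa> = root 4 \<bar>L\<bar>"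
  have \<kappa>: "\<kappa> > 0" "\<kappa> ^ 4 = \<bar>L\<bar>" using assms(2) by (simp_all add: \<kappa>_def)
  define \<delta> where "\<delta> = sgn L"
  define \<eta> where "\<eta> = (if L > 0 then 1 else cis (pi / 4))"
  have lr: "lemniscate_ray \<eta> \<delta>"
  proof
    have "cis (pi / 4) ^ 4 = cis (real 4 * (pi / 4))" by (rule Complex.DeMoivre)
    then have "cis (pi / 4) ^ 4 = -1" by simp
    moreover have "cnj (cis (pi / 4)) = - \<i> * cis (pi / 4)"
      by (simp add: complex_eq_iff cos_45 sin_45)
    ultimately show "\<eta> = 1 \<and> \<delta> = 1 \<or> \<eta> ^ 4 = -1 \<and> cnj \<eta> = - \<i> * \<eta> \<and> \<delta> = -1"
      using assms(2) by (auto simp: \<eta>_def \<delta>_def)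
  qed
  interpret lemniscate_ray \<eta> \<delta> by (rule lr)
  have L: "L = \<delta> * \<kappa> ^ 4" by (simp add: \<kappa>(2) \<delta>_def sgn_mult_abs)
  have nz: "\<eta> * of_real \<kappa> \<noteq> 0" using \<eta>_nz \<kappa>(1) by simp
  have "(q / (\<eta> * of_real \<kappa>)) ^ 4 = of_real L / (of_real \<delta> * of_real \<kappa> ^ 4)"
    by (simp add: power_divide power_mult_distrib assms(1) \<eta>4)
  also have "\<dots> = of_real L / of_real (\<delta> * \<kappa> ^ 4)" by simp
  also have "\<dots> = 1" unfolding L[symmetric] using assms(2) by simp
  finally have "(q / (\<eta> * of_real \<kappa>)) ^ 4 = 1" .
  then show ?thesis
    by (rule that[OF lr _ \<kappa>(1) _ L \<delta>_def]) (use nz in simp)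
qed

text \<open>The zero tensor has no boost order, so type N is asserted where the tensor is nonzero,
  and its vanishing is characterised separately. Poles are excluded from the zeros because
  \<open>jacobi_sn\<close> is 0 there by convention.\<close>

theorem mainTheorem5:
  fixes \<alpha>' \<beta>' \<gamma>' \<Lambda> pu px py L c :: real
    and F G :: "complex \<Rightarrow> complex" and D :: "complex set"
  assumes "\<alpha>' \<noteq> 0" and "\<beta>' \<noteq> 0" and "\<gamma>' \<noteq> 0"
    and "\<Lambda> = - \<gamma>' / (8 * \<beta>')"
    and "open D" and "F holomorphic_on D" and "G holomorphic_on D"
    and "px\<^sup>2 + py\<^sup>2 \<noteq> 0"
    and "L = \<Lambda> / (3 * (px\<^sup>2 + py\<^sup>2))"
  shows
    "(L < 0 \<longrightarrow> (\<forall>\<sigma>\<in>{1, -1}.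
       let z = lin pu px py;
           \<Omega> = (\<lambda>t. \<sigma> * sqrt (- 1 / L) * (1 / (t - c)));
           U = {p. zeta p \<in> D \<and> z p \<noteq> c};
           g = conformal (\<lambda>p. \<Omega> (z p)) (seed_metric F G)
       in quadratic_gravity_vacuum \<alpha>' \<beta>' \<gamma>' \<Lambda> U g
        \<and> (\<forall>p\<in>U.
             (weyl g p \<noteq> (\<lambda>_ _ _ _. 0) \<longrightarrow> weyl_boost_order g p d_r (-2) \<and> weyl_type_N g p)
           \<and> (weyl g p = (\<lambda>_ _ _ _. 0) \<longleftrightarrow>
                deriv (deriv F) (zeta p) + cnj (zeta p) * deriv (deriv G) (zeta p) = 0)
           \<and> (traceless_ricci g p \<noteq> (\<lambda>_ _. 0) \<longrightarrow>
                ricci_boost_order g p d_r (-2) \<and> traceless_ricci_type_N g p)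
           \<and> (traceless_ricci g p = (\<lambda>_ _. 0) \<longleftrightarrow>
                2 * (z p - c) * Re (deriv G (zeta p)) =
                Re (Complex px py *
                    (deriv F (zeta p) + cnj (zeta p) * deriv G (zeta p) + cnj (G (zeta p))))))
        \<and> siklos_geometry \<Lambda> U g))
   \<and> (\<forall>K>0. \<forall>q :: complex. q ^ 4 = of_real L \<longrightarrow>
      (let z = lin pu px py;
           arg = (\<lambda>t::real. of_real (root 4 K) * q * of_real (t - c));
           S = (\<lambda>t. jacobi_sn (arg t) (-1));
           \<Omega>C = (\<lambda>t. of_real (root 4 K) * (1 / q) * S t);
           \<Omega> = (\<lambda>t. Re (\<Omega>C t));
           U = {p. zeta p \<in> D \<and> \<not> sn_pole (arg (z p)) (-1) \<and> S (z p) \<noteq> 0};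
           Z = {t. \<not> sn_pole (arg t) (-1) \<and> S t = 0};
           g = conformal (\<lambda>p. \<Omega> (z p)) (seed_metric F G)
       in (\<forall>t. \<Omega>C t \<in> \<real>)
        \<and> quadratic_gravity_vacuum \<alpha>' \<beta>' \<gamma>' \<Lambda> U g
        \<and> (\<forall>p\<in>U.
             (weyl g p \<noteq> (\<lambda>_ _ _ _. 0) \<longrightarrow> weyl_boost_order g p d_r (-2) \<and> weyl_type_N g p)
           \<and> (weyl g p = (\<lambda>_ _ _ _. 0) \<longleftrightarrow>
                deriv (deriv F) (zeta p) + cnj (zeta p) * deriv (deriv G) (zeta p) = 0)
           \<and> ricci_boost_order g p d_r 0 \<and> traceless_ricci_type_II g p
           \<and> ricci_scalar g p = 4 * \<Lambda>
           \<and> complex_of_real (ricci_square g p) =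
               1 / 12 * of_real ((ricci_scalar g p)\<^sup>2) * (3 + 1 / S (z p) ^ 8))
        \<and> (\<forall>x. zeta x \<in> D \<and> z x \<in> Z \<longrightarrow> curvature_singularity U (ricci_square g) x)
        \<and> (\<exists>P. least_period S P \<and> c \<in> Z \<and> c + P \<in> Z
             \<and> Z = (if L > 0 then {c + of_int n * P / 2 | n. True}
                    else {c + of_int n * P | n. True}))))"
proof (intro conjI impI ballI allI)
  have \<Lambda>: "\<Lambda> = 3 * L * (px\<^sup>2 + py\<^sup>2)" 
  proof -
    have "3 * (\<Lambda> / (3 * P)) * P = \<Lambda>" if "P \<noteq> 0" for P :: real using that by simp
    from this[OF assms(8)] show ?thesis unfolding assms(9) by simp
  qed
  have \<gamma>: "\<gamma>' = - 8 * \<beta>' * \<Lambda>" using assms(2,4) by simp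
  fix \<sigma> :: real
  assume L: "L < 0" and "\<sigma> \<in> {1, -1}"
  then have \<sigma>: "\<sigma> \<noteq> 0" "\<sigma>\<^sup>2 = 1" by auto
  have sq: "(sqrt (- 1 / L))\<^sup>2 = - 1 / L" using L by (intro real_sqrt_pow2) (simp add: divide_nonpos_neg)
  have sq4: "(sqrt (- 1 / L)) ^ 4 = 1 / L\<^sup>2"
    using arg_cong[OF sq, of "\<lambda>x. x\<^sup>2"] by (simp add: power_mult[symmetric] power_divide)
  have \<sigma>4: "\<sigma> ^ 4 = 1" using arg_cong[OF \<sigma>(2), of "\<lambda>x. x\<^sup>2"] by (simp add: power_mult[symmetric])
  \<comment> \<open>The case K = 0: the factor is a multiple of 1 / (t - c), with logarithmic
    derivative - 1 / (t - c).\<close>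
  interpret C: conformal_seed F G D pu px py L 0 "\<lambda>t. \<sigma> * sqrt (- 1 / L) * (1 / (t - c))" "\<lambda>t. - 1 / (t - c)" "{t. t \<noteq> c}"
  proof
    have "open (- {c})" by (intro open_Compl closed_singleton)
    then show "open {t. t \<noteq> c}" by (simp add: Compl_eq)
    fix t assume "t \<in> {t. t \<noteq> c}"
    then have t: "t - c \<noteq> 0" by simp
    show "\<sigma> * sqrt (- 1 / L) * (1 / (t - c)) \<noteq> 0" using t \<sigma>(1) L by simp
    show "((\<lambda>t. \<sigma> * sqrt (- 1 / L) * (1 / (t - c))) has_real_derivative - 1 / (t - c) * (\<sigma> * sqrt (- 1 / L) * (1 / (t - c)))) (at t)"
      using t by (auto intro!: derivative_eq_intros simp: field_simps power2_eq_square)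
    show "((\<lambda>t. - 1 / (t - c)) has_real_derivative
       - 2 * L * (\<sigma> * sqrt (- 1 / L) * (1 / (t - c)))\<^sup>2 - (- 1 / (t - c))\<^sup>2) (at t)"
    proof (rule DERIV_cong)
      show "((\<lambda>t. - 1 / (t - c)) has_real_derivative 1 / (t - c)\<^sup>2) (at t)"
        using t by (auto intro!: derivative_eq_intros simp: power2_eq_square)
      show "1 / (t - c)\<^sup>2 = - 2 * L * (\<sigma> * sqrt (- 1 / L) * (1 / (t - c)))\<^sup>2 - (- 1 / (t - c))\<^sup>2"
        unfolding power_mult_distrib sq \<sigma>(2) using L by (simp add: power_divide)
    qed
    show "(- 1 / (t - c))\<^sup>2 * (\<sigma> * sqrt (- 1 / L) * (1 / (t - c)))\<^sup>2 = 0 - L * (\<sigma> * sqrt (- 1 / L) * (1 / (t - c))) ^ 4"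
    proof -
      have "(- 1 / r)\<^sup>2 * (1 * (- 1 / L) * (1 / r)\<^sup>2) = 0 - L * (1 * (1 / L\<^sup>2) * (1 / r) ^ 4)" if "r \<noteq> 0" for r
        using that L by (simp add: field_simps eval_nat_numeral)
      from this[OF t] show ?thesis unfolding power_mult_distrib sq sq4 \<sigma>(2) \<sigma>4 .
    qed
  qed (use assms in auto)
  let ?U = "{p. zeta p \<in> D \<and> lin pu px py p \<noteq> c}"
  have U: "?U = {p. zeta p \<in> D \<and> lin pu px py p \<in> {t. t \<noteq> c}}" by simp
  let ?g = "conformal (\<lambda>p. \<sigma> * sqrt (- 1 / L) * (1 / (lin pu px py p - c))) (seed_metric F G)"
  have siklos: "siklos_geometry \<Lambda> ?U ?g"
    unfolding siklos_geometry_def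
  proof (intro conjI exI)
    have "px\<^sup>2 + py\<^sup>2 > 0" using assms(8) by (metis sum_power2_gt_zero_iff zero_neq_one power_zero_numeral add_0 sum_power2_eq_zero_iff)
    then show "\<Lambda> < 0" unfolding \<Lambda> using L by (simp add: mult_less_0_iff)
    show "px\<^sup>2 + py\<^sup>2 \<noteq> 0" by fact
    \<comment> \<open>The constant factor 1 solves the same equations with L = K = 0, which shows
      that the unscaled seed metric is Lorentzian.\<close>
    interpret C1: conformal_seed F G D pu px py 0 0 "\<lambda>_. 1" "\<lambda>_. 0" "{t. t \<noteq> c}"
      by unfold_locales (use assms C.open_T in auto)
    have "conformal (\<lambda>p. 1) (seed_metric F G) = pp_wave (seed_profile F G)"
      by (rule ext) (simp add: conformal_def seed_metric_def)
    then show "lorentzian_metric ?U (pp_wave (seed_profile F G))"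
      using C1.lorentzian_metric_g by simp
    show "\<forall>p\<in>?U. lin pu px py p \<noteq> c \<and>
        ?g p = (- 3 * (px\<^sup>2 + py\<^sup>2) / \<Lambda> / (lin pu px py p - c)\<^sup>2) *\<^sub>R pp_wave (seed_profile F G) p"
    proof
      fix p assume p: "p \<in> ?U"
      \<comment> \<open>The Siklos constant \<open>- 3 (px^2 + py^2) / \<Lambda>\<close> equals
        \<open>- 1 / L\<close>, the square of the amplitude of \<Omega>.\<close>
      have "1 * (- 1 / L) * (1 / r)\<^sup>2 = - 3 * P / (3 * L * P) / r\<^sup>2" if "P \<noteq> 0" for P r
        using that L by (simp add: power_divide)
      from this[OF assms(8), of "lin pu px py p - c"]
      have "(\<sigma> * sqrt (- 1 / L) * (1 / (lin pu px py p - c)))\<^sup>2 = - 3 * (px\<^sup>2 + py\<^sup>2) / \<Lambda> / (lin pu px py p - c)\<^sup>2"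
        unfolding power_mult_distrib sq \<sigma>(2) \<Lambda> .
      then show "lin pu px py p \<noteq> c \<and>
        ?g p = (- 3 * (px\<^sup>2 + py\<^sup>2) / \<Lambda> / (lin pu px py p - c)\<^sup>2) *\<^sub>R pp_wave (seed_profile F G) p"
        using p by (simp only: conformal_def seed_metric_def) simp
    qed
  qed
  have types: "(weyl ?g p \<noteq> (\<lambda>_ _ _ _. 0) \<longrightarrow> weyl_boost_order ?g p d_r (-2) \<and> weyl_type_N ?g p)
           \<and> (weyl ?g p = (\<lambda>_ _ _ _. 0) \<longleftrightarrow>
                deriv (deriv F) (zeta p) + cnj (zeta p) * deriv (deriv G) (zeta p) = 0)
           \<and> (traceless_ricci ?g p \<noteq> (\<lambda>_ _. 0) \<longrightarrow>
                ricci_boost_order ?g p d_r (-2) \<and> traceless_ricci_type_N ?g p)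
           \<and> (traceless_ricci ?g p = (\<lambda>_ _. 0) \<longleftrightarrow>
                2 * (lin pu px py p - c) * Re (deriv G (zeta p)) =
                Re (Complex px py *
                    (deriv F (zeta p) + cnj (zeta p) * deriv G (zeta p) + cnj (G (zeta p)))))"
    if "p \<in> ?U" for p
  proof -
    have p: "p \<in> {p. zeta p \<in> D \<and> lin pu px py p \<in> {t. t \<noteq> c}}" using that by simp
    have nz: "lin pu px py p - c \<noteq> 0" using that by simp
    have "- 2 * r = - 1 / (lin pu px py p - c) * s \<longleftrightarrow> 2 * (lin pu px py p - c) * r = s" for r s :: real
      using nz by (auto simp: field_simps)
    then show ?thesis
      using C.weyl_type_N[OF p] C.weyl_eq_0_iff[OF p] C.traceless_ricci_type_N[OF p refl]
        C.traceless_ricci_eq_0_iff[OF p refl]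
      unfolding weyl_type_N_def traceless_ricci_type_N_def by blast
  qed
  show "let z = lin pu px py;
           \<Omega> = (\<lambda>t. \<sigma> * sqrt (- 1 / L) * (1 / (t - c)));
           U = {p. zeta p \<in> D \<and> z p \<noteq> c};
           g = conformal (\<lambda>p. \<Omega> (z p)) (seed_metric F G)
       in quadratic_gravity_vacuum \<alpha>' \<beta>' \<gamma>' \<Lambda> U g
        \<and> (\<forall>p\<in>U.
             (weyl g p \<noteq> (\<lambda>_ _ _ _. 0) \<longrightarrow> weyl_boost_order g p d_r (-2) \<and> weyl_type_N g p)
           \<and> (weyl g p = (\<lambda>_ _ _ _. 0) \<longleftrightarrow>
                deriv (deriv F) (zeta p) + cnj (zeta p) * deriv (deriv G) (zeta p) = 0)
           \<and> (traceless_ricci g p \<noteq> (\<lambda>_ _. 0) \<longrightarrow>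
                ricci_boost_order g p d_r (-2) \<and> traceless_ricci_type_N g p)
           \<and> (traceless_ricci g p = (\<lambda>_ _. 0) \<longleftrightarrow>
                2 * (z p - c) * Re (deriv G (zeta p)) =
                Re (Complex px py *
                    (deriv F (zeta p) + cnj (zeta p) * deriv G (zeta p) + cnj (G (zeta p))))))
        \<and> siklos_geometry \<Lambda> U g"
    unfolding Let_def using C.quadratic_gravity[OF \<Lambda> \<gamma>, folded U] types siklos by blast
next
  have \<Lambda>: "\<Lambda> = 3 * L * (px\<^sup>2 + py\<^sup>2)" 
  proof -
    have "3 * (\<Lambda> / (3 * P)) * P = \<Lambda>" if "P \<noteq> 0" for P :: real using that by simp
    from this[OF assms(8)] show ?thesis unfolding assms(9) by simp
  qed
  have \<gamma>: "\<gamma>' = - 8 * \<beta>' * \<Lambda>" using assms(2,4) by simp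
  \<comment> \<open>\<open>\<gamma>' \<noteq> 0\<close> makes \<Lambda>, and with it L,
    nonzero.\<close>
  have L0: "L \<noteq> 0" using \<Lambda> \<gamma> assms(3) by auto
  fix K :: real and q :: complex
  assume K: "K > 0" and q: "q ^ 4 = of_real L"
  define k where "k = root 4 K"
  have k: "k > 0" "k ^ 4 = K" using K by (simp_all add: k_def)
  obtain \<eta> \<delta> \<epsilon> \<kappa> where E: "lemniscate_ray \<eta> \<delta>" "\<epsilon> ^ 4 = 1" "\<kappa> > 0" "q = \<epsilon> * \<eta> * of_real \<kappa>" "L = \<delta> * \<kappa> ^ 4" "\<delta> = sgn L"
    by (rule fourth_root_ray[OF q L0]) blast
  interpret lemniscate_ray \<eta> \<delta> by fact
  have \<epsilon>: "\<epsilon> \<noteq> 0" using E(2) by auto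
  define w where "w t = k / \<kappa> * f (k * \<kappa> * (t - c))" for t
  interpret C: conformal_seed F G D pu px py L K w "\<lambda>t. k * \<kappa> * f' (k * \<kappa> * (t - c)) / f (k * \<kappa> * (t - c))"
    "{t. f (k * \<kappa> * (t - c)) \<noteq> 0}"
    using conformal_seed_sn[OF assms(5-7) k(1) E(3), of c] unfolding w_def[abs_def] k(2) E(5) .
  let ?arg = "\<lambda>t::real. of_real (root 4 K) * q * of_real (t - c)"
  have arg: "?arg t = \<epsilon> * (\<eta> * of_real (k * \<kappa> * (t - c)))" for t
    unfolding E(4) k_def[symmetric] by simp
  have S: "jacobi_sn (?arg t) (-1) = \<epsilon> * (\<eta> * of_real (f (k * \<kappa> * (t - c))))"
    and pole: "sn_pole (?arg t) (-1) \<longleftrightarrow> \<not> reg (k * \<kappa> * (t - c))" for t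
    unfolding arg jacobi_sn_eq_sn_quot sn_pole_eq sn_quot_rotate[OF E(2)] sn_quot_ray reg_def by simp_all
  have S0: "jacobi_sn (?arg t) (-1) = 0 \<longleftrightarrow> f (k * \<kappa> * (t - c)) = 0" for t
    unfolding S using \<epsilon> \<eta>_nz by simp
  \<comment> \<open>The phases \<open>\<epsilon>\<close> and \<open>\<eta>\<close> of
    \<open>1 / q\<close> and of sn cancel, which is why the factor is real.\<close>
  have \<Omega>C: "of_real (root 4 K) * (1 / q) * jacobi_sn (?arg t) (-1) = complex_of_real (w t)" for t
    unfolding S unfolding E(4) k_def[symmetric] w_def using \<epsilon> \<eta>_nz E(3) by (simp add: field_simps)
  let ?g = "conformal (\<lambda>p. w (lin pu px py p)) (seed_metric F G)"
  let ?U = "{p. zeta p \<in> D \<and> lin pu px py p \<in> {t. f (k * \<kappa> * (t - c)) \<noteq> 0}}"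
  let ?Z = "{t. reg (k * \<kappa> * (t - c)) \<and> f (k * \<kappa> * (t - c)) = 0}"
  have U: "{p. zeta p \<in> D \<and> \<not> sn_pole (?arg (lin pu px py p)) (-1) \<and> jacobi_sn (?arg (lin pu px py p)) (-1) \<noteq> 0} = ?U"
    unfolding pole S0 using f_not_reg by auto
  have Z: "{t. \<not> sn_pole (?arg t) (-1) \<and> jacobi_sn (?arg t) (-1) = 0} = ?Z"
    unfolding pole S0 by simp
  have types: "(weyl ?g p \<noteq> (\<lambda>_ _ _ _. 0) \<longrightarrow> weyl_boost_order ?g p d_r (-2) \<and> weyl_type_N ?g p)
           \<and> (weyl ?g p = (\<lambda>_ _ _ _. 0) \<longleftrightarrow>
                deriv (deriv F) (zeta p) + cnj (zeta p) * deriv (deriv G) (zeta p) = 0)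
           \<and> ricci_boost_order ?g p d_r 0 \<and> traceless_ricci_type_II ?g p
           \<and> ricci_scalar ?g p = 4 * \<Lambda>
           \<and> complex_of_real (ricci_square ?g p) =
               1 / 12 * of_real ((ricci_scalar ?g p)\<^sup>2) * (3 + 1 / jacobi_sn (?arg (lin pu px py p)) (-1) ^ 8)"
    if p: "p \<in> ?U" for p
  proof -
    define s where "s = f (k * \<kappa> * (lin pu px py p - c))"
    have s: "s \<noteq> 0" using p by (simp add: s_def)
    have R: "ricci_scalar ?g p = 4 * \<Lambda>" using C.ricci_scalar_eq[OF p] \<Lambda> by simp
    \<comment> \<open>The eighth power removes both phases, as \<open>\<epsilon>^4 = 1\<close> and
      \<open>\<eta>^8 = \<delta>^2 = 1\<close>.\<close>
    have "(\<epsilon> * (\<eta> * of_real s)) ^ 8 = (\<epsilon> ^ 4) ^ 2 * (\<eta> ^ 4) ^ 2 * complex_of_real s ^ 8"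
      by (simp add: power_mult_distrib power_mult[symmetric])
    also have "\<dots> = complex_of_real (s ^ 8)" unfolding E(2) \<eta>4 using \<delta>_cases by auto
    finally have S8: "jacobi_sn (?arg (lin pu px py p)) (-1) ^ 8 = complex_of_real (s ^ 8)"
      unfolding S s_def .
    have \<delta>2: "\<delta>\<^sup>2 = 1" using \<delta>_cases by auto
    have "w (lin pu px py p) ^ 8 = K\<^sup>2 / \<kappa> ^ 8 * s ^ 8"
      unfolding w_def s_def[symmetric] k(2)[symmetric] by (simp add: power_mult_distrib power_divide power_mult[symmetric])
    moreover have "L\<^sup>2 = \<kappa> ^ 8" unfolding E(5) power_mult_distrib \<delta>2 by (simp add: power_mult[symmetric])
    \<comment> \<open>K cancels because \<open>w^8 = K^2 s^8 / \<kappa>^8\<close> and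
      \<open>\<kappa>^8 = L^2\<close>.\<close>
    ultimately have Kw: "K\<^sup>2 / w (lin pu px py p) ^ 8 = L\<^sup>2 * (1 / s ^ 8)" using K E(3) s by simp
    have "12 * K\<^sup>2 * A / B = 12 * A * (K\<^sup>2 / B)" for A B :: real by simp
    then have "ricci_square ?g p = 36 * L\<^sup>2 * (px\<^sup>2 + py\<^sup>2)\<^sup>2 + 12 * (px\<^sup>2 + py\<^sup>2)\<^sup>2 * (L\<^sup>2 * (1 / s ^ 8))"
      unfolding C.ricci_square_eq[OF p] Kw[symmetric] by simp
    also have "36 * L\<^sup>2 * A\<^sup>2 + 12 * A\<^sup>2 * (L\<^sup>2 * B) = 1 / 12 * (4 * (3 * L * A))\<^sup>2 * (3 + B)" for A B :: real
      by (simp add: power2_eq_square algebra_simps)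
    finally have RR: "ricci_square ?g p = 1 / 12 * (4 * \<Lambda>)\<^sup>2 * (3 + 1 / s ^ 8)"
      unfolding \<Lambda> .
    have RS: "complex_of_real (ricci_square ?g p) =
               1 / 12 * of_real ((ricci_scalar ?g p)\<^sup>2) * (3 + 1 / jacobi_sn (?arg (lin pu px py p)) (-1) ^ 8)"
      unfolding R S8 RR by simp
    have "K \<noteq> 0" using K by simp
    then show ?thesis
      using C.weyl_type_N[OF p] C.weyl_eq_0_iff[OF p] C.traceless_ricci_type_II[OF p _ assms(8)] R RS
      unfolding weyl_type_N_def traceless_ricci_type_II_def by blast
  qed
  have sing: "curvature_singularity ?U (ricci_square ?g) x" if x: "zeta x \<in> D" "lin pu px py x \<in> ?Z" for x
  proof (rule C.curvature_singularity)
    let ?t = "lin pu px py x"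
    have r: "reg (k * \<kappa> * (?t - c))" "f (k * \<kappa> * (?t - c)) = 0" using x(2) by auto
    have f: "isCont f (k * \<kappa> * (?t - c))" by (rule DERIV_isCont[OF deriv_ray(2)[OF r(1)]])
    have "isCont (\<lambda>t. k * \<kappa> * (t - c)) ?t" by (intro continuous_intros)
    from isCont_o2[OF this f] have "isCont (\<lambda>t. f (k * \<kappa> * (t - c))) ?t" .
    then show "isCont w ?t" unfolding w_def[abs_def] by (intro continuous_intros)
    show "w ?t = 0" "?t \<notin> {t. f (k * \<kappa> * (t - c)) \<noteq> 0}" using r by (simp_all add: w_def)
    have "((\<lambda>t. k * \<kappa> * (t - c)) \<longlongrightarrow> k * \<kappa> * (?t - c)) (at ?t)" by (intro tendsto_intros)
    moreover have "eventually (\<lambda>t. k * \<kappa> * (t - c) \<noteq> k * \<kappa> * (?t - c)) (at ?t)"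
      using k(1) E(3) by (auto simp: eventually_at_filter)
    ultimately have "filterlim (\<lambda>t. k * \<kappa> * (t - c)) (at (k * \<kappa> * (?t - c))) (at ?t)" by (simp add: filterlim_at)
    from eventually_compose_filterlim[OF zero_isolated[OF r] this]
    show "eventually (\<lambda>t. t \<in> {t. f (k * \<kappa> * (t - c)) \<noteq> 0}) (at ?t)" by simp
  qed (use x K assms(8) in auto)
  obtain P where P: "least_period f P"
    "\<And>x. reg x \<and> f x = 0 \<longleftrightarrow> (\<exists>n::int. x = (if \<delta> = 1 then of_int n * P / 2 else of_int n * P))"
    by (rule zeros_and_period) blast
  \<comment> \<open>The argument of \<open>f\<close> runs with speed \<open>k * \<kappa>\<close>, so
    a period in t is that of \<open>f\<close> divided by it.\<close>
  let ?P = "P / (k * \<kappa>)"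
  have k\<kappa>: "k * \<kappa> > 0" using k(1) E(3) by simp
  have "least_period (\<lambda>t. jacobi_sn (?arg t) (-1)) ?P"
    unfolding least_period_def S
  proof (intro conjI allI impI)
    show "0 < ?P" using P(1) k\<kappa> by (simp add: least_period_def)
    have "k * \<kappa> * (t + ?P - c) = k * \<kappa> * (t - c) + P" for t using k\<kappa> k(1) E(3) by (simp add: field_simps)
    then show "\<epsilon> * (\<eta> * complex_of_real (f (k * \<kappa> * (t + ?P - c)))) = \<epsilon> * (\<eta> * complex_of_real (f (k * \<kappa> * (t - c))))" for t
      using P(1) by (simp add: least_period_def)
    fix Q assume Q: "0 < Q \<and> Q < ?P"
    then have "0 < k * \<kappa> * Q" "k * \<kappa> * Q < P" using k\<kappa> k(1) E(3) by (simp_all add: field_simps)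
    then obtain s where s: "f (s + k * \<kappa> * Q) \<noteq> f s" using P(1) unfolding least_period_def by blast
    define t where "t = s / (k * \<kappa>) + c"
    have t: "k * \<kappa> * (t + Q - c) = s + k * \<kappa> * Q" "k * \<kappa> * (t - c) = s"
      using k\<kappa> k(1) E(3) by (simp_all add: t_def field_simps)
    show "\<exists>t. \<epsilon> * (\<eta> * complex_of_real (f (k * \<kappa> * (t + Q - c)))) \<noteq> \<epsilon> * (\<eta> * complex_of_real (f (k * \<kappa> * (t - c))))"
      using s \<epsilon> \<eta>_nz by (intro exI[of _ t]) (simp only: t mult_cancel_left of_real_eq_iff, simp)
  qed
  moreover have Zeq: "?Z = (if L > 0 then {c + of_int n * ?P / 2 | n. True} else {c + of_int n * ?P | n. True})"
  proof -
    have \<delta>: "\<delta> = 1 \<longleftrightarrow> L > 0" unfolding E(6) by (auto simp: sgn_if)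
    have t: "k * \<kappa> * (t - c) = r \<longleftrightarrow> t = c + r / (k * \<kappa>)" for t r
      using k(1) E(3) by (auto simp: field_simps)
    have "c + (if \<delta> = 1 then of_int n * P / 2 else of_int n * P) / (k * \<kappa>)
        = (if L > 0 then c + of_int n * ?P / 2 else c + of_int n * ?P)" for n :: int
      unfolding \<delta> by simp
    then show ?thesis unfolding P(2) t by auto
  qed
  moreover have "c \<in> ?Z" using at_0 by simp
  moreover have "c + ?P \<in> ?Z"
    \<comment> \<open>For L > 0 the zeros are half a period apart and c + P is the second one after
      c; for L < 0 it is the first.\<close>
    unfolding Zeq by (auto intro: exI[of _ "2::int"] exI[of _ "1::int"])
  ultimately have per: "\<exists>P. least_period (\<lambda>t. jacobi_sn (?arg t) (-1)) P \<and> c \<in> ?Z \<and> c + P \<in> ?Z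
      \<and> ?Z = (if L > 0 then {c + of_int n * P / 2 | n. True} else {c + of_int n * P | n. True})"
    by blast
  show "let z = lin pu px py;
           arg = ?arg;
           S = (\<lambda>t. jacobi_sn (arg t) (-1));
           \<Omega>C = (\<lambda>t. of_real (root 4 K) * (1 / q) * S t);
           \<Omega> = (\<lambda>t. Re (\<Omega>C t));
           U = {p. zeta p \<in> D \<and> \<not> sn_pole (arg (z p)) (-1) \<and> S (z p) \<noteq> 0};
           Z = {t. \<not> sn_pole (arg t) (-1) \<and> S t = 0};
           g = conformal (\<lambda>p. \<Omega> (z p)) (seed_metric F G)
       in (\<forall>t. \<Omega>C t \<in> \<real>)
        \<and> quadratic_gravity_vacuum \<alpha>' \<beta>' \<gamma>' \<Lambda> U g
        \<and> (\<forall>p\<in>U.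
             (weyl g p \<noteq> (\<lambda>_ _ _ _. 0) \<longrightarrow> weyl_boost_order g p d_r (-2) \<and> weyl_type_N g p)
           \<and> (weyl g p = (\<lambda>_ _ _ _. 0) \<longleftrightarrow>
                deriv (deriv F) (zeta p) + cnj (zeta p) * deriv (deriv G) (zeta p) = 0)
           \<and> ricci_boost_order g p d_r 0 \<and> traceless_ricci_type_II g p
           \<and> ricci_scalar g p = 4 * \<Lambda>
           \<and> complex_of_real (ricci_square g p) =
               1 / 12 * of_real ((ricci_scalar g p)\<^sup>2) * (3 + 1 / S (z p) ^ 8))
        \<and> (\<forall>x. zeta x \<in> D \<and> z x \<in> Z \<longrightarrow> curvature_singularity U (ricci_square g) x)
        \<and> (\<exists>P. least_period S P \<and> c \<in> Z \<and> c + P \<in> Z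
             \<and> Z = (if L > 0 then {c + of_int n * P / 2 | n. True}
                    else {c + of_int n * P | n. True}))"
    unfolding Let_def U Z \<Omega>C Re_complex_of_real
    using C.quadratic_gravity[OF \<Lambda> \<gamma>] types sing per by (intro conjI) (blast | simp)+
qed

end
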